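(* Let $0<\alpha<1$ and let $\Omega\in L^1(\log L)^{\frac1{n'}}(\mathbb S^{n-1})$ have mean zero. Then $$T_{\Omega,\alpha}:\dot W^{1,p}(\mathbb R^n)\to L^q(\mathbb R^n)\qquad\text{for } n<p<\frac n\alpha,\ \ \frac1q=\frac1p-\frac\alpha n,$$ and $$T_{\Omega,\alpha}:\dot W^{1,n}(\mathbb R^n)\to L^{\frac n{1-\alpha},\infty}(\mathbb R^n).$$
   Context: $n$ is a positive integer and $\frac1{n'}=1-\frac1n$. $\sigma=\mathcal H^{n-1}$ is surface measure on $\mathbb S^{n-1}$; "mean zero" means $\int_{\mathbb S^{n-1}}\Omega\,d\sigma=0$. $L^1(\log L)^{\frac1{n'}}(\mathbb S^{n-1})$ is the Orlicz space on $(\mathbb S^{n-1},\sigma)$ associated with $\Psi(t)=t\,(\log(1+t))^{\frac1{n'}}$. $T_{\Omega,\alpha}f(x)=\mathrm{p.v.}\int_{\mathbb R^n}\frac{\Omega(y')}{|y|^{n+1-\alpha}}f(x-y)\,dy=\lim_{\varepsilon\to0^+}\int_{|y|>\varepsilon}\frac{\Omega(y')}{|y|^{n+1-\alpha}}f(x-y)\,dy$, with $y'=y/|y|$. The homogeneous Sobolev space $\dot W^{1,p}(\mathbb R^n)$ is the closure of $C_c^\infty(\mathbb R^n)$ with respect to the seminorm $\|\nabla f\|_{L^p(\mathbb R^n)}$. For a quasi-normed space $X$ of functions, the boundedness $T:\dot W^{1,p}(\mathbb R^n)\to X$ means that there is a constant $C$ with $\|Tf\|_X\le C\|\nabla f\|_{L^p(\mathbb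 R^n)}$ for all $f\in C_c^\infty(\mathbb R^n)$. Finally, $\|g\|_{L^{q,\infty}(\mathbb R^n)}=\sup_{t>0}t\,|\{x:|g(x)|>t\}|^{1/q}$. *)

theory Defs
  imports "HOL-Analysis.Analysis"
begin

section \<open>Hausdorff measure and surface measure on the unit sphere\<close>

text \<open>
  Covering sets are weighted by the volume of the \<open>m\<close>-dimensional ball of the same diameter. The
  empty set is singled out because \<open>0 ^ 0 = 1\<close>; thus \<open>m = 0\<close> gives the counting measure. Boundedness
  of the covering sets is required because \<^const>\<open>diameter\<close> is unspecified on unbounded sets.
\<close>

definition hausdorff_weight :: "nat \<Rightarrow> 'a::metric_space set \<Rightarrow> ennreal" where
  "hausdorff_weight m U =
     (if U = {} then 0 else ennreal (unit_ball_vol (real m) * (diameter U / 2) ^ m))"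

definition hausdorff_covers :: "real \<Rightarrow> 'a::metric_space set \<Rightarrow> (nat \<Rightarrow> 'a set) set" where
  "hausdorff_covers \<delta> A = {U. A \<subseteq> (\<Union>i. U i) \<and> (\<forall>i. bounded (U i) \<and> diameter (U i) \<le> \<delta>)}"

definition hausdorff_content :: "nat \<Rightarrow> real \<Rightarrow> 'a::metric_space set \<Rightarrow> ennreal" where
  "hausdorff_content m \<delta> A = (INF U\<in>hausdorff_covers \<delta> A. \<Sum>i. hausdorff_weight m (U i))"

definition hausdorff_outer :: "nat \<Rightarrow> 'a::metric_space set \<Rightarrow> ennreal" where
  "hausdorff_outer m A = (SUP \<delta>\<in>{0<..}. hausdorff_content m \<delta> A)"

definition hausdorff_measure :: "nat \<Rightarrow> 'a::metric_space measure" where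
  "hausdorff_measure m = measure_of UNIV (sets borel) (hausdorff_outer m)"

text \<open>
  \<^const>\<open>hausdorff_outer\<close> is a metric outer measure, so it is countably additive on the Borel sets and
  \<^const>\<open>hausdorff_measure\<close> is not the null measure that \<^const>\<open>measure_of\<close> yields otherwise.
\<close>

lemma hausdorff_weight_empty [simp]: "hausdorff_weight m {} = 0"
  by (simp add: hausdorff_weight_def)

lemma hausdorff_content_mono: "A \<subseteq> B \<Longrightarrow> hausdorff_content m \<delta> A \<le> hausdorff_content m \<delta> B"
  unfolding hausdorff_content_def by (rule INF_superset_mono) (auto simp: hausdorff_covers_def)

lemma hausdorff_content_antimono: "\<delta> \<le> \<delta>' \<Longrightarrow> hausdorff_content m \<delta>' A \<le> hausdorff_content m \<delta> A"
  unfolding hausdorff_content_def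
  by (rule INF_superset_mono) (auto simp: hausdorff_covers_def intro: order_trans)

lemma hausdorff_content_le: "U \<in> hausdorff_covers \<delta> A \<Longrightarrow>
    hausdorff_content m \<delta> A \<le> (\<Sum>i. hausdorff_weight m (U i))"
  unfolding hausdorff_content_def by (rule INF_lower)

lemma hausdorff_content_le_outer: "\<delta> > 0 \<Longrightarrow> hausdorff_content m \<delta> A \<le> hausdorff_outer m A"
  unfolding hausdorff_outer_def by (rule SUP_upper) auto

lemma hausdorff_outer_mono: "A \<subseteq> B \<Longrightarrow> hausdorff_outer m A \<le> hausdorff_outer m B"
  unfolding hausdorff_outer_def by (rule SUP_mono) (auto intro: hausdorff_content_mono)

lemma hausdorff_outer_empty [simp]: "hausdorff_outer m {} = 0"
proof -
  have "hausdorff_content m \<delta> {} \<le> 0" if "\<delta> > 0" for \<delta>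
    using hausdorff_content_le[of "\<lambda>_. {}" \<delta> "{}" m] that by (simp add: hausdorff_covers_def diameter_def)
  thus ?thesis unfolding hausdorff_outer_def
    by (intro antisym SUP_least) auto
qed

lemma hausdorff_content_subadd:
  assumes "\<delta> > 0"
  shows "hausdorff_content m \<delta> (\<Union>i. A i) \<le> (\<Sum>i. hausdorff_content m \<delta> (A i))"
proof (rule ennreal_le_epsilon)
  fix e :: real assume e: "e > 0" and fin: "(\<Sum>i. hausdorff_content m \<delta> (A i)) < top"
  have ex: "\<exists>U\<in>hausdorff_covers \<delta> (A i). (\<Sum>j. hausdorff_weight m (U j)) <
      hausdorff_content m \<delta> (A i) + ennreal (e * (1/2)^Suc i)" for i
  proof -
    have "hausdorff_content m \<delta> (A i) < top"
      using fin by (metis ennreal_suminf_lessD)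
    moreover have "e * (1/2)^Suc i > 0" using e by simp
    ultimately have "hausdorff_content m \<delta> (A i) < hausdorff_content m \<delta> (A i) + ennreal (e * (1/2)^Suc i)"
      by (simp add: ennreal_less_zero_iff less_top)
    thus ?thesis
      by (subst (asm) (1) hausdorff_content_def) (auto simp: INF_less_iff)
  qed
  then obtain U where U: "\<And>i. U i \<in> hausdorff_covers \<delta> (A i)"
    and U2: "\<And>i. (\<Sum>j. hausdorff_weight m (U i j)) <
      hausdorff_content m \<delta> (A i) + ennreal (e * (1/2)^Suc i)" by metis
  define V where "V = (\<lambda>k. case prod_decode k of (i,j) \<Rightarrow> U i j)"
  have "V \<in> hausdorff_covers \<delta> (\<Union>i. A i)"
    unfolding hausdorff_covers_def
  proof (safe)
    fix x i assume "x \<in> A i"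
    then obtain j where "x \<in> U i j" using U[of i] by (auto simp: hausdorff_covers_def)
    hence "x \<in> V (prod_encode (i,j))" by (simp add: V_def)
    thus "x \<in> (\<Union>i. V i)" by blast
  next
    fix k show "bounded (V k)" using U by (auto simp: V_def hausdorff_covers_def split: prod.split)
    show "diameter (V k) \<le> \<delta>" using U by (auto simp: V_def hausdorff_covers_def split: prod.split)
  qed
  hence "hausdorff_content m \<delta> (\<Union>i. A i) \<le> (\<Sum>k. hausdorff_weight m (V k))" by (rule hausdorff_content_le)
  also have "\<dots> = (\<Sum>i. \<Sum>j. hausdorff_weight m (U i j))"
    using suminf_ennreal_2dimen[of "\<lambda>i. \<Sum>j. hausdorff_weight m (U i j)" "\<lambda>(i,j). hausdorff_weight m (U i j)"]
    by (simp add: V_def comp_def case_prod_unfold)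
  also have "\<dots> \<le> (\<Sum>i. hausdorff_content m \<delta> (A i) + ennreal (e * (1/2)^Suc i))"
    by (intro suminf_le less_imp_le[OF U2]) auto
  also have "\<dots> = (\<Sum>i. hausdorff_content m \<delta> (A i)) + (\<Sum>i. ennreal (e * (1/2)^Suc i))"
    by (simp add: suminf_add)
  also have "(\<Sum>i. ennreal (e * (1/2)^Suc i)) = ennreal e"
    using sums_mult[OF power_half_series, of e] e 
    by (intro suminf_ennreal_eq) auto
  finally show "hausdorff_content m \<delta> (\<Union>i. A i) \<le> (\<Sum>i. hausdorff_content m \<delta> (A i)) + ennreal e" .
qed

lemma hausdorff_outer_subadd: "hausdorff_outer m (\<Union>i. A i) \<le> (\<Sum>i. hausdorff_outer m (A i))"
  unfolding hausdorff_outer_def[of m "\<Union>i. A i"]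
proof (rule SUP_least)
  fix \<delta> :: real assume "\<delta> \<in> {0<..}"
  hence d: "\<delta> > 0" by simp
  show "hausdorff_content m \<delta> (\<Union>i. A i) \<le> (\<Sum>i. hausdorff_outer m (A i))"
    by (rule order_trans[OF hausdorff_content_subadd[OF d]]) (intro suminf_le hausdorff_content_le_outer d; simp)
qed

lemma outer_measure_space_hausdorff: "outer_measure_space (Pow UNIV) (hausdorff_outer m)"
  unfolding outer_measure_space_def positive_def increasing_def countably_subadditive_def
  by (auto intro: hausdorff_outer_mono hausdorff_outer_subadd)

lemma hausdorff_outer_Un: "hausdorff_outer m (A \<union> B) \<le> hausdorff_outer m A + hausdorff_outer m B"
proof -
  have "(\<Union>i. if i = (0::nat) then A else if i = 1 then B else {}) = A \<union> B"
    by (auto split: if_splits)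
  moreover have "(\<Sum>i. hausdorff_outer m (if i = (0::nat) then A else if i = 1 then B else {})) =
     (\<Sum>i\<in>{0,1}. hausdorff_outer m (if i = (0::nat) then A else if i = 1 then B else {}))"
    by (rule suminf_finite) auto
  ultimately show ?thesis 
    using hausdorff_outer_subadd[of m "\<lambda>i. if i = (0::nat) then A else if i = 1 then B else {}"] by simp
qed

lemma hausdorff_outer_metric:
  assumes d: "d > 0" and sep: "\<And>x y. x \<in> A \<Longrightarrow> y \<in> B \<Longrightarrow> dist x y \<ge> d"
  shows "hausdorff_outer m A + hausdorff_outer m B \<le> hausdorff_outer m (A \<union> B)"
proof -
  have *: "hausdorff_content m \<delta> A + hausdorff_content m \<delta> B \<le> hausdorff_content m \<delta> (A \<union> B)"
    if "\<delta> < d" "\<delta> > 0" for \<delta>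
    unfolding hausdorff_content_def[of m \<delta> "A \<union> B"]
  proof (rule INF_greatest)
    fix U assume U: "U \<in> hausdorff_covers \<delta> (A \<union> B)"
    define V where "V = (\<lambda>i. if U i \<inter> A = {} then {} else U i)"
    define W where "W = (\<lambda>i. if U i \<inter> B = {} then {} else U i)"
    have z: "0 \<le> \<delta>" using that by simp
    have V: "V \<in> hausdorff_covers \<delta> A"
      using U z by (fastforce simp: hausdorff_covers_def V_def subset_iff)
    have W: "W \<in> hausdorff_covers \<delta> B"
      using U z by (fastforce simp: hausdorff_covers_def W_def subset_iff)
    have le: "hausdorff_weight m (V i) + hausdorff_weight m (W i) \<le> hausdorff_weight m (U i)" for i
    proof (cases "U i \<inter> A = {} \<or> U i \<inter> B = {}")
      case False
      then obtain x y where "x \<in> U i" "x \<in> A" "y \<in> U i" "y \<in> B" by blast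
      moreover have "bounded (U i)" "diameter (U i) \<le> \<delta>" using U by (auto simp: hausdorff_covers_def)
      ultimately have "dist x y \<le> \<delta>" "dist x y \<ge> d"
        using diameter_bounded_bound[of "U i" x y] sep by (auto intro: order_trans)
      thus ?thesis using that by linarith
    qed (auto simp: V_def W_def)
    have "hausdorff_content m \<delta> A + hausdorff_content m \<delta> B \<le>
      (\<Sum>i. hausdorff_weight m (V i)) + (\<Sum>i. hausdorff_weight m (W i))"
      by (intro add_mono hausdorff_content_le V W)
    also have "\<dots> = (\<Sum>i. hausdorff_weight m (V i) + hausdorff_weight m (W i))"
      by (simp add: suminf_add)
    also have "\<dots> \<le> (\<Sum>i. hausdorff_weight m (U i))"
      by (intro suminf_le le) auto
    finally show "hausdorff_content m \<delta> A + hausdorff_content m \<delta> B \<le> (\<Sum>i. hausdorff_weight m (U i))" .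
  qed
  have "hausdorff_outer m A + hausdorff_outer m B =
     (SUP \<delta>\<in>{0<..}. hausdorff_content m \<delta> A + hausdorff_content m \<delta> B)"
    unfolding hausdorff_outer_def
  proof (rule SUP_add_directed_ennreal[symmetric])
    fix i j :: real assume "i \<in> {0<..}" "j \<in> {0<..}"
    then show "\<exists>k\<in>{0<..}. hausdorff_content m i A + hausdorff_content m j B \<le>
        hausdorff_content m k A + hausdorff_content m k B"
      by (intro bexI[of _ "min i j"] add_mono hausdorff_content_antimono) auto
  qed
  also have "\<dots> \<le> hausdorff_outer m (A \<union> B)"
  proof (rule SUP_least)
    fix \<delta> :: real assume "\<delta> \<in> {0<..}"
    define \<delta>' where "\<delta>' = min \<delta> (d/2)"
    have \<delta>': "\<delta>' > 0" "\<delta>' < d" "\<delta>' \<le> \<delta>" using d \<open>\<delta> \<in> _\<close> by (auto simp: \<delta>'_def)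
    have "hausdorff_content m \<delta> A + hausdorff_content m \<delta> B \<le> hausdorff_content m \<delta>' A + hausdorff_content m \<delta>' B"
      by (intro add_mono hausdorff_content_antimono \<delta>')
    also have "\<dots> \<le> hausdorff_content m \<delta>' (A \<union> B)" by (intro * \<delta>')
    also have "\<dots> \<le> hausdorff_outer m (A \<union> B)" by (intro hausdorff_content_le_outer \<delta>')
    finally show "hausdorff_content m \<delta> A + hausdorff_content m \<delta> B \<le> hausdorff_outer m (A \<union> B)" .
  qed
  finally show ?thesis .
qed

lemma hausdorff_outer_metric_sum:
  fixes R :: "nat \<Rightarrow> 'a::metric_space set"
  assumes "\<And>k. \<exists>d>0. \<forall>x\<in>(\<Union>j<k. R j). \<forall>y\<in>R k. dist x y \<ge> d"
  shows "(\<Sum>j<k. hausdorff_outer m (R j)) \<le> hausdorff_outer m (\<Union>j<k. R j)"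
proof (induction k)
  case (Suc k)
  obtain d where d: "d > 0" "\<And>x y. x\<in>(\<Union>j<k. R j) \<Longrightarrow> y\<in>R k \<Longrightarrow> dist x y \<ge> d" using assms by meson
  have "(\<Sum>j<Suc k. hausdorff_outer m (R j)) \<le> hausdorff_outer m (\<Union>j<k. R j) + hausdorff_outer m (R k)"
    using Suc by (simp add: add_right_mono)
  also have "\<dots> \<le> hausdorff_outer m ((\<Union>j<k. R j) \<union> R k)" by (rule hausdorff_outer_metric[OF d])
  also have "(\<Union>j<k. R j) \<union> R k = (\<Union>j<Suc k. R j)" by (simp add: lessThan_Suc Un_commute)
  finally show ?case .
qed simp

lemma closed_in_lambda_system:
  assumes "closed F"
  shows "F \<in> lambda_system UNIV (Pow UNIV) (hausdorff_outer m)"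
proof -
  interpret algebra UNIV "Pow (UNIV::'a set)" by (rule algebra_Pow)
  let ?H = "hausdorff_outer m"
  have key: "?H (T \<inter> F) + ?H (T - F) \<le> ?H T" for T
  proof (cases "F = {} \<or> ?H T = top")
    case True thus ?thesis by auto
  next
    case False
    hence F: "F \<noteq> {}" and fin: "?H T < top" by (auto simp: less_top)
    define S where "S = (\<lambda>k::nat. {x\<in>T. infdist x F \<ge> 1 / real (Suc k)})"
    define R where "R = (\<lambda>k. S (Suc k) - S k)"
    have ST: "S k \<subseteq> T" for k by (auto simp: S_def)
    have RT: "R k \<subseteq> T" for k by (auto simp: R_def S_def)
    have step: "?H (T \<inter> F) + ?H (S k) \<le> ?H T" for k
    proof -
      have "?H (T \<inter> F) + ?H (S k) \<le> ?H ((T \<inter> F) \<union> S k)"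
      proof (rule hausdorff_outer_metric[of "1 / real (Suc k)"])
        fix x y assume "x \<in> T \<inter> F" "y \<in> S k"
        thus "1 / real (Suc k) \<le> dist x y"
          using infdist_le[of x F y] by (auto simp: S_def dist_commute)
      qed simp
      also have "\<dots> \<le> ?H T" by (intro hausdorff_outer_mono) (use ST in auto)
      finally show ?thesis .
    qed
    have sep: "\<exists>d>0. \<forall>i j. \<forall>x\<in>R i. \<forall>y\<in>R j. i + 2 \<le> j \<and> j \<le> k \<longrightarrow> dist x y \<ge> d" for k
    proof (intro exI conjI allI ballI impI)
      have "1 / real (Suc (Suc k)) < 1 / real (Suc k)" by (intro divide_strict_left_mono) auto
      thus "1 / real (Suc k) - 1 / real (Suc (Suc k)) > 0" by simp
      fix i j x y assume a: "x \<in> R i" "y \<in> R j" "i + 2 \<le> j \<and> j \<le> k"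
      have x: "infdist x F \<ge> 1 / real (Suc (Suc i))" using a by (auto simp: R_def S_def)
      have y: "infdist y F < 1 / real (Suc j)" using a by (auto simp: R_def S_def)
      have "1 / real (Suc j) \<le> 1 / real (Suc (Suc (Suc i)))"
        using a by (intro divide_left_mono) auto
      moreover have "1 / real (Suc k) - 1 / real (Suc (Suc k)) \<le> 1 / real (Suc (Suc i)) - 1 / real (Suc (Suc (Suc i)))"
      proof -
        have e: "1 / real (Suc p) - 1 / real (Suc (Suc p)) = 1 / (real (Suc p) * real (Suc (Suc p)))" for p
          by (simp add: field_simps)
        show ?thesis unfolding e using a by (intro divide_left_mono mult_mono) auto
      qed
      moreover have "infdist x F \<le> infdist y F + dist x y" by (rule infdist_triangle)
      ultimately show "1 / real (Suc k) - 1 / real (Suc (Suc k)) \<le> dist x y" using x y by linarith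
    qed
    have half: "(\<Sum>j<k. ?H (R (2 * j + p))) \<le> ?H T" for k p
    proof -
      have "(\<Sum>j<k. ?H (R (2 * j + p))) \<le> ?H (\<Union>j<k. R (2 * j + p))"
      proof (rule hausdorff_outer_metric_sum)
        fix k
        obtain d where d: "d > 0"
          "\<forall>i j. \<forall>x\<in>R i. \<forall>y\<in>R j. i + 2 \<le> j \<and> j \<le> 2 * k + p \<longrightarrow> dist x y \<ge> d"
          using sep[of "2*k+p"] by auto
        show "\<exists>d>0. \<forall>x\<in>\<Union>j<k. R (2 * j + p). \<forall>y\<in>R (2 * k + p). d \<le> dist x y"
        proof (intro exI[of _ d] conjI ballI)
          fix x y assume "x \<in> (\<Union>j<k. R (2 * j + p))" "y \<in> R (2 * k + p)"
          then obtain j where "j < k" "x \<in> R (2*j+p)" by auto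
          moreover have "2 * j + p + 2 \<le> 2 * k + p \<and> 2 * k + p \<le> 2 * k + p" using \<open>j < k\<close> by simp
          ultimately show "d \<le> dist x y" using d(2) \<open>y \<in> _\<close> by blast
        qed (use d in auto)
      qed
      also have "\<dots> \<le> ?H T" by (intro hausdorff_outer_mono) (use RT in auto)
      finally show ?thesis .
    qed
    have "(\<Sum>j<n. ?H (R j)) \<le> 2 * ?H T" for n
    proof -
      have "(\<Sum>j<n. ?H (R j)) \<le> (\<Sum>j<2*n. ?H (R j))" by (intro sum_mono2) auto
      also have "\<dots> = (\<Sum>j<n. ?H (R (2*j+0))) + (\<Sum>j<n. ?H (R (2*j+1)))"
        by (induction n) (auto simp: algebra_simps)
      also have "\<dots> \<le> ?H T + ?H T" by (intro add_mono half)
      finally show ?thesis by (simp add: mult_2)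
    qed
    hence "(\<Sum>j. ?H (R j)) \<le> 2 * ?H T" by (intro suminf_le_const) auto
    also have "\<dots> < top" using fin by (simp add: ennreal_mult_less_top)
    finally have sumfin: "(\<Sum>j. ?H (R j)) < top" .
    show ?thesis
    proof (rule ennreal_le_epsilon)
      fix e :: real assume e: "e > 0"
      have "(\<lambda>k. \<Sum>j. ?H (R (j + k))) \<longlonglongrightarrow> 0"
      proof -
        have "?H (R j) = ennreal (enn2real (?H (R j)))" for j
          using sumfin by (metis ennreal_suminf_lessD ennreal_enn2real)
        then obtain r where r: "\<And>j. r j \<ge> 0" "\<And>j. ?H (R j) = ennreal (r j)"
          by (rule that[OF enn2real_nonneg])
        have s: "summable r" 
          using sumfin r by (intro summable_suminf_not_top) auto
        have "(\<Sum>j. ?H (R (j + k))) = ennreal (\<Sum>j. r (j + k))" for k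
          unfolding r(2) using r(1) s by (intro suminf_ennreal2) (auto simp: summable_iff_shift)
        moreover have "(\<lambda>k. ennreal (\<Sum>j. r (j + k))) \<longlonglongrightarrow> ennreal 0"
          by (intro tendsto_ennrealI suminf_exist_split2 s)
        ultimately show ?thesis by simp
      qed
      hence "\<forall>\<^sub>F k in sequentially. (\<Sum>j. ?H (R (j + k))) < ennreal e"
        using e by (intro order_tendstoD) auto
      then obtain k where k: "(\<Sum>j. ?H (R (j + k))) < ennreal e"
        by (auto simp: eventually_sequentially)
      have "T - F \<subseteq> S k \<union> (\<Union>j. R (j + k))"
      proof
        fix x assume x: "x \<in> T - F"
        hence "infdist x F > 0" using \<open>closed F\<close> F by (simp add: infdist_pos_not_in_closed)
        then obtain N where "1 / real (Suc N) < infdist x F" using nat_approx_posE by blast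
        hence xN: "x \<in> S N" using x by (auto simp: S_def)
        show "x \<in> S k \<union> (\<Union>j. R (j + k))"
        proof (rule ccontr)
          assume n: "x \<notin> S k \<union> (\<Union>j. R (j + k))"
          have ns: "x \<notin> S (j + k)" for j
          proof (induction j)
            case (Suc j) 
            thus ?case using n by (auto simp: R_def)
          qed (use n in auto)
          have "S N \<subseteq> S (N + k)"
          proof
            fix y assume y: "y \<in> S N"
            have "1 / real (Suc (N+k)) \<le> 1 / real (Suc N)" by (intro divide_left_mono) auto
            thus "y \<in> S (N + k)" using y unfolding S_def by (auto intro: order_trans)
          qed
          thus False using ns xN by blast
        qed
      qed
      hence "?H (T - F) \<le> ?H (S k \<union> (\<Union>j. R (j + k)))" by (rule hausdorff_outer_mono)
      also have "\<dots> \<le> ?H (S k) + ?H (\<Union>j. R (j + k))" by (rule hausdorff_outer_Un)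
      also have "\<dots> \<le> ?H (S k) + (\<Sum>j. ?H (R (j + k)))" by (intro add_left_mono hausdorff_outer_subadd)
      also have "\<dots> \<le> ?H (S k) + ennreal e" using k by (intro add_left_mono) auto
      finally have "?H (T \<inter> F) + ?H (T - F) \<le> ?H (T \<inter> F) + (?H (S k) + ennreal e)"
        by (rule add_left_mono)
      also have "\<dots> \<le> ?H T + ennreal e" using step[of k] by (simp add: add.assoc[symmetric] add_right_mono)
      finally show "?H (T \<inter> F) + ?H (T - F) \<le> ?H T + ennreal e" .
    qed
  qed
  show ?thesis
    unfolding lambda_system_eq
  proof (safe; simp)
    fix x show "?H (x \<inter> F) + ?H (x - F) = ?H x"
    proof (rule antisym[OF key])
      have "?H x = ?H ((x \<inter> F) \<union> (x - F))" by (simp add: Int_Diff_Un)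
      also have "\<dots> \<le> ?H (x \<inter> F) + ?H (x - F)" by (rule hausdorff_outer_Un)
      finally show "?H x \<le> ?H (x \<inter> F) + ?H (x - F)" .
    qed
  qed
qed

lemma measure_space_hausdorff: "measure_space UNIV (sets borel) (hausdorff_outer m)"
proof -
  let ?L = "lambda_system UNIV (Pow UNIV) (hausdorff_outer m :: 'a set \<Rightarrow> ennreal)"
  interpret sigma_algebra UNIV "Pow (UNIV::'a set)" by (rule sigma_algebra_Pow)
  have ms: "measure_space UNIV ?L (hausdorff_outer m)"
    by (rule caratheodory_lemma[OF outer_measure_space_hausdorff])
  hence sa: "sigma_algebra UNIV ?L" by (simp add: measure_space_def)
  have "sets borel \<subseteq> ?L"
  proof -
    have "Collect closed \<subseteq> ?L" using closed_in_lambda_system by blast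
    hence "sigma_sets UNIV (Collect closed) \<subseteq> ?L"
      by (rule sigma_algebra.sigma_sets_subset[OF sa])
    thus ?thesis unfolding borel_eq_closed by (simp add: sets_measure_of)
  qed
  thus ?thesis using ms sets.sigma_algebra_axioms[of "borel :: 'a measure"]
    unfolding measure_space_def countably_additive_def by (auto simp: subset_iff positive_def)
qed

lemma space_hausdorff_measure [simp]: "space (hausdorff_measure m) = UNIV"
  by (simp add: hausdorff_measure_def space_measure_of_conv)

lemma sets_hausdorff_measure [simp, measurable_cong]: "sets (hausdorff_measure m) = sets borel"
  unfolding hausdorff_measure_def by (metis sets.sets_measure_of_eq space_borel)

lemma emeasure_hausdorff_measure:
  "A \<in> sets borel \<Longrightarrow> emeasure (hausdorff_measure m) A = hausdorff_outer m A"
  unfolding hausdorff_measure_def using measure_space_hausdorff[of m]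
  by (intro emeasure_measure_of_sigma) (auto simp: measure_space_def)

text \<open>
  The completion admits all measurable functions in the sense of Caratheodory, not only the Borel
  ones.
\<close>

definition sphere_measure :: "(real ^ 'n) measure" where
  "sphere_measure =
     completion (restrict_space (hausdorff_measure (CARD('n) - 1)) (sphere 0 1))"


section \<open>Function spaces\<close>

text \<open>The power \<open>x\<^sup>a\<close> of an extended nonnegative real, for \<open>a > 0\<close>.\<close>

definition ennreal_powr :: "ennreal \<Rightarrow> real \<Rightarrow> ennreal" where
  "ennreal_powr x a = (if x = \<infinity> then \<infinity> else ennreal (enn2real x powr a))"

definition Lp_norm :: "real \<Rightarrow> (real ^ 'n \<Rightarrow> 'b::real_normed_vector) \<Rightarrow> ennreal" where
  "Lp_norm p g = ennreal_powr (\<integral>\<^sup>+ x. ennreal (norm (g x) powr p) \<partial>lebesgue) (1 / p)"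

definition weak_Lp_norm :: "real \<Rightarrow> (real ^ 'n \<Rightarrow> 'b::real_normed_vector) \<Rightarrow> ennreal" where
  "weak_Lp_norm q g =
     (SUP t\<in>{0<..}. ennreal t * ennreal_powr (emeasure lebesgue {x. norm (g x) > t}) (1 / q))"

definition luxemburg_norm ::
    "'a measure \<Rightarrow> (real \<Rightarrow> real) \<Rightarrow> ('a \<Rightarrow> 'b::real_normed_vector) \<Rightarrow> ennreal" where
  "luxemburg_norm M \<Psi> f =
     Inf {ennreal c | c. c > 0 \<and> (\<integral>\<^sup>+ x. ennreal (\<Psi> (norm (f x) / c)) \<partial>M) \<le> 1}"

definition orlicz_space ::
    "'a measure \<Rightarrow> (real \<Rightarrow> real) \<Rightarrow> ('a \<Rightarrow> 'b::real_normed_vector) set" where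
  "orlicz_space M \<Psi> = {f \<in> borel_measurable M. luxemburg_norm M \<Psi> f < \<infinity>}"

definition L_log_L_sphere :: "real \<Rightarrow> (real ^ 'n \<Rightarrow> complex) set" where
  "L_log_L_sphere a = orlicz_space sphere_measure (\<lambda>t. t * ln (1 + t) powr a)"


section \<open>Test functions\<close>

definition partial_deriv :: "'n \<Rightarrow> (real ^ 'n \<Rightarrow> complex) \<Rightarrow> real ^ 'n \<Rightarrow> complex" where
  "partial_deriv i f x = frechet_derivative f (at x) (axis i 1)"

definition gradient :: "(real ^ 'n \<Rightarrow> complex) \<Rightarrow> real ^ 'n \<Rightarrow> complex ^ 'n" where
  "gradient f x = (\<chi> i. partial_deriv i f x)"

primrec Ck :: "nat \<Rightarrow> (real ^ 'n \<Rightarrow> complex) \<Rightarrow> bool" where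
  "Ck 0 f \<longleftrightarrow> continuous_on UNIV f"
| "Ck (Suc k) f \<longleftrightarrow> f differentiable_on UNIV \<and> (\<forall>i. Ck k (partial_deriv i f))"

definition Cc_infinity :: "(real ^ 'n \<Rightarrow> complex) set" where
  "Cc_infinity = {f. (\<forall>k. Ck k f) \<and> compact (closure {x. f x \<noteq> 0})}"


section \<open>The rough operator\<close>

text \<open>Note that \<open>sgn y = y / |y|\<close>.\<close>

definition rough_truncated ::
    "(real ^ 'n \<Rightarrow> complex) \<Rightarrow> real \<Rightarrow> real \<Rightarrow> (real ^ 'n \<Rightarrow> complex) \<Rightarrow> real ^ 'n \<Rightarrow> complex" where
  "rough_truncated \<Omega> \<alpha> \<epsilon> f x =
     (LINT y:{y. norm y > \<epsilon>}|lebesgue.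
        \<Omega> (sgn y) / complex_of_real (norm y powr (real CARD('n) + 1 - \<alpha>)) * f (x - y))"

definition rough_op ::
    "(real ^ 'n \<Rightarrow> complex) \<Rightarrow> real \<Rightarrow> (real ^ 'n \<Rightarrow> complex) \<Rightarrow> real ^ 'n \<Rightarrow> complex" where
  "rough_op \<Omega> \<alpha> f x = Lim (at_right 0) (\<lambda>\<epsilon>. rough_truncated \<Omega> \<alpha> \<epsilon> f x)"

text \<open>
  Boundedness of \<open>T\<close> from the homogeneous Sobolev space with exponent \<open>p\<close> into the space of
  measurable functions with finite quasi-norm \<open>N\<close>, tested on smooth compactly supported functions.
  Finiteness of \<open>N (T f)\<close> follows from the inequality, as the gradient of such a function has finite norm.
\<close>

definition bounded_from_sobolev ::
    "real \<Rightarrow> ((real ^ 'n \<Rightarrow> complex) \<Rightarrow> ennreal) \<Rightarrow>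
       ((real ^ 'n \<Rightarrow> complex) \<Rightarrow> real ^ 'n \<Rightarrow> complex) \<Rightarrow> bool" where
  "bounded_from_sobolev p N T \<longleftrightarrow>
     (\<exists>C::real. \<forall>f\<in>Cc_infinity.
        T f \<in> borel_measurable lebesgue \<and> N (T f) \<le> ennreal C * Lp_norm p (gradient f))"

end

theory Submission imports Defs begin

text \<open>
  The kernel \<open>\<Omega>(y') |y|\<^sup>-\<^sup>n\<^sup>-\<^sup>1\<^sup>+\<^sup>\<alpha>\<close> has the homogeneity of a derivative of order \<open>1 - \<alpha>\<close>, so
  \<open>T f\<close> should be controlled by one derivative of \<open>f\<close> followed by a gain of \<open>\<alpha>\<close>. Cut the kernel into the
  dyadic annuli \<open>R / 2 < |y| \<le> R\<close>. Since \<open>\<Omega>\<close> has mean zero, the contribution of an annulus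
  does not change when a constant is subtracted from \<open>f\<close>. This gives the estimate that carries the
  whole proof (\<open>annulus_estimate\<close>): the contribution of the annulus at \<open>x\<close> is at most
  \<open>C R\<^sup>\<alpha>\<^sup>-\<^sup>1 (\<integral>\<^bsub>B(x,R)\<^esub> |\<nabla>f|\<^sup>n)\<^sup>1\<^sup>/\<^sup>n\<close>.

  By scaling it is enough to take \<open>R = 1\<close>. On the unit ball the mean oscillation of \<open>f\<close> about \<open>f(w)\<close> is
  bounded by the Riesz potential of order one of \<open>|\<nabla>f|\<close> (\<open>oscillation_le_riesz_potential\<close>). Such a
  potential of an \<open>L\<^sup>n\<close> function lies in the exponential class \<open>exp L\<^sup>n\<^sup>'\<close>, which is exactly the dual of
  \<open>L (log L)\<^sup>1\<^sup>/\<^sup>n\<^sup>'\<close>. The pairing is estimated directly in \<open>rough_riesz_bound\<close>: for \<open>\<Omega>\<close> suitably normalised, the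
  potential at \<open>w\<close> is split at the distance \<open>(1 + |\<Omega>(w')|)\<^sup>-\<^sup>2\<close>. Closer than that, \<open>|\<Omega>(w')|\<close> is absorbed by
  half a power of the distance; farther away, Hoelder's inequality leaves the power \<open>1/n'\<close> of
  the logarithm of \<open>1 + |\<Omega>(w')|\<close>.

  To sum over \<open>R = 2\<^sup>k\<close>, bound \<open>(\<integral>\<^bsub>B(x,R)\<^esub> |\<nabla>f|\<^sup>n)\<^sup>1\<^sup>/\<^sup>n\<close> by \<open>R M(|\<nabla>f|\<^sup>n)(x)\<^sup>1\<^sup>/\<^sup>n\<close> for small
  \<open>R\<close> and by \<open>C R\<^sup>1\<^sup>-\<^sup>n\<^sup>/\<^sup>p \<parallel>\<nabla>f\<parallel>\<^sub>p\<close> for large \<open>R\<close>, where \<open>M\<close> is a maximal operator. Both geometric series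
  converge for \<open>n \<le> p < n / \<alpha>\<close>, and with \<open>\<theta> = \<alpha> p / n\<close> the best place to switch gives, as in
  Hedberg's proof of the Sobolev inequality,
  \<open>|T f(x)| \<le> C M(|\<nabla>f|\<^sup>n)(x)\<^sup>(\<^sup>1\<^sup>-\<^sup>\<theta>\<^sup>)\<^sup>/\<^sup>n \<parallel>\<nabla>f\<parallel>\<^sub>p\<^sup>\<theta>\<close> (\<open>limit_pointwise_bound\<close>). For \<open>p > n\<close> the
  operator \<open>M\<close> is bounded on \<open>L\<^sup>p\<^sup>/\<^sup>n\<close>, which yields the strong bound; for \<open>p = n\<close> only the weak type of \<open>M\<close>
  on \<open>L\<^sup>1\<close> is available, which yields the weak one.

  One further point is geometric: the hypotheses on \<open>\<Omega>\<close> refer to the Hausdorff measure of the sphere, whereas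
  the operator integrates against Lebesgue measure. In polar coordinates Lebesgue measure induces
  on the sphere the measure of cones. Both measures are finite, nonzero and invariant under rotations, hence
  they give equal mass to all balls of equal radius with centre on the sphere, and two measures
  with this property are proportional (\<open>uniformly_distributed_proportional\<close>).
\<close>

section \<open>Polar coordinates for the cone measure\<close>

text \<open>
  The measure of a part of the sphere is the volume of the cone over it inside the unit ball. The origin
  is removed because \<open>sgn 0 = 0\<close> is not on the sphere.
\<close>

definition cone_measure :: "'a::euclidean_space measure" where
  "cone_measure = distr (density lborel (\<lambda>y. indicator {y. 0 < norm y \<and> norm y \<le> 1} y)) borel sgn"

lemma sets_cone_measure [simp, measurable_cong]: "sets cone_measure = sets borel"
  by (simp add: cone_measure_def)

lemma space_cone_measure [simp]: "space cone_measure = UNIV"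
  by (simp add: cone_measure_def)

lemma emeasure_cone_measure:
  fixes A :: "'a::euclidean_space set"
  assumes [measurable]: "A \<in> sets borel"
  shows "emeasure cone_measure A = emeasure lborel {y. 0 < norm y \<and> norm y \<le> 1 \<and> sgn y \<in> A}"
proof -
  have "emeasure cone_measure A = emeasure (density lborel (\<lambda>y. indicator {y::'a. 0 < norm y \<and> norm y \<le> 1} y)) {y. sgn y \<in> A}"
    unfolding cone_measure_def by (subst emeasure_distr) (auto simp: vimage_def)
  also have "\<dots> = (\<integral>\<^sup>+y. indicator {y::'a. 0 < norm y \<and> norm y \<le> 1 \<and> sgn y \<in> A} y \<partial>lborel)"
    by (subst emeasure_density, measurable, rule nn_integral_cong) (auto simp: indicator_def)
  also have "\<dots> = emeasure lborel {y. 0 < norm y \<and> norm y \<le> 1 \<and> sgn y \<in> A}"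
    by (rule nn_integral_indicator) measurable
  finally show ?thesis .
qed

lemma emeasure_lborel_scaled:
  fixes A :: "'a::euclidean_space set"
  assumes [measurable]: "A \<in> sets borel" and r: "r > 0"
  shows "emeasure lborel {y. (1/r) *\<^sub>R y \<in> A} = ennreal (r ^ DIM('a)) * emeasure lborel A"
proof -
  have "emeasure lborel {y. (1/r) *\<^sub>R y \<in> A}
      = emeasure (density (distr lborel borel (\<lambda>x. 0 + r *\<^sub>R x)) (\<lambda>_. ennreal (\<bar>r\<bar> ^ DIM('a)))) {y. (1/r) *\<^sub>R y \<in> A}"
    using lborel_affine[of r "0::'a"] r by simp
  also have "\<dots> = ennreal (r ^ DIM('a)) * emeasure (distr lborel borel (\<lambda>x. r *\<^sub>R x)) {y. (1/r) *\<^sub>R y \<in> A}"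
    using r by (subst emeasure_density) (auto simp: nn_integral_cmult)
  also have "emeasure (distr lborel borel (\<lambda>x. r *\<^sub>R x)) {y. (1/r) *\<^sub>R y \<in> A} = emeasure lborel A"
    using r by (subst emeasure_distr) (auto simp: vimage_def)
  finally show ?thesis .
qed

lemma emeasure_lborel_cone:
  fixes A :: "'a::euclidean_space set"
  assumes [measurable]: "A \<in> sets borel" and r: "r \<ge> 0"
  shows "emeasure lborel {y. 0 < norm y \<and> norm y \<le> r \<and> sgn y \<in> A}
     = ennreal (r ^ DIM('a)) * emeasure cone_measure A"
proof (cases "r = 0")
  case True
  have e: "{y::'a. 0 < norm y \<and> norm y \<le> 0 \<and> sgn y \<in> A} = {}" by auto
  show ?thesis unfolding True e by (simp add: zero_power)
next
  case False
  hence r: "r > 0" using r by simp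
  have "{y. 0 < norm y \<and> norm y \<le> r \<and> sgn y \<in> A}
      = {y. (1/r) *\<^sub>R y \<in> {y. 0 < norm y \<and> norm y \<le> 1 \<and> sgn y \<in> A}}"
    using r by (auto simp: sgn_scaleR)
  moreover have "{y::'a. 0 < norm y \<and> norm y \<le> 1 \<and> sgn y \<in> A} \<in> sets borel" by measurable
  ultimately show ?thesis
    using emeasure_lborel_scaled[OF _ r, of "{y. 0 < norm y \<and> norm y \<le> 1 \<and> sgn y \<in> A}"]
    by (simp only: emeasure_cone_measure[OF assms(1)])
qed

text \<open>
  Volumes of truncated cones scale like \<open>r\<^sup>n\<close>, so the law of the norm under Lebesgue measure on the
  cone over \<open>A\<close> has the density \<open>n r\<^sup>n\<^sup>-\<^sup>1\<close>, times the cone measure of \<open>A\<close>.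
\<close>

lemma radial_distr:
  fixes A :: "'a::euclidean_space set"
  assumes [measurable]: "A \<in> sets borel"
  shows "distr (density lborel (\<lambda>y. indicator A (sgn y) * indicator (-{0::'a}) y)) borel norm
     = density lborel (\<lambda>r. emeasure cone_measure A * (ennreal (DIM('a) * r ^ (DIM('a) - 1)) * indicator {0<..} r))"
    (is "?M = ?N")
proof -
  let ?d = "\<lambda>r::real. ennreal (DIM('a) * r ^ (DIM('a) - 1)) * indicator {0<..} r"
  have M: "emeasure ?M {..a} = (if a \<ge> 0 then ennreal (a ^ DIM('a)) * emeasure cone_measure A else 0)" for a
  proof -
    have "emeasure ?M {..a} = (\<integral>\<^sup>+y. indicator {y. 0 < norm y \<and> norm y \<le> a \<and> sgn y \<in> A} y \<partial>lborel)"
      by (subst emeasure_distr, simp, simp, subst emeasure_density, measurable, rule nn_integral_cong)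
         (auto simp: indicator_def)
    also have "\<dots> = emeasure lborel {y. 0 < norm y \<and> norm y \<le> a \<and> sgn y \<in> A}"
      by (rule nn_integral_indicator) measurable
    also have "\<dots> = (if a \<ge> 0 then ennreal (a ^ DIM('a)) * emeasure cone_measure A else 0)"
    proof (cases "a \<ge> 0")
      case False
      hence "{y. 0 < norm y \<and> norm y \<le> a \<and> sgn y \<in> A} = {}"
        by (auto intro: le_less_trans[OF norm_ge_zero] dest: order_trans[OF norm_ge_zero])
      thus ?thesis using False by (metis emeasure_empty)
    qed (use emeasure_lborel_cone[OF assms] in simp)
    finally show ?thesis .
  qed
  have N: "emeasure ?N {..a} = (if a \<ge> 0 then ennreal (a ^ DIM('a)) * emeasure cone_measure A else 0)" for a
  proof -
    have "emeasure ?N {..a} = (\<integral>\<^sup>+r. emeasure cone_measure A *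
         (?d r * indicator {..a} r) \<partial>lborel)"
      by (subst emeasure_density) (auto simp: mult.assoc)
    also have "\<dots> = emeasure cone_measure A * (\<integral>\<^sup>+r. (?d r * indicator {..a} r) \<partial>lborel)"
      by (rule nn_integral_cmult) measurable
    also have "(\<integral>\<^sup>+r. (?d r * indicator {..a} r) \<partial>lborel)
       = (if a \<ge> 0 then ennreal (a ^ DIM('a)) else 0)"
    proof (cases "a \<ge> 0")
      case True
      have "(\<integral>\<^sup>+r. (?d r * indicator {..a} r) \<partial>lborel)
         = (\<integral>\<^sup>+r. (ennreal (DIM('a) * r ^ (DIM('a) - 1)) * indicator {0..a} r) \<partial>lborel)"
        by (rule nn_integral_cong_AE, rule AE_I[of _ _ "{0}"]) (auto simp: indicator_def split: if_splits)
      also have "\<dots> = ennreal (a ^ DIM('a) - 0 ^ DIM('a))"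
        by (rule nn_integral_FTC_Icc) (use True in \<open>auto intro!: derivative_eq_intros\<close>)
      finally show ?thesis using True by (simp add: zero_power)
    next
      case False
      hence "(\<integral>\<^sup>+r. (?d r * indicator {..a} r) \<partial>lborel) = (\<integral>\<^sup>+(r::real). 0 \<partial>lborel)"
        by (intro nn_integral_cong) (auto simp: indicator_def)
      thus ?thesis using False by simp
    qed
    finally show ?thesis by (simp add: mult.commute)
  qed
  have fin: "emeasure (cone_measure :: 'a measure) A < \<infinity>"
  proof -
    have "emeasure (cone_measure :: 'a measure) A \<le> emeasure lborel (cball (0::'a) 1)"
      unfolding emeasure_cone_measure[OF assms] by (rule emeasure_mono) auto
    thus ?thesis by (simp add: emeasure_cball le_less_trans)
  qed
  show ?thesis
  proof (rule measure_eqI_generator_eq[of "range atMost" UNIV _ _ "\<lambda>i::nat. {..real i}"])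
    show "Int_stable (range (atMost :: real \<Rightarrow> _))" by (auto simp: Int_stable_def)
    show "emeasure ?M X = emeasure ?N X" if "X \<in> range atMost" for X using M N that by auto
    show "sets ?M = sigma_sets UNIV (range atMost)" by (simp add: borel_eq_atMost)
    show "sets ?N = sigma_sets UNIV (range atMost)" by (simp add: borel_eq_atMost)
    show "(\<Union>i. {..real i}) = UNIV" using real_arch_simple by auto
    show "emeasure ?M {..real i} \<noteq> \<infinity>" for i using M fin by (auto simp: ennreal_mult_eq_top_iff)
  qed auto
qed

text \<open>
  Normalised so that a radial function on space has integral \<open>radial_integral n \<phi>\<close>
  times the volume of the unit ball.
\<close>

definition radial_integral :: "nat \<Rightarrow> (real \<Rightarrow> ennreal) \<Rightarrow> ennreal" where
  "radial_integral n \<phi> = (\<integral>\<^sup>+r. \<phi> r * ennreal (n * r ^ (n - 1)) * indicator {0<..} r \<partial>lborel)"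

lemma AE_lborel_nonzero: "AE y in lborel. y \<noteq> (0::'a::euclidean_space)"
  by (rule AE_I[of _ _ "{0}"]) auto

lemma polar_indicator:
  fixes A :: "'a::euclidean_space set"
  assumes [measurable]: "A \<in> sets borel" "\<phi> \<in> borel_measurable borel"
  shows "(\<integral>\<^sup>+y. \<phi> (norm y) * indicator A (sgn y) \<partial>lborel) = radial_integral DIM('a) \<phi> * emeasure cone_measure A"
proof -
  have "(\<integral>\<^sup>+y. \<phi> (norm y) * indicator A (sgn y) \<partial>lborel)
      = (\<integral>\<^sup>+y. (indicator A (sgn y) * indicator (-{0::'a}) y) * \<phi> (norm y) \<partial>lborel)"
    by (rule nn_integral_cong_AE, rule AE_mp[OF AE_lborel_nonzero], rule AE_I2) (auto simp: indicator_def)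
  also have "\<dots> = (\<integral>\<^sup>+r. \<phi> r \<partial>distr (density lborel (\<lambda>y. indicator A (sgn y) * indicator (-{0::'a}) y)) borel norm)"
    by (simp add: nn_integral_distr nn_integral_density)
  also have "\<dots> = (\<integral>\<^sup>+r. emeasure (cone_measure::'a measure) A * (\<phi> r * ennreal (DIM('a) * r ^ (DIM('a) - 1)) * indicator {0<..} r) \<partial>lborel)"
    unfolding radial_distr[OF assms(1)] by (simp add: nn_integral_density mult_ac)
  also have "\<dots> = radial_integral DIM('a) \<phi> * emeasure cone_measure A"
    unfolding radial_integral_def by (subst nn_integral_cmult) (auto simp: mult.commute)
  finally show ?thesis .
qed

text \<open>
  Polar coordinates in the form of a statement about measures, which transfers both
  nonnegative and Bochner integrals.
\<close>

lemma polar_distr: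
  fixes \<phi> :: "real \<Rightarrow> ennreal"
  assumes [measurable]: "\<phi> \<in> borel_measurable borel"
  shows "distr (density lborel (\<lambda>y::'a::euclidean_space. \<phi> (norm y))) borel sgn
     = scale_measure (radial_integral DIM('a) \<phi>) cone_measure"
proof (rule measure_eqI)
  fix A :: "'a set" assume "A \<in> sets (distr (density lborel (\<lambda>y::'a. \<phi> (norm y))) borel sgn)"
  hence [measurable]: "A \<in> sets borel" by simp
  have "emeasure (distr (density lborel (\<lambda>y::'a. \<phi> (norm y))) borel sgn) A
     = emeasure (density lborel (\<lambda>y::'a. \<phi> (norm y))) {y. sgn y \<in> A}"
    by (subst emeasure_distr) (auto simp: vimage_def)
  also have "\<dots> = (\<integral>\<^sup>+y. \<phi> (norm y) * indicator A (sgn y) \<partial>lborel)"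
    by (subst emeasure_density) (auto simp: indicator_def intro!: nn_integral_cong)
  finally show "emeasure (distr (density lborel (\<lambda>y::'a. \<phi> (norm y))) borel sgn) A
     = emeasure (scale_measure (radial_integral DIM('a) \<phi>) cone_measure) A"
    by (simp add: polar_indicator)
qed simp

lemma nn_integral_polar:
  fixes G :: "'a::euclidean_space \<Rightarrow> ennreal"
  assumes [measurable]: "\<phi> \<in> borel_measurable borel" "G \<in> borel_measurable borel"
  shows "(\<integral>\<^sup>+y. \<phi> (norm y) * G (sgn y) \<partial>lborel) = radial_integral DIM('a) \<phi> * (\<integral>\<^sup>+u. G u \<partial>cone_measure)"
proof -
  have "(\<integral>\<^sup>+y. \<phi> (norm y) * G (sgn y) \<partial>lborel) = (\<integral>\<^sup>+u. G u \<partial>distr (density lborel (\<lambda>y::'a. \<phi> (norm y))) borel sgn)"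
    by (simp add: nn_integral_distr nn_integral_density)
  thus ?thesis unfolding polar_distr[OF assms(1)] by (simp add: nn_integral_scale_measure)
qed

lemma emeasure_cone_measure_UNIV:
  "emeasure (cone_measure :: 'a::euclidean_space measure) UNIV = ennreal (unit_ball_vol DIM('a))"
proof -
  have "emeasure (cone_measure :: 'a measure) UNIV = emeasure lborel (cball (0::'a) 1 - {0})"
    by (subst emeasure_cone_measure) (auto intro!: arg_cong[where f = "emeasure lborel"])
  also have "\<dots> = emeasure lborel (cball (0::'a) 1)"
    by (subst emeasure_Diff) auto
  finally show ?thesis by (simp add: emeasure_cball)
qed

lemma nn_integral_radial:
  assumes [measurable]: "\<phi> \<in> borel_measurable borel"
  shows "(\<integral>\<^sup>+y. \<phi> (norm (y::'a::euclidean_space)) \<partial>lborel) = radial_integral DIM('a) \<phi> * ennreal (unit_ball_vol DIM('a))"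
  using nn_integral_polar[of \<phi> "\<lambda>_::'a. 1"] by (simp add: emeasure_cone_measure_UNIV)

lemma radial_integral_power:
  assumes s: "s > 0" and R: "R \<ge> 0" and n: "n > 0"
  shows "radial_integral n (\<lambda>r. ennreal (r powr (s - real n)) * indicator {..R} r) = ennreal (n * R powr s / s)"
proof -
  have "radial_integral n (\<lambda>r. ennreal (r powr (s - real n)) * indicator {..R} r)
     = (\<integral>\<^sup>+r. ennreal (n * r powr (s - 1)) * indicator {0..R} r \<partial>lborel)"
    unfolding radial_integral_def
  proof (rule nn_integral_cong_AE, rule AE_mp[OF AE_lborel_nonzero], rule AE_I2, rule impI)
    fix r :: real assume r: "r \<noteq> 0"
    show "ennreal (r powr (s - real n)) * indicator {..R} r * ennreal (n * r ^ (n - 1)) * indicator {0<..} r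
       = ennreal (n * r powr (s - 1)) * indicator {0..R} r"
    proof (cases "r > 0")
      case True
      have "r powr (s - real n) * r ^ (n - 1) = r powr (s - 1)"
        using True n by (simp add: powr_realpow[symmetric] powr_add[symmetric] of_nat_diff)
      thus ?thesis using True by (auto simp: indicator_def ennreal_mult[symmetric] mult_ac)
    qed (use r in \<open>auto simp: indicator_def\<close>)
  qed
  also have "\<dots> = ennreal (n * R powr s / s)"
  proof (cases "R = 0")
    case True
    have "(\<integral>\<^sup>+r. ennreal (n * r powr (s - 1)) * indicator {0..R} r \<partial>lborel) = (\<integral>\<^sup>+(r::real). 0 \<partial>lborel)"
      unfolding True by (rule nn_integral_cong_AE, rule AE_mp[OF AE_lborel_nonzero], rule AE_I2) (auto simp: indicator_def)
    thus ?thesis using True by simp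
  next
    case False
    hence R: "R > 0" using R by simp
    have i: "((\<lambda>r. n * r powr (s - 1)) has_integral (n * (R powr s / s))) {0..R}"
      using has_integral_powr_from_0[of "s-1" R] s R by (intro has_integral_mult_right) simp
    show ?thesis
      using nn_integral_has_integral_lebesgue[OF _ i]
      by (simp add: nn_integral_completion ennreal_mult' ennreal_indicator mult.commute)
  qed
  finally show ?thesis .
qed

lemma radial_integral_log:
  assumes d: "0 < \<delta>" "\<delta> \<le> R" and n: "n > 0"
  shows "radial_integral n (\<lambda>r. ennreal (r powr (- real n)) * indicator {\<delta>..R} r) = ennreal (n * ln (R / \<delta>))"
proof -
  have "radial_integral n (\<lambda>r. ennreal (r powr (- real n)) * indicator {\<delta>..R} r)
     = (\<integral>\<^sup>+r. ennreal (n / r) * indicator {\<delta>..R} r \<partial>lborel)"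
    unfolding radial_integral_def
  proof (rule nn_integral_cong)
    fix r :: real
    show "ennreal (r powr (- real n)) * indicator {\<delta>..R} r * ennreal (n * r ^ (n - 1)) * indicator {0<..} r
       = ennreal (n / r) * indicator {\<delta>..R} r"
    proof (cases "r \<ge> \<delta>")
      case True
      hence r: "r > 0" using d by simp
      have "r powr (- real n) * r ^ (n - 1) = r powr (-1)"
        using r n by (simp add: powr_realpow[symmetric] powr_add[symmetric] of_nat_diff)
      also have "\<dots> = 1 / r" using r by (simp add: powr_minus_divide)
      finally have "r powr (- real n) * (n * r ^ (n - 1)) = n / r" by (metis mult.left_commute mult.right_neutral times_divide_eq_right)
      thus ?thesis using r by (auto simp: indicator_def ennreal_mult[symmetric])
    qed (auto simp: indicator_def)
  qed
  also have "\<dots> = ennreal (n * ln R - n * ln \<delta>)"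
    by (rule nn_integral_FTC_Icc) (use d in \<open>auto intro!: derivative_eq_intros\<close>)
  also have "n * ln R - n * ln \<delta> = n * ln (R / \<delta>)" using d by (simp add: ln_div right_diff_distrib)
  finally show ?thesis .
qed

section \<open>Measures with equal mass on equal balls\<close>

text \<open>
  The first half of Christensen's argument. The share of \<open>ball x r\<close> that lies in \<open>U\<close>, measured by \<open>M\<close> and
  integrated over \<open>x \<in> U\<close> with respect to \<open>N\<close>, tends to the \<open>N\<close>-measure of \<open>U\<close> by dominated convergence. On
  the other hand Fubini's theorem exchanges the two measures, and then the inner integral is at most the
  \<open>N\<close>-measure of a ball.
\<close>

lemma restricted_ball_average_limit:
  fixes M N :: "'a::{metric_space,second_countable_topology} measure" and h k :: "real \<Rightarrow> real"
  assumes sets [measurable_cong, simp]: "sets M = sets borel" "sets N = sets borel"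
    and fM: "finite_measure M" and fN: "finite_measure N"
    and S: "AE x in M. x \<in> S" "AE x in N. x \<in> S"
    and h: "\<And>x r. x \<in> S \<Longrightarrow> r > 0 \<Longrightarrow> emeasure M (ball x r) = ennreal (h r)" "\<And>r. r > 0 \<Longrightarrow> h r > 0"
    and k: "\<And>x r. x \<in> S \<Longrightarrow> r > 0 \<Longrightarrow> emeasure N (ball x r) = ennreal (k r)" "\<And>r. r > 0 \<Longrightarrow> k r > 0"
    and U: "open U"
  obtains a where "\<And>j. a j \<le> ennreal (k (1 / real (Suc j)) / h (1 / real (Suc j))) * emeasure M U"
    "a \<longlonglongrightarrow> emeasure N U"
proof -
  interpret M: finite_measure M by fact
  interpret N: finite_measure N by fact
  interpret P: pair_sigma_finite M N ..
  have Ub [measurable]: "U \<in> sets borel" using U by simp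
  define r where "r j = 1 / real (Suc j)" for j
  have r: "r j > 0" for j by (simp add: r_def)
  define F where "F j x y = (indicator U x * indicator U y * indicator {z. dist (fst z) (snd z) < r j} (x,y) :: ennreal)" for j x y
  have meas [measurable]: "case_prod (\<lambda>y x. F j x y) \<in> borel_measurable (M \<Otimes>\<^sub>M N)" for j
  proof -
    have "{z::'a\<times>'a. dist (fst z) (snd z) < r j} \<in> sets (borel \<Otimes>\<^sub>M borel)"
      unfolding borel_prod by (intro borel_open open_Collect_less continuous_intros)
    hence [measurable]: "{z::'a\<times>'a. dist (fst z) (snd z) < r j} \<in> sets (N \<Otimes>\<^sub>M M)"
      by (simp cong: sets_pair_measure_cong)
    have "case_prod (F j) \<in> borel_measurable (N \<Otimes>\<^sub>M M)"
      unfolding F_def by measurable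
    from measurable_pair_swap[OF this] show ?thesis by (simp add: case_prod_unfold)
  qed
  define a where "a j = (\<integral>\<^sup>+x. ennreal (1 / h (r j)) * (\<integral>\<^sup>+y. F j x y \<partial>M) \<partial>N)" for j
  have mq: "(\<lambda>x. \<integral>\<^sup>+y. F j x y \<partial>M) \<in> borel_measurable N" for j
    using M.borel_measurable_nn_integral_fst[OF measurable_pair_swap[OF meas[of j]]]
    by (simp add: case_prod_unfold)
  have inner: "(\<integral>\<^sup>+y. F j x y \<partial>M) = indicator U x * emeasure M (U \<inter> ball x (r j))" for j x
  proof -
    have "(\<integral>\<^sup>+y. F j x y \<partial>M) = (\<integral>\<^sup>+y. indicator U x * indicator (U \<inter> ball x (r j)) y \<partial>M)"
      by (intro nn_integral_cong) (auto simp: F_def indicator_def)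
    also have "\<dots> = indicator U x * emeasure M (U \<inter> ball x (r j))"
      by (rule nn_integral_cmult_indicator) auto
    finally show ?thesis .
  qed
  have "a j \<le> ennreal (k (r j) / h (r j)) * emeasure M U" for j
  proof -
    have "a j = ennreal (1 / h (r j)) * (\<integral>\<^sup>+x. (\<integral>\<^sup>+y. F j x y \<partial>M) \<partial>N)"
      unfolding a_def using mq by (rule nn_integral_cmult)
    also have "(\<integral>\<^sup>+x. (\<integral>\<^sup>+y. F j x y \<partial>M) \<partial>N) = (\<integral>\<^sup>+y. (\<integral>\<^sup>+x. F j x y \<partial>N) \<partial>M)"
      by (rule P.Fubini'[OF meas])
    also have "\<dots> \<le> (\<integral>\<^sup>+y. ennreal (k (r j)) * indicator U y \<partial>M)"
    proof (rule nn_integral_mono_AE, rule AE_mp[OF S(1)], rule AE_I2, rule impI)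
      fix y assume y: "y \<in> S"
      have "(\<integral>\<^sup>+x. F j x y \<partial>N) \<le> (\<integral>\<^sup>+x. indicator U y * indicator (ball y (r j)) x \<partial>N)"
        by (intro nn_integral_mono) (auto simp: F_def indicator_def dist_commute)
      also have "\<dots> = indicator U y * emeasure N (ball y (r j))"
        by (rule nn_integral_cmult_indicator) auto
      finally show "(\<integral>\<^sup>+x. F j x y \<partial>N) \<le> ennreal (k (r j)) * indicator U y"
        using k(1)[OF y r] by (simp add: mult.commute)
    qed
    also have "\<dots> = ennreal (k (r j)) * emeasure M U" by (rule nn_integral_cmult_indicator) auto
    also have "ennreal (1 / h (r j)) * (ennreal (k (r j)) * emeasure M U) = ennreal (k (r j) / h (r j)) * emeasure M U"
      using h(2)[OF r, of j] k(2)[OF r, of j] by (simp add: mult.assoc[symmetric] ennreal_mult[symmetric] less_imp_le)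
    finally show ?thesis by (simp add: mult_left_mono)
  qed
  moreover have "a \<longlonglongrightarrow> (\<integral>\<^sup>+x. indicator U x \<partial>N)"
    unfolding a_def
  proof (rule nn_integral_dominated_convergence[where w = "\<lambda>_. 1"])
    show "(\<lambda>x. ennreal (1 / h (r j)) * (\<integral>\<^sup>+ y. F j x y \<partial>M)) \<in> borel_measurable N" for j
      using mq by measurable
    have *: "ennreal (1 / h (r j)) * emeasure M (ball x (r j)) = 1" if "x \<in> S" for x j
      using h(2)[OF r, of j] h(1)[OF that r] by (simp add: ennreal_mult[symmetric])
    have le: "emeasure M (U \<inter> ball x (r j)) \<le> emeasure M (ball x (r j))" for x j
      by (rule emeasure_mono) auto
    show "AE x in N. ennreal (1 / h (r j)) * (\<integral>\<^sup>+ y. F j x y \<partial>M) \<le> 1" for j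
    proof (rule AE_mp[OF S(2)], rule AE_I2, rule impI)
      fix x assume x: "x \<in> S"
      have "ennreal (1 / h (r j)) * (indicator U x * emeasure M (U \<inter> ball x (r j)))
          \<le> ennreal (1 / h (r j)) * (1 * emeasure M (ball x (r j)))"
        by (intro mult_left_mono mult_mono le) (auto simp: indicator_def)
      thus "ennreal (1 / h (r j)) * (\<integral>\<^sup>+ y. F j x y \<partial>M) \<le> 1" using *[OF x, of j] by (simp add: inner)
    qed
    show "AE x in N. (\<lambda>j. ennreal (1 / h (r j)) * (\<integral>\<^sup>+ y. F j x y \<partial>M)) \<longlonglongrightarrow> indicator U x"
    proof (rule AE_mp[OF S(2)], rule AE_I2, rule impI)
      fix x assume x: "x \<in> S"
      show "(\<lambda>j. ennreal (1 / h (r j)) * (\<integral>\<^sup>+ y. F j x y \<partial>M)) \<longlonglongrightarrow> indicator U x"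
      proof (cases "x \<in> U")
        case True
        then obtain e where e: "e > 0" "ball x e \<subseteq> U" using U open_contains_ball by blast
        have "\<forall>\<^sub>F j in sequentially. r j < e"
          using LIMSEQ_inverse_real_of_nat e(1) unfolding r_def inverse_eq_divide by (rule order_tendstoD)
        hence "\<forall>\<^sub>F j in sequentially. ennreal (1 / h (r j)) * (\<integral>\<^sup>+ y. F j x y \<partial>M) = indicator U x"
        proof eventually_elim
          case (elim j)
          hence "U \<inter> ball x (r j) = ball x (r j)" using e by auto
          thus ?case using True *[OF x] by (simp add: inner)
        qed
        thus ?thesis by (rule tendsto_eventually)
      qed (simp add: inner)
    qed
    show "(\<integral>\<^sup>+x. 1 \<partial>N) < \<infinity>" by (simp add: less_top[symmetric])
  qed measurable
  ultimately show thesis using that[of a] by (simp add: r_def)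
qed

text \<open>
  The averages of the preceding lemma for \<open>(M, U)\<close> and for \<open>(N, V)\<close> come with the reciprocal
  factors \<open>k/h\<close> and \<open>h/k\<close>. These cancel in the product, so no knowledge of how the masses of balls behave for
  small radii is needed.
\<close>

lemma uniformly_distributed_proportional:
  fixes M N :: "'a::{metric_space,second_countable_topology} measure" and h k :: "real \<Rightarrow> real"
  assumes sets [measurable_cong, simp]: "sets M = sets borel" "sets N = sets borel"
    and fM: "finite_measure M" and fN: "finite_measure N"
    and S: "AE x in M. x \<in> S" "AE x in N. x \<in> S"
    and h: "\<And>x r. x \<in> S \<Longrightarrow> r > 0 \<Longrightarrow> emeasure M (ball x r) = ennreal (h r)" "\<And>r. r > 0 \<Longrightarrow> h r > 0"
    and k: "\<And>x r. x \<in> S \<Longrightarrow> r > 0 \<Longrightarrow> emeasure N (ball x r) = ennreal (k r)" "\<And>r. r > 0 \<Longrightarrow> k r > 0"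
    and A: "A \<in> sets borel"
  shows "emeasure N A * emeasure M UNIV = emeasure M A * emeasure N UNIV"
proof -
  interpret M: finite_measure M by fact
  interpret N: finite_measure N by fact
  \<comment> \<open>It is enough to prove one inequality for all pairs of open sets: exchanging \<open>U\<close> and \<open>V\<close> gives the other.\<close>
  have le: "emeasure N U * emeasure M V \<le> emeasure M U * emeasure N V" if U: "open U" and V: "open V" for U V
  proof -
    obtain a where a: "\<And>j. a j \<le> ennreal (k (1 / real (Suc j)) / h (1 / real (Suc j))) * emeasure M U"
      "a \<longlonglongrightarrow> emeasure N U"
      using restricted_ball_average_limit[OF sets fM fN S h k U] by metis
    obtain b where b: "\<And>j. b j \<le> ennreal (h (1 / real (Suc j)) / k (1 / real (Suc j))) * emeasure N V"
      "b \<longlonglongrightarrow> emeasure M V"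
      using restricted_ball_average_limit[OF sets(2,1) fN fM S(2,1) k h V] by metis
    have "(\<lambda>j. a j * b j) \<longlonglongrightarrow> emeasure N U * emeasure M V"
      by (rule tendsto_mult_ennreal[OF a(2) b(2)]) auto
    moreover have "a j * b j \<le> emeasure M U * emeasure N V" for j
    proof -
      define x where "x = k (1 / real (Suc j))"
      define y where "y = h (1 / real (Suc j))"
      have xy: "x > 0" "y > 0" using h(2) k(2) by (auto simp: x_def y_def)
      have "a j * b j \<le> (ennreal (x / y) * emeasure M U) * (ennreal (y / x) * emeasure N V)"
        unfolding x_def y_def by (intro mult_mono a b) auto
      also have "\<dots> = (ennreal (x / y) * ennreal (y / x)) * (emeasure M U * emeasure N V)"
        by (simp add: mult_ac)
      also have "ennreal (x / y) * ennreal (y / x) = 1"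
        using xy by (simp add: ennreal_mult[symmetric])
      finally show ?thesis by simp
    qed
    ultimately show ?thesis by (intro LIMSEQ_le_const2) auto
  qed
  define M' where "M' = scale_measure (emeasure N UNIV) M"
  define N' where "N' = scale_measure (emeasure M UNIV) N"
  have "M' = N'"
  proof (rule measure_eqI_generator_eq[of "Collect open" UNIV _ _ "\<lambda>_. UNIV"])
    show "Int_stable (Collect open :: 'a set set)" by (auto simp: Int_stable_def)
    show "emeasure M' X = emeasure N' X" if "X \<in> Collect open" for X
      using le[of X UNIV] le[of UNIV X] that by (auto simp: M'_def N'_def mult_ac intro!: antisym)
    show "sets M' = sigma_sets UNIV (Collect open)" by (simp add: M'_def borel_def)
    show "sets N' = sigma_sets UNIV (Collect open)" by (simp add: N'_def borel_def)
    show "emeasure M' UNIV \<noteq> \<infinity>" by (simp add: M'_def ennreal_mult_eq_top_iff)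
  qed auto
  hence "emeasure M' A = emeasure N' A" by simp
  thus ?thesis by (simp add: M'_def N'_def mult_ac)
qed

section \<open>The Hausdorff measure of the sphere is finite and positive\<close>

lemma diameter_isometric_image:
  assumes "\<And>x y. dist (T x) (T y) = dist x y"
  shows "diameter (T ` U) = diameter U"
proof -
  have "(\<lambda>(x, y). dist x y) ` (T ` U \<times> T ` U) = (\<lambda>(x, y). dist x y) ` (U \<times> U)"
    using assms by (force simp: image_iff)
  thus ?thesis unfolding diameter_def by simp
qed

lemma hausdorff_outer_isometric_image_le:
  fixes T :: "'a::metric_space \<Rightarrow> 'a"
  assumes iso: "\<And>x y. dist (T x) (T y) = dist x y"
  shows "hausdorff_outer m (T ` A) \<le> hausdorff_outer m A"
  unfolding hausdorff_outer_def hausdorff_content_def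
proof (intro SUP_mono bexI INF_mono)
  fix \<delta> U assume U: "U \<in> hausdorff_covers \<delta> A"
  have bd: "bounded (T ` X)" if "bounded X" for X
    using that unfolding bounded_two_points by (auto simp: iso)
  show "(\<lambda>i. T ` U i) \<in> hausdorff_covers \<delta> (T ` A)"
    using U bd image_mono[of A "\<Union>i. U i" T]
    by (simp add: hausdorff_covers_def diameter_isometric_image[OF iso] image_UN)
  show "(\<Sum>i. hausdorff_weight m (T ` U i)) \<le> (\<Sum>i. hausdorff_weight m (U i))"
    by (simp add: hausdorff_weight_def diameter_isometric_image[OF iso] cong: if_cong)
qed

lemma hausdorff_outer_orthogonal_image:
  fixes T :: "'a::euclidean_space \<Rightarrow> 'a"
  assumes T: "orthogonal_transformation T"
  shows "hausdorff_outer m (T ` A) = hausdorff_outer m A"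
proof (rule antisym)
  have iso: "dist (T x) (T y) = dist x y" if "orthogonal_transformation T" for T :: "'a \<Rightarrow> 'a" and x y
    using that by (metis dist_norm linear_diff orthogonal_transformation)
  show "hausdorff_outer m (T ` A) \<le> hausdorff_outer m A"
    by (rule hausdorff_outer_isometric_image_le[OF iso[OF T]])
  have "hausdorff_outer m (inv T ` (T ` A)) \<le> hausdorff_outer m (T ` A)"
    by (rule hausdorff_outer_isometric_image_le[OF iso[OF orthogonal_transformation_inv[OF T]]])
  thus "hausdorff_outer m A \<le> hausdorff_outer m (T ` A)"
    by (simp add: image_comp inv_o_cancel[OF orthogonal_transformation_inj[OF T]])
qed

text \<open>
  Packing: disjoint balls of radius \<open>\<rho>\<close> with centres on the sphere lie in an annulus of
  thickness \<open>2 \<rho>\<close>, whose volume is of order \<open>\<rho>\<close>.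
\<close>

lemma card_separated_sphere_le:
  fixes C :: "'a::euclidean_space set"
  assumes C: "finite C" "C \<subseteq> sphere 0 1" and \<rho>: "0 < \<rho>" "\<rho> \<le> 1"
    and disj: "pairwise (\<lambda>x y. disjnt (cball x \<rho>) (cball y \<rho>)) C"
  shows "real (card C) * \<rho> ^ (DIM('a) - 1) \<le> DIM('a) * 2 ^ DIM('a)"
proof -
  define n where "n = DIM('a)"
  have n: "n > 0" by (simp add: n_def)
  define \<omega> where "\<omega> = unit_ball_vol (real n)"
  have \<omega>: "\<omega> > 0" by (simp add: \<omega>_def)
  have "ennreal (real (card C) * (\<omega> * \<rho> ^ n)) = (\<Sum>x\<in>C. ennreal (\<omega> * \<rho> ^ n))"
    using \<omega> \<rho> by (simp add: ennreal_of_nat_eq_real_of_nat ennreal_mult)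
  also have "\<dots> = (\<Sum>x\<in>C. emeasure lborel (cball x \<rho>))"
    using \<rho> by (intro sum.cong) (auto simp: emeasure_cball \<omega>_def n_def)
  also have "\<dots> = emeasure lborel (\<Union>x\<in>C. cball x \<rho>)"
    using C disj by (intro sum_emeasure) (auto simp: disjoint_family_on_def pairwise_def disjnt_def)
  also have "\<dots> \<le> emeasure lborel (cball (0::'a) (1 + \<rho>) - ball 0 (1 - \<rho>))"
  proof (rule emeasure_mono)
    show "(\<Union>x\<in>C. cball x \<rho>) \<subseteq> cball 0 (1 + \<rho>) - ball 0 (1 - \<rho>)"
    proof safe
      fix x y assume x: "x \<in> C" and y: "y \<in> cball x \<rho>"
      have "norm x = 1" "norm (x - y) \<le> \<rho>" using x y C by (auto simp: dist_norm)
      moreover have "norm y \<le> norm x + norm (x - y)" "norm x \<le> norm y + norm (x - y)"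
        using norm_triangle_ineq[of x "y - x"] norm_triangle_ineq[of y "x - y"] by (auto simp: norm_minus_commute)
      ultimately show "y \<in> cball 0 (1 + \<rho>)" "y \<in> ball 0 (1 - \<rho>) \<Longrightarrow> False" by auto
    qed
  qed simp
  also have "\<dots> = emeasure lborel (cball (0::'a) (1 + \<rho>)) - emeasure lborel (ball (0::'a) (1 - \<rho>))"
    using \<rho> by (intro emeasure_Diff) (auto simp: emeasure_ball)
  also have "\<dots> = ennreal (\<omega> * ((1 + \<rho>) ^ n - (1 - \<rho>) ^ n))"
    using \<rho> \<omega> by (simp add: emeasure_cball emeasure_ball ennreal_minus right_diff_distrib \<omega>_def n_def)
  finally have "real (card C) * (\<omega> * \<rho> ^ n) \<le> \<omega> * ((1 + \<rho>) ^ n - (1 - \<rho>) ^ n)"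
    using \<omega> \<rho> by (subst (asm) ennreal_le_iff) (auto intro!: mult_nonneg_nonneg power_mono)
  hence "real (card C) * \<rho> ^ n \<le> (1 + \<rho>) ^ n - (1 - \<rho>) ^ n"
    using \<omega> by (simp add: mult.left_commute)
  also have "\<dots> = 2 * \<rho> * (\<Sum>i<n. (1 - \<rho>) ^ (n - Suc i) * (1 + \<rho>) ^ i)"
    by (subst power_diff_sumr2) (simp add: algebra_simps)
  also have "\<dots> \<le> 2 * \<rho> * (\<Sum>i<n. 1 * 2 ^ (n - 1))"
  proof (intro mult_left_mono sum_mono mult_mono)
    fix i assume "i \<in> {..<n}"
    have "(1 + \<rho>) ^ i \<le> 2 ^ i" using \<rho> by (intro power_mono) auto
    also have "(2::real) ^ i \<le> 2 ^ (n - 1)" using \<open>i \<in> _\<close> by (intro power_increasing) auto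
    finally show "(1 + \<rho>) ^ i \<le> 2 ^ (n - 1)" .
    show "(1 - \<rho>) ^ (n - Suc i) \<le> 1" using \<rho> by (intro power_le_one) auto
  qed (use \<rho> in auto)
  also have "\<dots> = \<rho> * (n * 2 ^ n)" using n by (cases n) (auto simp: algebra_simps)
  finally have "\<rho> * (real (card C) * \<rho> ^ (n - 1)) \<le> \<rho> * (n * 2 ^ n)"
    using n by (cases n) (auto simp: mult_ac algebra_simps)
  thus ?thesis using \<rho> by (simp add: n_def)
qed

text \<open>
  A maximal family of disjoint balls of radius \<open>\<rho>\<close> has at most \<open>C \<rho>\<^sup>1\<^sup>-\<^sup>n\<close> members, and the five times
  larger balls cover the sphere with total weight bounded independently of \<open>\<rho>\<close>.
\<close>

lemma hausdorff_sphere_finite: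
  "hausdorff_outer (DIM('a) - 1) (sphere (0::'a::euclidean_space) 1) < \<infinity>"
proof -
  define n where "n = DIM('a)"
  define m where "m = n - 1"
  define v where "v = unit_ball_vol (real m)"
  have v: "v > 0" by (simp add: v_def)
  have "hausdorff_content m \<delta> (sphere (0::'a) 1) \<le> ennreal (n * 2 ^ n * (v * 5 ^ m))" if \<delta>: "\<delta> > 0" for \<delta>
  proof -
    \<comment> \<open>The covering balls have radius \<open>5 * \<rho>\<close> and must have diameter at most \<open>\<delta>\<close>.\<close>
    define \<rho> where "\<rho> = min 1 (\<delta> / 10)"
    have \<rho>: "0 < \<rho>" "\<rho> \<le> 1" "10 * \<rho> \<le> \<delta>" using \<delta> by (auto simp: \<rho>_def)
    obtain C where C: "C \<subseteq> sphere (0::'a) 1" "pairwise (\<lambda>i j. disjnt (cball i \<rho>) (cball j \<rho>)) C"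
      "sphere (0::'a) 1 \<subseteq> (\<Union>i\<in>C. cball i (5 * \<rho>))"
    proof (rule Vitali_covering_lemma_cballs[where S = "sphere (0::'a) 1" and K = "sphere (0::'a) 1" and a = "\<lambda>x. x" and r = "\<lambda>_. \<rho>" and B = 1])
      show "sphere (0::'a) 1 \<subseteq> (\<Union>i\<in>sphere 0 1. cball i \<rho>)" using \<rho> by auto
    qed (use \<rho> in auto)
    have cb: "real (card G) \<le> n * 2 ^ n / \<rho> ^ m" if "G \<subseteq> C" "finite G" for G
    proof -
      have "real (card G) * \<rho> ^ m \<le> n * 2 ^ n"
        unfolding m_def n_def using that C \<rho> by (intro card_separated_sphere_le) (auto intro: pairwise_subset)
      thus ?thesis using \<rho> by (simp add: pos_le_divide_eq)
    qed
    have "finite C \<and> card C \<le> nat \<lfloor>n * 2 ^ n / \<rho> ^ m\<rfloor>"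
      by (rule finite_if_finite_subsets_card_bdd) (use cb in \<open>auto simp: le_nat_floor\<close>)
    then obtain cs where cs: "set cs = C" "distinct cs" using finite_distinct_list by blast
    define U where "U = (\<lambda>i. if i < length cs then cball (cs ! i) (5 * \<rho>) else {})"
    have "U \<in> hausdorff_covers \<delta> (sphere (0::'a) 1)"
      unfolding hausdorff_covers_def
    proof (safe)
      fix x :: 'a assume "x \<in> sphere 0 1"
      then obtain c where "c \<in> set cs" "x \<in> cball c (5 * \<rho>)" using C(3) cs by auto
      thus "x \<in> (\<Union>i. U i)" unfolding U_def in_set_conv_nth by (auto split: if_splits)
    next
      fix i show "bounded (U i)" "diameter (U i) \<le> \<delta>" using \<rho> by (auto simp: U_def)
    qed
    hence "hausdorff_content m \<delta> (sphere (0::'a) 1) \<le> (\<Sum>i. hausdorff_weight m (U i))"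
      by (rule hausdorff_content_le)
    also have "\<dots> = (\<Sum>i<length cs. hausdorff_weight m (U i))"
      by (rule suminf_finite) (auto simp: U_def)
    also have "\<dots> = (\<Sum>i<length cs. ennreal (v * (5 * \<rho>) ^ m))"
      using \<rho> by (intro sum.cong refl) (simp add: U_def hausdorff_weight_def v_def)
    also have "\<dots> = ennreal (real (card C) * (v * (5 * \<rho>) ^ m))"
      using v \<rho> distinct_card[OF cs(2)] cs(1) by (simp add: ennreal_of_nat_eq_real_of_nat ennreal_mult)
    also have "\<dots> \<le> ennreal (n * 2 ^ n * (v * 5 ^ m))"
    proof (rule ennreal_leI)
      have "real (card C) * (v * (5 * \<rho>) ^ m) = (real (card C) * \<rho> ^ m) * (v * 5 ^ m)"
        by (simp add: power_mult_distrib mult_ac)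
      also have "\<dots> \<le> (n * 2 ^ n) * (v * 5 ^ m)"
        using cb[of C] cs \<rho> v by (intro mult_right_mono) (auto simp: pos_le_divide_eq)
      finally show "real (card C) * (v * (5 * \<rho>) ^ m) \<le> n * 2 ^ n * (v * 5 ^ m)" .
    qed
    finally show ?thesis .
  qed
  hence "hausdorff_outer m (sphere (0::'a) 1) \<le> ennreal (n * 2 ^ n * (v * 5 ^ m))"
    unfolding hausdorff_outer_def by (intro SUP_least) auto
  also have "\<dots> < \<infinity>" by simp
  finally show ?thesis by (simp add: m_def n_def)
qed

lemma finite_measure_cone_measure: "finite_measure (cone_measure :: 'a::euclidean_space measure)"
  by (rule finite_measureI) (simp add: emeasure_cone_measure_UNIV)

text \<open>
  The outer layer \<open>1 - d < |y| \<le> 1\<close> of the cone over a cap of radius \<open>d\<close> fits into a ball of radius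
  \<open>2 d\<close>, and it makes up at least the fraction \<open>d\<close> of that cone. The radius zero is included because a set in a
  cover may be a single point; in dimension one the right-hand side is then a positive constant, as \<open>0 ^ 0 = 1\<close>.
\<close>

lemma measure_cone_measure_cball_le:
  fixes u :: "'a::euclidean_space"
  assumes u: "norm u = 1" and d: "0 \<le> d" "d \<le> 1"
  shows "measure cone_measure (cball u d) \<le> unit_ball_vol DIM('a) * 2 ^ DIM('a) * d ^ (DIM('a) - 1)"
proof -
  interpret finite_measure "cone_measure :: 'a measure" by (rule finite_measure_cone_measure)
  define n where "n = DIM('a)"
  have n: "n > 0" by (simp add: n_def)
  define \<omega> where "\<omega> = unit_ball_vol (real n)"
  have \<omega>: "\<omega> > 0" by (simp add: \<omega>_def)
  have pos: "measure cone_measure (cball u d) \<le> \<omega> * 2 ^ n * d ^ (n - 1)" if d: "0 < d" "d \<le> 1" for d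
  proof -
    let ?m = "measure cone_measure (cball u d)"
    let ?L = "{y. 0 < norm y \<and> norm y \<le> 1 - d \<and> sgn y \<in> cball u d}"
    have [measurable]: "cball u d \<in> sets borel" by simp
    have em: "emeasure cone_measure (cball u d) = ennreal ?m" by (rule emeasure_eq_measure)
    have "ennreal ?m = emeasure lborel {y. 0 < norm y \<and> norm y \<le> 1 \<and> sgn y \<in> cball u d}"
      unfolding em[symmetric] by (rule emeasure_cone_measure) simp
    also have "\<dots> \<le> emeasure lborel (?L \<union> cball u (2 * d))"
    proof (rule emeasure_mono)
      show "{y. 0 < norm y \<and> norm y \<le> 1 \<and> sgn y \<in> cball u d}
        \<subseteq> ?L \<union> cball u (2 * d)"
      proof (rule subsetI, rule UnCI)
        fix y assume 1: "y \<in> {y. 0 < norm y \<and> norm y \<le> 1 \<and> sgn y \<in> cball u d}"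
          and 2: "y \<notin> cball u (2 * d)"
        have "norm (y - sgn y) = \<bar>norm y - 1\<bar>"
        proof -
          have "y - sgn y = (norm y - 1) *\<^sub>R sgn y" using 1 by (simp add: sgn_div_norm algebra_simps)
          thus ?thesis using 1 by (simp add: norm_sgn)
        qed
        moreover have "dist u (sgn y) \<le> d" using 1 by simp
        ultimately have "dist u y \<le> 1 - norm y + d"
          using dist_triangle2[of u y "sgn y"] 1 by (simp add: dist_norm)
        thus "y \<in> ?L"
          using 1 2 by simp
      qed
      have "?L \<in> sets borel" by measurable
      thus "?L \<union> cball u (2 * d) \<in> sets lborel" by simp
    qed
    also have "\<dots> \<le> emeasure lborel ?L + emeasure lborel (cball u (2 * d))"
    proof (rule emeasure_subadditive)
      have "?L \<in> sets borel" by measurable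
      thus "?L \<in> sets lborel" by simp
    qed simp
    also have "\<dots> = ennreal ((1 - d) ^ n * ?m) + ennreal (\<omega> * (2 * d) ^ n)"
      using d by (subst emeasure_lborel_cone) (auto simp: em emeasure_cball n_def \<omega>_def ennreal_mult)
    also have "\<dots> = ennreal ((1 - d) ^ n * ?m + \<omega> * (2 * d) ^ n)"
      using d \<omega> by (intro ennreal_plus[symmetric]) auto
    finally have "?m \<le> (1 - d) ^ n * ?m + \<omega> * (2 * d) ^ n"
      using d \<omega> by (subst (asm) ennreal_le_iff) (auto intro!: add_nonneg_nonneg)
    moreover have "(1 - d) ^ n * ?m \<le> (1 - d) * ?m"
      using power_decreasing[of 1 n "1 - d"] n d by (intro mult_right_mono) auto
    ultimately have "d * ?m \<le> \<omega> * (2 * d) ^ n" by (simp add: algebra_simps)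
    also have "\<dots> = d * (\<omega> * 2 ^ n * d ^ (n - 1))" using n by (cases n) (auto simp: power_mult_distrib)
    finally show ?thesis using d by simp
  qed
  have "measure cone_measure (cball u d) \<le> \<omega> * 2 ^ n * d ^ (n - 1)"
  proof (cases "d = 0")
    case True
    have "((\<lambda>e. \<omega> * 2 ^ n * e ^ (n - 1)) \<longlongrightarrow> \<omega> * 2 ^ n * 0 ^ (n - 1)) (at_right 0)"
      by (intro tendsto_intros)
    moreover have "\<forall>\<^sub>F e in at_right (0::real). measure cone_measure (cball u d) \<le> \<omega> * 2 ^ n * e ^ (n - 1)"
    proof (rule eventually_at_right_real[THEN eventually_mono])
      show "(0::real) < 1" by simp
      fix e :: real assume e: "e \<in> {0<..<1}"
      have "measure cone_measure (cball u d) \<le> measure cone_measure (cball u e)"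
        using e True by (intro finite_measure_mono) auto
      also have "\<dots> \<le> \<omega> * 2 ^ n * e ^ (n - 1)" using e by (intro pos) auto
      finally show "measure cone_measure (cball u d) \<le> \<omega> * 2 ^ n * e ^ (n - 1)" .
    qed
    ultimately show ?thesis unfolding True by (intro tendsto_lowerbound) auto
  qed (use d pos in auto)
  thus ?thesis by (simp add: n_def \<omega>_def)
qed

text \<open>
  The mass distribution principle: by the preceding lemma the cone measure of a set of diameter at
  most one is bounded by a multiple of its Hausdorff weight.
\<close>

lemma hausdorff_sphere_pos:
  "hausdorff_outer (DIM('a) - 1) (sphere (0::'a::euclidean_space) 1) > 0"
proof -
  interpret finite_measure "cone_measure :: 'a measure" by (rule finite_measure_cone_measure)
  define n where "n = DIM('a)"
  define m where "m = n - 1"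
  define v where "v = unit_ball_vol (real m)"
  have v: "v > 0" by (simp add: v_def)
  define \<omega> where "\<omega> = unit_ball_vol (real n)"
  have \<omega>: "\<omega> > 0" by (simp add: \<omega>_def)
  define K where "K = \<omega> * 2 ^ n * 2 ^ m / v"
  have K: "K > 0" using v \<omega> by (simp add: K_def)
  have "ennreal (\<omega> / K) \<le> hausdorff_content m 1 (sphere (0::'a) 1)"
    unfolding hausdorff_content_def
  proof (rule INF_greatest)
    fix U assume U: "U \<in> hausdorff_covers 1 (sphere (0::'a) 1)"
    \<comment> \<open>The sets of a cover need not be measurable; each one that meets the sphere is enlarged to a ball
      centred at one of its points on the sphere.\<close>
    define V where "V = (\<lambda>i. if U i \<inter> sphere 0 1 = {} then {} else cball (SOME u. u \<in> U i \<inter> sphere 0 1) (diameter (U i)))"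
    have V: "U i \<inter> sphere 0 1 \<subseteq> V i \<and> V i \<in> sets borel \<and> emeasure cone_measure (V i) \<le> ennreal K * hausdorff_weight m (U i)" for i
    proof (cases "U i \<inter> sphere 0 1 = {}")
      case False
      define u where "u = (SOME u. u \<in> U i \<inter> sphere 0 1)"
      have u: "u \<in> U i" "norm u = 1" using some_in_eq[of "U i \<inter> sphere 0 1"] False by (auto simp: u_def)
      have bd: "bounded (U i)" "diameter (U i) \<le> 1" using U by (auto simp: hausdorff_covers_def)
      have Vi: "V i = cball u (diameter (U i))" using False by (simp add: V_def u_def)
      have "U i \<subseteq> V i" using diameter_bounded_bound[OF bd(1) u(1)] by (auto simp: Vi)
      moreover have "emeasure cone_measure (V i) \<le> ennreal K * hausdorff_weight m (U i)"
      proof -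
        have "emeasure cone_measure (V i) = ennreal (measure cone_measure (V i))" by (rule emeasure_eq_measure)
        also have "\<dots> \<le> ennreal (\<omega> * 2 ^ n * diameter (U i) ^ m)"
          unfolding Vi \<omega>_def n_def m_def using bd u(2)
          by (intro ennreal_leI measure_cone_measure_cball_le diameter_ge_0)
        also have "\<omega> * 2 ^ n * diameter (U i) ^ m = K * (v * (diameter (U i) / 2) ^ m)"
          using v by (simp add: K_def power_divide)
        also have "ennreal \<dots> = ennreal K * hausdorff_weight m (U i)"
          using u(1) K v diameter_ge_0[OF bd(1)] by (subst ennreal_mult) (auto simp: hausdorff_weight_def v_def)
        finally show ?thesis .
      qed
      ultimately show ?thesis by (auto simp: Vi)
    qed (auto simp: V_def)
    have "ennreal \<omega> = emeasure (cone_measure :: 'a measure) UNIV" by (simp add: emeasure_cone_measure_UNIV \<omega>_def n_def)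
    also have "\<dots> = emeasure (cone_measure :: 'a measure) (sphere 0 1)"
      by (subst (1 2) emeasure_cone_measure) (auto simp: norm_sgn intro!: arg_cong[where f = "emeasure lborel"])
    also have "\<dots> \<le> emeasure cone_measure (\<Union>i. V i)"
    proof (rule emeasure_mono)
      show "sphere 0 1 \<subseteq> (\<Union>i. V i)"
      proof
        fix x :: 'a assume x: "x \<in> sphere 0 1"
        then obtain i where "x \<in> U i" using U by (auto simp: hausdorff_covers_def)
        thus "x \<in> (\<Union>i. V i)" using V[of i] x by blast
      qed
      show "(\<Union>i. V i) \<in> sets cone_measure" using V by (intro sets.countable_UN) auto
    qed
    also have "\<dots> \<le> (\<Sum>i. emeasure cone_measure (V i))"
      using V by (intro emeasure_subadditive_countably) auto
    also have "\<dots> \<le> (\<Sum>i. ennreal K * hausdorff_weight m (U i))"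
      using V by (intro suminf_le) auto
    also have "\<dots> = ennreal K * (\<Sum>i. hausdorff_weight m (U i))" by simp
    finally have "ennreal (1 / K) * ennreal \<omega> \<le> ennreal (1 / K) * (ennreal K * (\<Sum>i. hausdorff_weight m (U i)))"
      by (rule mult_left_mono) simp
    also have "\<dots> = (\<Sum>i. hausdorff_weight m (U i))"
      using K by (simp add: mult.assoc[symmetric] ennreal_mult[symmetric])
    finally show "ennreal (\<omega> / K) \<le> (\<Sum>i. hausdorff_weight m (U i))"
      using K \<omega> by (simp add: ennreal_mult[symmetric])
  qed
  also have "\<dots> \<le> hausdorff_outer m (sphere (0::'a) 1)" by (rule hausdorff_content_le_outer) simp
  finally have "ennreal (\<omega> / K) \<le> hausdorff_outer m (sphere (0::'a) 1)" .
  moreover have "0 < ennreal (\<omega> / K)" using K \<omega> by simp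
  ultimately show ?thesis unfolding m_def n_def by (rule less_le_trans[rotated])
qed

section \<open>Surface measure and cone measure\<close>

text \<open>
  The restriction is kept as a measure on the whole space, so that it can be compared with
  \<^const>\<open>cone_measure\<close>.
\<close>

definition surface_measure :: "(real ^ 'n) measure" where
  "surface_measure = density (hausdorff_measure (CARD('n) - 1)) (indicator (sphere 0 1))"

lemma sets_surface_measure [simp, measurable_cong]: "sets surface_measure = sets borel"
  by (simp add: surface_measure_def)

lemma space_surface_measure [simp]: "space surface_measure = UNIV"
  by (simp add: surface_measure_def)

lemma emeasure_surface_measure:
  fixes A :: "(real ^ 'n) set"
  assumes A: "A \<in> sets borel"
  shows "emeasure surface_measure A = hausdorff_outer (CARD('n) - 1) (A \<inter> sphere 0 1)"
  unfolding surface_measure_def using A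
  by (subst emeasure_restricted) (auto simp: emeasure_hausdorff_measure Int_commute)

lemma sgn_orthogonal_transformation:
  "orthogonal_transformation T \<Longrightarrow> sgn (T x) = T (sgn x)" for T :: "'a::euclidean_space \<Rightarrow> 'a"
  by (simp add: sgn_div_norm orthogonal_transformation_norm orthogonal_transformation_scaleR)

text \<open>
  Up to a null set, an open set is a disjoint union of balls, and an orthogonal map sends a ball to
  a ball of the same radius. Applied to the inverse map, the inequality becomes an equality.
\<close>

lemma emeasure_lborel_orthogonal_image_ge:
  fixes T :: "'a::euclidean_space \<Rightarrow> 'a"
  assumes T: "orthogonal_transformation T" and U: "open U"
  shows "emeasure lborel U \<le> emeasure lborel (T ` U)"
proof -
  define K where "K = {p :: 'a \<times> real. 0 < snd p \<and> ball (fst p) (snd p) \<subseteq> U}"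
  have cov: "\<exists>i. i \<in> K \<and> x \<in> ball (fst i) (snd i) \<and> snd i < d" if "x \<in> U" "0 < d" for x d
  proof -
    obtain e where "e > 0" "ball x e \<subseteq> U" using U \<open>x \<in> U\<close> open_contains_ball by blast
    hence "(x, min e (d/2)) \<in> K \<and> x \<in> ball x (min e (d/2)) \<and> min e (d/2) < d"
      using \<open>0 < d\<close> by (auto simp: K_def)
    thus ?thesis by (metis fst_conv snd_conv)
  qed
  obtain C where C: "countable C" "C \<subseteq> K"
    "pairwise (\<lambda>i j. disjnt (ball (fst i) (snd i)) (ball (fst j) (snd j))) C"
    "negligible (U - (\<Union>i\<in>C. ball (fst i) (snd i)))"
    by (rule Vitali_covering_theorem_balls[OF cov])
  have im: "T ` ball x r = ball (T x) r" for x r by (rule image_orthogonal_transformation_ball[OF T])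
  have inj: "inj T" using T by (rule orthogonal_transformation_inj)
  have B [simp]: "(\<Union>i\<in>C. ball (fst i) (snd i)) \<in> sets borel" "U \<in> sets borel"
    using U by (auto intro!: borel_open)
  have null: "U - (\<Union>i\<in>C. ball (fst i) (snd i)) \<in> null_sets lebesgue"
    using C(4) by (simp add: negligible_iff_null_sets)
  hence null: "U - (\<Union>i\<in>C. ball (fst i) (snd i)) \<in> null_sets lborel"
    by (subst (asm) null_sets_completion_iff) auto
  have "emeasure lborel U \<le> emeasure lborel ((\<Union>i\<in>C. ball (fst i) (snd i)) \<union> (U - (\<Union>i\<in>C. ball (fst i) (snd i))))"
    by (intro emeasure_mono) auto
  also have "\<dots> = emeasure lborel (\<Union>i\<in>C. ball (fst i) (snd i))"
    using null C(1) by (intro emeasure_Un_null_set) auto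
  also have "\<dots> = (\<integral>\<^sup>+i. emeasure lborel (ball (fst i) (snd i)) \<partial>count_space C)"
    using C(1,3) by (intro emeasure_UN_countable) (auto simp: disjoint_family_on_def pairwise_def disjnt_def)
  also have "\<dots> = (\<integral>\<^sup>+i. emeasure lborel (T ` ball (fst i) (snd i)) \<partial>count_space C)"
    using C(2) by (intro nn_integral_cong) (auto simp: im emeasure_ball K_def)
  also have "\<dots> = emeasure lborel (\<Union>i\<in>C. T ` ball (fst i) (snd i))"
  proof (rule emeasure_UN_countable[symmetric])
    show "disjoint_family_on (\<lambda>i. T ` ball (fst i) (snd i)) C"
      using C(3) inj unfolding disjoint_family_on_def pairwise_def disjnt_def
      by (metis image_Int image_empty)
  qed (use C(1) in \<open>auto simp: im\<close>)
  also have "\<dots> \<le> emeasure lborel (T ` U)"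
    using C(2) open_surjective_linear_image[OF U orthogonal_transformation_linear[OF T] orthogonal_transformation_surj[OF T]]
    by (intro emeasure_mono) (auto simp: K_def)
  finally show ?thesis .
qed

lemma lborel_distr_orthogonal:
  fixes T :: "'a::euclidean_space \<Rightarrow> 'a"
  assumes T: "orthogonal_transformation T"
  shows "distr lborel borel T = lborel"
proof -
  have lin: "linear T" by (rule orthogonal_transformation_linear[OF T])
  have cont: "continuous_on UNIV T" using lin by (simp add: linear_continuous_on linear_linear)
  hence Tm [measurable]: "T \<in> borel_measurable borel" by (rule borel_measurable_continuous_onI)
  have bij: "bij T" using T by (rule orthogonal_transformation_bij)
  have ev: "emeasure (distr lborel borel T) U = emeasure lborel (inv T ` U)" if "U \<in> sets borel" for U
    using that bij by (simp add: emeasure_distr bij_vimage_eq_inv_image)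
  have op: "emeasure (distr lborel borel T) U = emeasure lborel U" if U: "open U" for U
  proof (rule antisym)
    have oi: "open (inv T ` U)"
      using U orthogonal_transformation_inv[OF T]
      by (intro open_surjective_linear_image orthogonal_transformation_linear orthogonal_transformation_surj)
    have "T ` inv T ` U = U" using bij by (simp add: bij_is_surj image_f_inv_f)
    thus "emeasure (distr lborel borel T) U \<le> emeasure lborel U"
      using emeasure_lborel_orthogonal_image_ge[OF T oi] U by (simp add: ev)
    show "emeasure lborel U \<le> emeasure (distr lborel borel T) U"
      using emeasure_lborel_orthogonal_image_ge[OF orthogonal_transformation_inv[OF T] U] U by (simp add: ev)
  qed
  show ?thesis
  proof (rule measure_eqI_generator_eq[of "Collect open" UNIV _ _ "\<lambda>i::nat. ball 0 (real i)"])
    show "Int_stable (Collect open :: 'a set set)" by (auto simp: Int_stable_def)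
    show "(\<Union>i. ball 0 (real i)) = (UNIV :: 'a set)" using reals_Archimedean2 by auto
    show "emeasure (distr lborel borel T) (ball 0 (real i)) \<noteq> \<infinity>" for i
      using emeasure_lborel_ball_finite[of "0::'a" "real i"] by (simp add: op)
    show "sets (distr lborel borel T) = sigma_sets UNIV (Collect open)" "sets lborel = sigma_sets UNIV (Collect (open :: 'a set \<Rightarrow> bool))"
      by (simp_all add: borel_def)
  qed (auto simp: op)
qed

lemma emeasure_cone_measure_orthogonal_image:
  fixes T :: "'a::euclidean_space \<Rightarrow> 'a"
  assumes T: "orthogonal_transformation T" and A: "A \<in> sets borel" "T ` A \<in> sets borel"
  shows "emeasure cone_measure (T ` A) = emeasure cone_measure A"
proof -
  note A [measurable]
  have inj: "inj T" using T by (rule orthogonal_transformation_inj)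
  let ?C = "\<lambda>A::'a set. {y. 0 < norm y \<and> norm y \<le> 1 \<and> sgn y \<in> A}"
  have CT: "?C (T ` A) = T ` ?C A"
  proof (intro equalityI subsetI)
    fix y assume y: "y \<in> ?C (T ` A)"
    then obtain x where x: "y = T x"
      using orthogonal_transformation_surj[OF T] by (meson surjE)
    have "norm y = norm x" using T by (simp add: x orthogonal_transformation_norm)
    moreover have "T (sgn x) \<in> T ` A" using y sgn_orthogonal_transformation[OF T, of x] by (simp add: x)
    ultimately show "y \<in> T ` ?C A" using y inj unfolding x by (auto simp: inj_image_mem_iff)
  next
    fix y assume "y \<in> T ` ?C A"
    then obtain x where "y = T x" "x \<in> ?C A" by blast
    thus "y \<in> ?C (T ` A)"
      by (simp add: sgn_orthogonal_transformation[OF T] orthogonal_transformation_norm[OF T] del: zero_less_norm_iff)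
  qed
  have C: "?C A \<in> sets borel" "?C (T ` A) \<in> sets borel" by measurable
  have "emeasure cone_measure A = emeasure lborel (T -` (T ` ?C A))"
    using inj by (simp only: emeasure_cone_measure[OF A(1)] inj_vimage_image_eq)
  also have "\<dots> = emeasure (distr lborel borel T) (T ` ?C A)"
  proof (subst emeasure_distr)
    show "T \<in> measurable lborel borel"
      using orthogonal_transformation_linear[OF T]
      by (simp add: borel_measurable_continuous_onI linear_continuous_on linear_linear)
    show "T ` ?C A \<in> sets borel" using C(2) unfolding CT .
  qed simp
  also have "\<dots> = emeasure cone_measure (T ` A)"
    by (simp only: lborel_distr_orthogonal[OF T] emeasure_cone_measure[OF A(2)] CT)
  finally show ?thesis by simp
qed

lemma AE_cone_measure_sphere: "AE y in (cone_measure :: 'a::euclidean_space measure). y \<in> sphere 0 1"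
proof (rule AE_I[of _ _ "- sphere 0 1"])
  have e: "{y::'a. 0 < norm y \<and> norm y \<le> 1 \<and> sgn y \<in> - sphere 0 1} = {}" by (auto simp: norm_sgn)
  show "emeasure (cone_measure :: 'a measure) (- sphere 0 1) = 0"
    by (subst emeasure_cone_measure) (simp, simp only: e emeasure_empty)
qed auto

text \<open>
  Some orthogonal map takes any point of the sphere to any other. If small balls had measure zero,
  then so would the sphere, by compactness.
\<close>

lemma sphere_ball_measure_constant:
  fixes M :: "(real ^ 'n) measure"
  assumes sets [simp, measurable_cong]: "sets M = sets borel" and M: "finite_measure M"
    and inv: "\<And>T A. orthogonal_transformation T \<Longrightarrow> A \<in> sets borel \<Longrightarrow> T ` A \<in> sets borel
        \<Longrightarrow> emeasure M (T ` A) = emeasure M A"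
    and pos: "emeasure M (sphere 0 1) > 0"
  obtains h where "\<And>x r. x \<in> sphere 0 1 \<Longrightarrow> r > 0 \<Longrightarrow> emeasure M (ball x r) = ennreal (h r)"
    "\<And>r. r > 0 \<Longrightarrow> h r > 0"
proof
  interpret finite_measure M by fact
  define e :: "real ^ 'n" where "e = axis undefined 1"
  have e: "norm e = 1" by (simp add: e_def)
  have eq: "emeasure M (ball x r) = emeasure M (ball e r)" if x: "x \<in> sphere 0 1" for x r
  proof -
    obtain T where T: "orthogonal_transformation T" "T e = x"
      by (rule orthogonal_transformation_exists_1[OF e, of x]) (use x in auto)
    have im: "T ` ball e r = ball x r" using T by (simp add: image_orthogonal_transformation_ball)
    show ?thesis using inv[OF T(1), of "ball e r"] by (simp add: im)
  qed
  show "emeasure M (ball x r) = ennreal (measure M (ball e r))" if "x \<in> sphere 0 1" "r > 0" for x r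
    using eq[OF that(1)] by (simp add: emeasure_eq_measure)
  show "measure M (ball e r) > 0" if r: "r > 0" for r
  proof (rule ccontr)
    assume "\<not> ?thesis"
    hence "measure M (ball e r) = 0" using zero_less_measure_iff by blast
    hence z: "ball x r \<in> null_sets M" if "x \<in> sphere 0 1" for x
      using eq[OF that, of r] by (simp add: null_sets_def emeasure_eq_measure)
    have "compact (sphere (0::real^'n) 1)" by simp
    then obtain D where D: "D \<subseteq> sphere (0::real^'n) 1" "finite D" "sphere (0::real^'n) 1 \<subseteq> (\<Union>c\<in>D. ball c r)"
      by (rule compactE_image[where C = "sphere (0::real^'n) 1" and f = "\<lambda>c. ball c r"]) (use r in auto)
    have "(\<Union>c\<in>D. ball c r) \<in> null_sets M" using D z by (intro null_sets_UN') (auto intro: countable_finite)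
    hence "emeasure M (sphere 0 1) \<le> 0"
      using D(3) emeasure_mono[OF D(3), of M] by (simp add: null_sets_def)
    thus False using pos by simp
  qed
qed

text \<open>
  Both measures are invariant under orthogonal maps, so each gives equal mass to all balls of equal radius
  centred on the sphere. Positivity of the factor matters: otherwise conditions on \<open>\<Omega>\<close> with respect to the
  surface measure would say nothing about the cone measure.
\<close>

theorem surface_measure_proportional:
  obtains c :: real where "c > 0" "surface_measure = scale_measure (ennreal c) (cone_measure :: (real ^ 'n) measure)"
proof -
  let ?S = "sphere (0::real^'n) 1"
  let ?\<sigma> = "surface_measure :: (real ^ 'n) measure"
  let ?\<mu> = "cone_measure :: (real ^ 'n) measure"
  have sp [simp]: "space ?\<sigma> = UNIV" by (simp add: surface_measure_def)
  have fin: "emeasure ?\<sigma> UNIV < \<infinity>" and pos: "emeasure ?\<sigma> UNIV > 0"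
    using hausdorff_sphere_finite[where 'a = "real ^ 'n"] hausdorff_sphere_pos[where 'a = "real ^ 'n"]
    by (simp_all add: emeasure_surface_measure)
  have f\<sigma>: "finite_measure ?\<sigma>" using fin by (intro finite_measureI) auto
  have f\<mu>: "finite_measure ?\<mu>" by (rule finite_measure_cone_measure)
  have S\<sigma>: "AE x in ?\<sigma>. x \<in> ?S"
  proof (rule AE_I[of _ _ "- ?S"])
    show "emeasure ?\<sigma> (- ?S) = 0" by (subst emeasure_surface_measure) auto
  qed auto
  have S\<mu>: "AE x in ?\<mu>. x \<in> ?S" by (rule AE_cone_measure_sphere)
  have "emeasure ?\<sigma> ?S = emeasure ?\<sigma> UNIV"
    by (simp add: emeasure_surface_measure)
  hence p\<sigma>: "emeasure ?\<sigma> ?S > 0" using pos by simp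
  have "emeasure ?\<mu> ?S = emeasure ?\<mu> UNIV"
    using S\<mu> by (intro emeasure_eq_AE) auto
  hence p\<mu>: "emeasure ?\<mu> ?S > 0" by (simp add: emeasure_cone_measure_UNIV)
  obtain h where h: "\<And>x r. x \<in> ?S \<Longrightarrow> r > 0 \<Longrightarrow> emeasure ?\<sigma> (ball x r) = ennreal (h r)"
    "\<And>r. r > 0 \<Longrightarrow> h r > 0"
  proof (rule sphere_ball_measure_constant[OF _ f\<sigma> _ p\<sigma>])
    fix T :: "real^'n \<Rightarrow> real^'n" and A :: "(real^'n) set"
    assume T: "orthogonal_transformation T" and A: "A \<in> sets borel" "T ` A \<in> sets borel"
    have "T ` A \<inter> ?S = T ` (A \<inter> ?S)" using T by (auto simp: orthogonal_transformation_norm)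
    thus "emeasure ?\<sigma> (T ` A) = emeasure ?\<sigma> A"
      using A T by (simp add: emeasure_surface_measure hausdorff_outer_orthogonal_image)
  qed auto
  obtain k where k: "\<And>x r. x \<in> ?S \<Longrightarrow> r > 0 \<Longrightarrow> emeasure ?\<mu> (ball x r) = ennreal (k r)"
    "\<And>r. r > 0 \<Longrightarrow> k r > 0"
  proof (rule sphere_ball_measure_constant[OF sets_cone_measure f\<mu> _ p\<mu>])
    fix T :: "real^'n \<Rightarrow> real^'n" and A :: "(real^'n) set"
    assume "orthogonal_transformation T" "A \<in> sets borel" "T ` A \<in> sets borel"
    thus "emeasure ?\<mu> (T ` A) = emeasure ?\<mu> A" by (rule emeasure_cone_measure_orthogonal_image)
  qed blast
  define a where "a = measure ?\<sigma> UNIV"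
  define b where "b = measure ?\<mu> UNIV"
  have a0: "emeasure ?\<sigma> UNIV = ennreal a"
    unfolding a_def by (rule finite_measure.emeasure_eq_measure[OF f\<sigma>])
  moreover have "a > 0" using pos unfolding a0 by simp
  ultimately have a: "emeasure ?\<sigma> UNIV = ennreal a" "a > 0" by auto
  have b: "emeasure ?\<mu> UNIV = ennreal b" "b > 0"
    by (auto simp: b_def measure_def emeasure_cone_measure_UNIV)
  show thesis
  proof (rule that[of "a / b"])
    show "a / b > 0" using a b by simp
    show "?\<sigma> = scale_measure (ennreal (a / b)) ?\<mu>"
    proof (rule measure_eqI)
      fix A assume "A \<in> sets ?\<sigma>"
      hence A: "A \<in> sets borel" by simp
      have "emeasure ?\<mu> A * emeasure ?\<sigma> UNIV = emeasure ?\<sigma> A * emeasure ?\<mu> UNIV"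
        by (rule uniformly_distributed_proportional[OF _ _ f\<sigma> f\<mu> S\<sigma> S\<mu> h k A]) auto
      hence "ennreal (1 / b) * (emeasure ?\<mu> A * ennreal a) = ennreal (1 / b) * (emeasure ?\<sigma> A * ennreal b)"
        unfolding a b by simp
      moreover have "ennreal (1 / b) * (emeasure ?\<sigma> A * ennreal b) = emeasure ?\<sigma> A * (ennreal (1 / b) * ennreal b)"
        by (simp only: mult_ac)
      moreover have "ennreal (1 / b) * (emeasure ?\<mu> A * ennreal a) = (ennreal (1 / b) * ennreal a) * emeasure ?\<mu> A"
        by (simp only: mult_ac)
      ultimately show "emeasure ?\<sigma> A = emeasure (scale_measure (ennreal (a / b)) ?\<mu>) A"
        using a b by (simp add: ennreal_mult[symmetric])
    qed simp
  qed
qed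

lemma sphere_measure_eq: "restrict_space (hausdorff_measure (CARD('n) - 1)) (sphere 0 1)
   = restrict_space surface_measure (sphere (0::real^'n) 1)"
proof (rule measure_eqI)
  show "sets (restrict_space (hausdorff_measure (CARD('n) - 1)) (sphere (0::real^'n) 1)) = sets (restrict_space surface_measure (sphere 0 1))"
    by (intro sets_restrict_space_cong) simp
  fix A :: "(real^'n) set" assume "A \<in> sets (restrict_space (hausdorff_measure (CARD('n) - 1)) (sphere 0 1))"
  hence "A \<in> sets borel" "A \<subseteq> sphere 0 1"
    by (auto simp: sets_restrict_space_iff)
  thus "emeasure (restrict_space (hausdorff_measure (CARD('n) - 1)) (sphere 0 1)) A =
      emeasure (restrict_space surface_measure (sphere 0 1)) A"
    by (simp add: emeasure_restrict_space emeasure_surface_measure emeasure_hausdorff_measure Int_absorb2)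
qed

lemma AE_sphere_measure:
  "(AE y in sphere_measure. P y) \<longleftrightarrow> (AE y in (cone_measure :: (real^'n) measure). y \<in> sphere 0 1 \<longrightarrow> P y)"
proof -
  obtain c where c: "c > 0" "surface_measure = scale_measure (ennreal c) (cone_measure :: (real ^ 'n) measure)"
    by (rule surface_measure_proportional)
  have "(AE y in sphere_measure. P y) \<longleftrightarrow> (AE y in surface_measure. y \<in> sphere (0::real^'n) 1 \<longrightarrow> P y)"
    unfolding sphere_measure_def sphere_measure_eq AE_completion_iff
    by (subst AE_restrict_space_iff) auto
  also have "\<dots> \<longleftrightarrow> (AE y in (cone_measure :: (real^'n) measure). y \<in> sphere 0 1 \<longrightarrow> P y)"
  proof -
    have "emeasure surface_measure A = 0 \<longleftrightarrow> emeasure cone_measure A = 0" for A :: "(real^'n) set"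
      unfolding c(2) using c(1) by simp
    thus ?thesis unfolding eventually_ae_filter by (simp add: null_sets_def)
  qed
  finally show ?thesis .
qed

lemma ex_borel_complex_completion:
  fixes f :: "'a \<Rightarrow> complex"
  assumes f: "f \<in> borel_measurable (completion M)"
  obtains g where "g \<in> borel_measurable M" "AE x in M. f x = g x"
proof -
  have m: "(\<lambda>x. Re (f x)) \<in> borel_measurable (completion M)" "(\<lambda>x. Im (f x)) \<in> borel_measurable (completion M)"
    using f by measurable
  obtain r where [measurable]: "r \<in> borel_measurable M" and ae1: "AE x in M. Re (f x) = r x"
    using completion_ex_borel_measurable_real[OF m(1)] by auto
  obtain i where [measurable]: "i \<in> borel_measurable M" and ae2: "AE x in M. Im (f x) = i x"
    using completion_ex_borel_measurable_real[OF m(2)] by auto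
  show thesis
  proof (rule that[of "\<lambda>x. complex_of_real (r x) + \<i> * complex_of_real (i x)"])
    show "(\<lambda>x. complex_of_real (r x) + \<i> * complex_of_real (i x)) \<in> borel_measurable M"
      by measurable
    show "AE x in M. f x = complex_of_real (r x) + \<i> * complex_of_real (i x)"
      using ae1 ae2 by eventually_elim (simp add: complex_eq_iff)
  qed
qed

lemma borel_representative_on_sphere:
  fixes \<Omega> :: "real ^ 'n \<Rightarrow> complex"
  assumes "\<Omega> \<in> borel_measurable sphere_measure"
  obtains g where "g \<in> borel_measurable borel" "AE y in sphere_measure. \<Omega> y = g y"
proof -
  let ?R = "restrict_space (hausdorff_measure (CARD('n) - 1)) (sphere (0::real^'n) 1)"
  obtain g0 where g0: "g0 \<in> borel_measurable ?R" "AE y in ?R. \<Omega> y = g0 y"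
    using ex_borel_complex_completion assms unfolding sphere_measure_def by blast
  have S: "sphere (0::real^'n) 1 \<in> sets borel" by simp
  define g where "g = (\<lambda>y. indicator (sphere 0 1) y *\<^sub>R g0 y)"
  have "g \<in> borel_measurable (hausdorff_measure (CARD('n) - 1))"
    unfolding g_def using g0(1) S by (subst (asm) borel_measurable_restrict_space_iff) auto
  hence "g \<in> borel_measurable borel" by (simp cong: measurable_cong_sets)
  moreover have "AE y in sphere_measure. \<Omega> y = g y"
    unfolding sphere_measure_def AE_completion_iff
    using g0(2) AE_space by eventually_elim (simp add: g_def space_restrict_space)
  ultimately show thesis by (rule that)
qed

text \<open>
  The cone over a null set of directions is a null set.
\<close>

lemma AE_lborel_sgn:
  assumes "AE u in (cone_measure :: 'a::euclidean_space measure). P u"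
  shows "AE y in lborel. P (sgn (y::'a))"
proof -
  obtain N where N: "{u. \<not> P u} \<subseteq> N" "N \<in> sets borel" "emeasure (cone_measure :: 'a measure) N = 0"
    using assms unfolding eventually_ae_filter by (auto simp: null_sets_def)
  have "(\<integral>\<^sup>+y. indicator N (sgn (y::'a)) \<partial>lborel) = 0"
    using polar_indicator[OF N(2), of "\<lambda>_. 1"] N(3) by simp
  hence "AE y in lborel. indicator N (sgn (y::'a)) = (0::ennreal)"
    using N(2) by (subst (asm) nn_integral_0_iff_AE) auto
  thus ?thesis by eventually_elim (use N(1) in \<open>auto simp: indicator_def split: if_splits\<close>)
qed

lemma nn_integral_sphere_measure:
  fixes G :: "real ^ 'n \<Rightarrow> ennreal"
  assumes [measurable]: "G \<in> borel_measurable borel"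
  shows "(\<integral>\<^sup>+y. G y \<partial>sphere_measure) = (\<integral>\<^sup>+y. G y \<partial>surface_measure)"
proof -
  have S [measurable]: "sphere (0::real^'n) 1 \<in> sets borel" by simp
  show ?thesis
    unfolding sphere_measure_def nn_integral_completion surface_measure_def
    by (subst nn_integral_restrict_space, simp, subst nn_integral_density)
       (auto simp: mult.commute intro!: borel_measurable_indicator cong: measurable_cong_sets)
qed

text \<open>
  Passing to a Borel representative \<open>g\<close> and to the cone measure puts all hypotheses on
  \<open>\<Omega>\<close> into a form suited to polar coordinates.
\<close>

theorem sphere_function_polar:
  fixes \<Omega> :: "real ^ 'n \<Rightarrow> complex" and \<Psi> :: "real \<Rightarrow> real"
  assumes \<Omega>: "\<Omega> \<in> orlicz_space sphere_measure \<Psi>" and \<Psi> [measurable]: "\<Psi> \<in> borel_measurable borel"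
  obtains g c where "g \<in> borel_measurable borel" "AE y in lborel. \<Omega> (sgn y) = g (sgn y)"
    "c > 0" "(\<integral>\<^sup>+u. ennreal (\<Psi> (norm (g u) / c)) \<partial>cone_measure) < \<infinity>"
    "(LINT y|sphere_measure. \<Omega> y) = 0 \<Longrightarrow> (LINT u|cone_measure. g u) = 0"
proof -
  obtain k where k: "k > 0" "surface_measure = scale_measure (ennreal k) (cone_measure :: (real ^ 'n) measure)"
    by (rule surface_measure_proportional)
  have meas: "\<Omega> \<in> borel_measurable sphere_measure" and lux: "luxemburg_norm sphere_measure \<Psi> \<Omega> < \<infinity>"
    using \<Omega> by (auto simp: orlicz_space_def)
  obtain g where g [measurable]: "g \<in> borel_measurable borel" and ae: "AE y in sphere_measure. \<Omega> y = g y"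
    using borel_representative_on_sphere[OF meas] by blast
  have "AE u in cone_measure. \<Omega> u = g u"
    using ae[unfolded AE_sphere_measure] AE_cone_measure_sphere by eventually_elim auto
  hence ae': "AE y in lborel. \<Omega> (sgn y) = g (sgn y)" by (rule AE_lborel_sgn)
  obtain c where c: "c > 0" "(\<integral>\<^sup>+ x. ennreal (\<Psi> (norm (\<Omega> x) / c)) \<partial>sphere_measure) \<le> 1"
    using lux unfolding luxemburg_norm_def by (auto simp: Inf_less_iff)
  have "(\<integral>\<^sup>+ x. ennreal (\<Psi> (norm (\<Omega> x) / c)) \<partial>sphere_measure) = (\<integral>\<^sup>+ x. ennreal (\<Psi> (norm (g x) / c)) \<partial>sphere_measure)"
    by (rule nn_integral_cong_AE) (use ae in \<open>eventually_elim; simp\<close>)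
  also have "\<dots> = (\<integral>\<^sup>+ x. ennreal (\<Psi> (norm (g x) / c)) \<partial>surface_measure)"
    by (rule nn_integral_sphere_measure) measurable
  also have "\<dots> = ennreal k * (\<integral>\<^sup>+ x. ennreal (\<Psi> (norm (g x) / c)) \<partial>cone_measure)"
    unfolding k(2) by (rule nn_integral_scale_measure) measurable
  finally have "ennreal k * (\<integral>\<^sup>+ x. ennreal (\<Psi> (norm (g x) / c)) \<partial>cone_measure) \<le> 1" using c(2) by simp
  hence "ennreal k * (\<integral>\<^sup>+ x. ennreal (\<Psi> (norm (g x) / c)) \<partial>cone_measure) < \<infinity>"
    by (rule le_less_trans) simp
  hence fin: "(\<integral>\<^sup>+ x. ennreal (\<Psi> (norm (g x) / c)) \<partial>cone_measure) < \<infinity>"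
    using k(1) by (auto simp: ennreal_mult_less_top)
  have mean: "(LINT u|cone_measure. g u) = 0" if "(LINT y|sphere_measure. \<Omega> y) = 0"
  proof -
    have S [measurable]: "sphere (0::real^'n) 1 \<in> sets borel" by simp
    have g': "g \<in> borel_measurable sphere_measure"
      unfolding sphere_measure_def
      by (intro measurable_completion measurable_restrict_space1) (simp cong: measurable_cong_sets)
    have gR: "g \<in> borel_measurable (restrict_space surface_measure (sphere 0 1))"
      by (intro measurable_restrict_space1) (simp cong: measurable_cong_sets)
    have "(LINT y|sphere_measure. \<Omega> y) = (LINT y|sphere_measure. g y)"
      by (rule integral_cong_AE[OF meas g' ae])
    also have "\<dots> = (LINT y|restrict_space surface_measure (sphere 0 1). g y)"
      unfolding sphere_measure_def sphere_measure_eq by (rule integral_completion[OF gR])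
    also have "\<dots> = (LINT y|surface_measure. indicator (sphere 0 1) y *\<^sub>R g y)"
      by (subst integral_restrict_space) (auto simp: set_lebesgue_integral_def)
    also have "surface_measure = density cone_measure (\<lambda>_::real^'n. ennreal k)"
      unfolding k(2) by (intro measure_eqI) (auto simp: emeasure_density nn_integral_cmult_indicator)
    also have "(LINT y|density cone_measure (\<lambda>_::real^'n. ennreal k). indicator (sphere 0 1) y *\<^sub>R g y)
        = (LINT y|cone_measure. k *\<^sub>R (indicator (sphere 0 1) y *\<^sub>R g y))"
      using k(1) by (subst integral_density) auto
    also have "\<dots> = (LINT y|cone_measure. k *\<^sub>R g y)"
    proof (rule integral_cong_AE)
      show "AE y in cone_measure. k *\<^sub>R (indicator (sphere 0 1) y *\<^sub>R g y) = k *\<^sub>R g y"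
        using AE_cone_measure_sphere by eventually_elim simp
    qed auto
    finally show ?thesis using that k(1) by simp
  qed
  show thesis by (rule that[OF g ae' c(1) fin mean])
qed

section \<open>Oscillation and Riesz potentials on the unit ball\<close>

lemma nn_integral_lborel_affine:
  fixes F :: "'a::euclidean_space \<Rightarrow> ennreal"
  assumes [measurable]: "F \<in> borel_measurable borel" and c: "c \<noteq> 0"
  shows "(\<integral>\<^sup>+x. F x \<partial>lborel) = ennreal (\<bar>c\<bar> ^ DIM('a)) * (\<integral>\<^sup>+x. F (t + c *\<^sub>R x) \<partial>lborel)"
  by (subst lborel_affine[OF c, of t]) (simp add: nn_integral_density nn_integral_distr nn_integral_cmult)

text \<open>
  Hoelder's inequality with the second factor written as a power \<open>1 - 1/p\<close>. In this form the exponent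
  \<open>p = 1\<close>, which occurs in dimension one and at the endpoint, needs no essential supremum. It follows from
  Young's inequality after normalising both integrals to one.
\<close>

lemma nn_integral_holder:
  fixes f m :: "'a \<Rightarrow> real"
  assumes [measurable]: "f \<in> borel_measurable M" "m \<in> borel_measurable M"
    and nonneg: "\<And>x. f x \<ge> 0" "\<And>x. m x \<ge> 0" and p: "p \<ge> 1" and A: "A \<ge> 0" and B: "B > 0"
    and fA: "(\<integral>\<^sup>+x. ennreal (f x powr p) \<partial>M) \<le> ennreal (A powr p)"
    and mB: "(\<integral>\<^sup>+x. ennreal (m x) \<partial>M) \<le> ennreal B"
  shows "(\<integral>\<^sup>+x. ennreal (f x * m x powr (1 - 1/p)) \<partial>M) \<le> ennreal (A * B powr (1 - 1/p))"
proof (cases "A = 0")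
  case True
  hence "(\<integral>\<^sup>+x. ennreal (f x powr p) \<partial>M) = 0" using fA p by simp
  hence "AE x in M. ennreal (f x powr p) = 0" by (subst (asm) nn_integral_0_iff_AE) auto
  hence "AE x in M. f x = 0"
  proof eventually_elim
    case (elim x)
    have "f x powr p \<le> 0" using elim by (simp add: ennreal_eq_0_iff)
    thus ?case using nonneg(1)[of x] by (metis antisym powr_ge_zero powr_eq_0_iff)
  qed
  hence "(\<integral>\<^sup>+x. ennreal (f x * m x powr (1 - 1/p)) \<partial>M) = (\<integral>\<^sup>+x. 0 \<partial>M)"
    by (intro nn_integral_cong_AE) auto
  thus ?thesis by simp
next
  case False
  hence A: "A > 0" using A by simp
  define a where "a = 1 / p"
  have a: "0 < a" "a \<le> 1" using p by (auto simp: a_def)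
  have pt: "f x * m x powr (1 - a) \<le> A * B powr (1 - a) * (a / A powr p * f x powr p + (1 - a) / B * m x)" for x
  proof (cases "f x = 0 \<or> m x = 0")
    case True
    thus ?thesis using nonneg[of x] a A B by (auto intro!: mult_nonneg_nonneg add_nonneg_nonneg)
  next
    case False
    hence pos: "f x > 0" "m x > 0" using nonneg[of x] by (auto simp: less_le)
    have "((f x / A) powr p) powr a * (m x / B) powr (1 - a) \<le> a * (f x / A) powr p + (1 - a) * (m x / B)"
      using a pos A B by (intro Youngs_inequality_0) auto
    also have "((f x / A) powr p) powr a = f x / A" using pos A p by (simp add: powr_powr a_def)
    finally have "f x / A * (m x / B) powr (1 - a) \<le> a / A powr p * f x powr p + (1 - a) / B * m x"
      using pos A by (simp add: powr_divide)
    hence "A * B powr (1 - a) * (f x / A * (m x / B) powr (1 - a)) \<le> A * B powr (1 - a) * (a / A powr p * f x powr p + (1 - a) / B * m x)"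
      using A by (intro mult_left_mono) auto
    thus ?thesis using pos A B by (simp add: powr_divide)
  qed
  have "(\<integral>\<^sup>+x. ennreal (f x * m x powr (1 - 1/p)) \<partial>M)
     \<le> (\<integral>\<^sup>+x. ennreal (A * B powr (1 - a)) * (ennreal (a / A powr p) * ennreal (f x powr p) + ennreal ((1 - a) / B) * ennreal (m x)) \<partial>M)"
  proof (rule nn_integral_mono)
    fix x
    have "ennreal (f x * m x powr (1 - 1/p)) \<le> ennreal (A * B powr (1 - a) * (a / A powr p * f x powr p + (1 - a) / B * m x))"
      using pt[of x] by (intro ennreal_leI) (simp add: a_def)
    also have "\<dots> = ennreal (A * B powr (1 - a)) * (ennreal (a / A powr p) * ennreal (f x powr p) + ennreal ((1 - a) / B) * ennreal (m x))"
      using A B a nonneg[of x]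
      by (simp add: ennreal_mult[symmetric] ennreal_plus[symmetric] del: ennreal_plus)
    finally show "ennreal (f x * m x powr (1 - 1/p)) \<le> \<dots>" .
  qed
  also have "\<dots> = ennreal (A * B powr (1 - a)) * (ennreal (a / A powr p) * (\<integral>\<^sup>+x. ennreal (f x powr p) \<partial>M)
      + ennreal ((1 - a) / B) * (\<integral>\<^sup>+x. ennreal (m x) \<partial>M))"
    by (simp add: nn_integral_cmult nn_integral_add)
  also have "\<dots> \<le> ennreal (A * B powr (1 - a)) * (ennreal (a / A powr p) * ennreal (A powr p) + ennreal ((1 - a) / B) * ennreal B)"
    by (intro mult_left_mono add_mono fA mB) auto
  also have "ennreal (a / A powr p) * ennreal (A powr p) + ennreal ((1 - a) / B) * ennreal B = ennreal (a + (1 - a))"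
    using A B a by (simp add: ennreal_mult[symmetric] ennreal_plus[symmetric] del: ennreal_plus)
  finally show ?thesis by (simp add: a_def)
qed

lemma nn_integral_inverse_power_le:
  assumes a: "0 < a" "a \<le> 1" and n: "n > 0"
  shows "(\<integral>\<^sup>+t. ennreal (1 / t ^ Suc n) * indicator {a..1} t \<partial>lborel) \<le> ennreal (1 / (n * a ^ n))"
proof -
  have "(\<integral>\<^sup>+t. ennreal (1 / t ^ Suc n) * indicator {a..1} t \<partial>lborel) = ennreal ((- 1 / (real n * 1 ^ n)) - (- 1 / (real n * a ^ n)))"
  proof (rule nn_integral_FTC_Icc[where F = "\<lambda>t. - 1 / (real n * t ^ n)"])
    fix t :: real assume "t \<in> {a..1}"
    hence t: "a \<le> t" "t \<le> 1" by auto
    have *: "real n * t ^ (n - 1) / (real n * (t ^ n * t ^ n)) = 1 / t ^ Suc n"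
    proof -
      obtain k where k: "n = Suc k" using n by (cases n) auto
      have "real n * t ^ (n - 1) / (real n * (t ^ n * t ^ n)) = t ^ (n - 1) / (t ^ n * t ^ n)"
        using n by simp
      also have "\<dots> = 1 / t ^ Suc n" unfolding k using t a by (simp add: field_simps)
      finally show ?thesis .
    qed
    have tn: "t * t ^ (n - Suc 0) = t ^ n" using n by (cases n) auto
    show "((\<lambda>t. - 1 / (real n * t ^ n)) has_real_derivative 1 / t ^ Suc n) (at t)"
      using t a n by (auto intro!: derivative_eq_intros simp: *[symmetric] power2_eq_square field_simps tn)
    show "0 \<le> 1 / t ^ Suc n" using t a by simp
  qed (use a in auto)
  also have "\<dots> \<le> ennreal (1 / (n * a ^ n))" using n by (intro ennreal_leI) simp
  finally show ?thesis .
qed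

text \<open>
  Integrate the increment along the segment from \<open>z\<close> to \<open>w\<close> and substitute \<open>v = z + t (w - z)\<close>
  for \<open>w\<close>. The point \<open>v\<close> stays in the ball by convexity, the Jacobian is \<open>t\<^sup>-\<^sup>n\<close>, and \<open>|v - z| \<le> 2 t\<close> because
  \<open>|w - z| \<le> 2\<close>; integration in \<open>t\<close> then produces \<open>|v - z|\<^sup>1\<^sup>-\<^sup>n\<close>. The gradient enters only through the function
  \<open>h\<close> that dominates increments along segments.
\<close>

lemma oscillation_le_riesz_potential:
  fixes u :: "'a::euclidean_space \<Rightarrow> 'b::real_normed_vector" and h :: "'a \<Rightarrow> real"
  assumes h [measurable]: "h \<in> borel_measurable borel" and h0: "\<And>x. h x \<ge> 0"
    and u [measurable]: "(\<lambda>x. norm (u z - u x)) \<in> borel_measurable borel"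
    and ray: "\<And>w. ennreal (norm (u z - u w)) \<le>
        (\<integral>\<^sup>+t. ennreal (h (z + t *\<^sub>R (w - z)) * norm (w - z)) * indicator {0..1} t \<partial>lborel)"
    and z: "z \<in> cball 0 1"
  shows "(\<integral>\<^sup>+w. ennreal (norm (u z - u w)) * indicator (cball 0 1) w \<partial>lborel)
     \<le> ennreal (2 ^ DIM('a) / DIM('a)) *
        (\<integral>\<^sup>+v. ennreal (h v * norm (v - z) powr (1 - real DIM('a))) * indicator (cball 0 1) v \<partial>lborel)"
proof -
  define n where "n = DIM('a)"
  have n: "n > 0" by (simp add: n_def)
  have B [measurable]: "cball (0::'a) 1 \<in> sets borel" by simp
  let ?W = "\<lambda>t w. ennreal (h (z + t *\<^sub>R (w - z)) * norm (w - z)) * indicator {0..1} t * indicator (cball 0 1) w"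
  let ?V = "\<lambda>t v. ennreal (h v * norm (v - z) * (1 / t ^ Suc n)) * indicator {norm (v - z) / 2..1} t * indicator (cball 0 1) v"
  let ?K = "\<lambda>v. ennreal (h v * norm (v - z) powr (1 - real n)) * indicator (cball 0 1) v"
  have "(\<integral>\<^sup>+w. ennreal (norm (u z - u w)) * indicator (cball 0 1) w \<partial>lborel)
      \<le> (\<integral>\<^sup>+w. (\<integral>\<^sup>+t. ennreal (h (z + t *\<^sub>R (w - z)) * norm (w - z)) * indicator {0..1} t \<partial>lborel) * indicator (cball 0 1) w \<partial>lborel)"
    by (intro nn_integral_mono mult_right_mono ray) auto
  also have "\<dots> = (\<integral>\<^sup>+w. (\<integral>\<^sup>+t. ?W t w \<partial>lborel) \<partial>lborel)"
    by (intro nn_integral_cong nn_integral_multc[symmetric]) measurable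
  also have "\<dots> = (\<integral>\<^sup>+t. (\<integral>\<^sup>+w. ?W t w \<partial>lborel) \<partial>lborel)"
    by (rule lborel_pair.Fubini') measurable
  also have "\<dots> \<le> (\<integral>\<^sup>+t. (\<integral>\<^sup>+v. ?V t v \<partial>lborel) \<partial>lborel)"
  proof (rule nn_integral_mono_AE, rule AE_mp[OF AE_lborel_nonzero], rule AE_I2, rule impI)
    fix t :: real assume t0: "t \<noteq> 0"
    show "(\<integral>\<^sup>+w. ?W t w \<partial>lborel)
       \<le> (\<integral>\<^sup>+v. ?V t v \<partial>lborel)"
    proof (cases "0 < t \<and> t \<le> 1")
      case False
      hence "(indicator {0..1} t :: ennreal) = 0" using t0 by (auto simp: indicator_def)
      thus ?thesis by simp
    next
      case True
      hence t: "t > 0" "t \<le> 1" by auto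
      define \<phi> where "\<phi> v = z - (1/t) *\<^sub>R z + (1/t) *\<^sub>R v" for v
      have \<phi>: "\<phi> v - z = (1/t) *\<^sub>R (v - z)" for v by (simp add: \<phi>_def algebra_simps)
      have \<phi>2: "z + t *\<^sub>R (\<phi> v - z) = v" for v unfolding \<phi> using t by simp
      have "(\<integral>\<^sup>+w. ?W t w \<partial>lborel)
         = ennreal (\<bar>1/t\<bar> ^ DIM('a)) * (\<integral>\<^sup>+v. ?W t (\<phi> v) \<partial>lborel)"
        unfolding \<phi>_def using t by (intro nn_integral_lborel_affine) auto
      also have "\<dots> = (\<integral>\<^sup>+v. ennreal (\<bar>1/t\<bar> ^ DIM('a)) * ?W t (\<phi> v) \<partial>lborel)"
        unfolding \<phi>_def by (rule nn_integral_cmult[symmetric]) measurable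
      also have "\<dots> \<le> (\<integral>\<^sup>+v. ?V t v \<partial>lborel)"
      proof (rule nn_integral_mono)
        fix v
        show "ennreal (\<bar>1/t\<bar> ^ DIM('a)) * ?W t (\<phi> v)
          \<le> ?V t v"
        proof (cases "\<phi> v \<in> cball 0 1")
          case T: True
          have "v = (1 - t) *\<^sub>R z + t *\<^sub>R \<phi> v" using t by (simp add: \<phi>_def algebra_simps)
          moreover have "(1 - t) *\<^sub>R z + t *\<^sub>R \<phi> v \<in> cball 0 1"
            using convex_cball[of "0::'a" 1] z T t by (intro convexD) auto
          ultimately have v: "v \<in> cball 0 1" by simp
          have "norm (\<phi> v - z) \<le> norm (\<phi> v) + norm z" by (rule norm_triangle_ineq4)
          also have "\<dots> \<le> 2" using T z by simp
          finally have "norm (\<phi> v - z) \<le> 2" .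
          moreover have "norm (\<phi> v - z) = norm (v - z) / t" unfolding \<phi> using t by simp
          ultimately have "norm (v - z) / 2 \<le> t" using t by (simp add: field_simps)
          moreover have "\<bar>1/t\<bar> ^ n * (h v * norm (\<phi> v - z)) = h v * norm (v - z) * (1 / t ^ Suc n)"
            unfolding \<phi> using t by (simp add: power_divide)
          ultimately show ?thesis unfolding \<phi>2 n_def[symmetric] using v t T
            by (simp add: ennreal_mult'[symmetric])
        qed simp
      qed
      finally show ?thesis .
    qed
  qed
  also have "\<dots> = (\<integral>\<^sup>+v. (\<integral>\<^sup>+t. ?V t v \<partial>lborel) \<partial>lborel)"
  proof -
    have e: "indicator {norm (v - z) / 2..1} t = (indicator {p. norm (fst p - z) / 2 \<le> snd p \<and> snd p \<le> 1} (v, t) :: ennreal)" for v and t :: real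
      by (simp add: indicator_def)
    show ?thesis unfolding e by (rule lborel_pair.Fubini') measurable
  qed
  also have "\<dots> \<le> (\<integral>\<^sup>+v. ennreal (2 ^ n / n) * ?K v \<partial>lborel)"
  proof (rule nn_integral_mono_AE, rule AE_I[of _ _ "{z}"], safe)
    fix v assume "\<not> (\<integral>\<^sup>+t. ?V t v \<partial>lborel)
       \<le> ennreal (2 ^ n / n) * ?K v"
    moreover have "(\<integral>\<^sup>+t. ?V t v \<partial>lborel)
       \<le> ennreal (2 ^ n / n) * ?K v" if "v \<noteq> z"
    proof (cases "v \<in> cball 0 1")
      case True
      define a where "a = norm (v - z) / 2"
      have "norm (v - z) \<le> norm v + norm z" by (rule norm_triangle_ineq4)
      also have "\<dots> \<le> 2" using True z by simp
      finally have a: "0 < a" "a \<le> 1" using that by (auto simp: a_def)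
      have "(\<integral>\<^sup>+t. ?V t v \<partial>lborel)
        = (\<integral>\<^sup>+t. ennreal (h v * norm (v - z)) * (ennreal (1 / t ^ Suc n) * indicator {a..1} t) \<partial>lborel)"
        using True h0 a by (intro nn_integral_cong) (auto simp: a_def indicator_def ennreal_mult'[symmetric])
      also have "\<dots> = ennreal (h v * norm (v - z)) * (\<integral>\<^sup>+t. (ennreal (1 / t ^ Suc n) * indicator {a..1} t) \<partial>lborel)"
        by (rule nn_integral_cmult) measurable
      also have "\<dots> \<le> ennreal (h v * norm (v - z)) * ennreal (1 / (n * a ^ n))"
        by (intro mult_left_mono nn_integral_inverse_power_le a n) auto
      also have "\<dots> = ennreal (h v * norm (v - z) * (1 / (n * a ^ n)))"
        using h0 a by (subst ennreal_mult) auto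
      also have "h v * norm (v - z) * (1 / (n * a ^ n)) = 2 ^ n / n * (h v * (norm (v - z) / norm (v - z) ^ n))"
        by (simp add: a_def power_divide)
      also have "norm (v - z) / norm (v - z) ^ n = norm (v - z) powr (1 - real n)"
        using that by (simp add: powr_diff powr_realpow)
      also have "ennreal (2 ^ n / n * (h v * norm (v - z) powr (1 - real n))) = ennreal (2 ^ n / n) * ?K v"
        using True h0 by (subst ennreal_mult) auto
      finally show ?thesis .
    qed simp
    ultimately show "v = z" by blast
  qed auto
  also have "\<dots> = ennreal (2 ^ n / n) * (\<integral>\<^sup>+v. ?K v \<partial>lborel)"
    by (rule nn_integral_cmult) measurable
  finally show ?thesis by (simp add: n_def)
qed

text \<open>
  The logarithm of \<open>2 / \<delta>\<close> for \<open>\<delta> = (1 + G)\<^sup>-\<^sup>2\<close> equals \<open>ln 2 + 2 L\<close> with \<open>L = ln (1 + G)\<close>.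
\<close>

lemma log_power_split:
  fixes L a :: real
  assumes "L \<ge> 0" "0 \<le> a" "a \<le> 1"
  shows "(ln 2 + 2 * L) powr a \<le> 3 * (1 + L powr a)"
proof -
  have l2: "ln 2 \<le> (1::real)" "ln 2 > (0::real)" using ln_2_less_1 by auto
  have 3: "3 powr a \<le> (3::real)" using assms powr_mono[of a 1 3] by simp
  show ?thesis
  proof (cases "L \<le> 1")
    case True
    have "(ln 2 + 2 * L) powr a \<le> 3 powr a" using True assms l2 by (intro powr_mono2) auto
    also have "\<dots> \<le> 3 * (1 + L powr a)" using 3 by (smt (verit) powr_ge_zero)
    finally show ?thesis .
  next
    case False
    have "(ln 2 + 2 * L) powr a \<le> (3 * L) powr a" using False assms l2 by (intro powr_mono2) auto
    also have "\<dots> = 3 powr a * L powr a" using False by (simp add: powr_mult)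
    also have "\<dots> \<le> 3 * L powr a" by (intro mult_right_mono 3) auto
    finally show ?thesis by simp
  qed
qed

lemma nn_integral_translate_radial:
  fixes v :: "'a::euclidean_space"
  assumes [measurable]: "\<phi> \<in> borel_measurable borel"
  shows "(\<integral>\<^sup>+w. \<phi> (norm (v - w)) \<partial>lborel) = radial_integral DIM('a) \<phi> * ennreal (unit_ball_vol DIM('a))"
proof -
  have "(\<integral>\<^sup>+w. \<phi> (norm (v - w)) \<partial>lborel) = (\<integral>\<^sup>+w. \<phi> (norm (w::'a)) \<partial>lborel)"
    using nn_integral_lborel_affine[of "\<lambda>w. \<phi> (norm (v - w))" 1 v] by simp
  thus ?thesis by (simp add: nn_integral_radial)
qed

text \<open>
  This is where the Orlicz condition is used: functions in \<open>L (log L)\<^sup>1\<^sup>-\<^sup>1\<^sup>/\<^sup>n\<close> pair boundedly with Riesz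
  potentials of order one of functions in \<open>L\<^sup>n\<close>. For fixed \<open>w\<close> the potential is split at the distance
  \<open>\<delta>(w) = (1 + G(w))\<^sup>-\<^sup>2\<close>. In the far part, Hoelder's inequality meets the integral of \<open>|v - w|\<^sup>-\<^sup>n\<close> over
  \<open>\<delta>(w) \<le> |v - w| \<le> 2\<close>, which is a multiple of \<open>ln (2 / \<delta>(w))\<close>. In the near part \<open>G(w) \<le> |v - w|\<^sup>-\<^sup>1\<^sup>/\<^sup>2\<close>, and
  the kernel \<open>|v - w|\<^sup>1\<^sup>/\<^sup>2\<^sup>-\<^sup>n\<close> that results is integrable; an exponent of \<open>1 + G\<close> equal to \<open>-1\<close> would leave the
  non-integrable \<open>|v - w|\<^sup>-\<^sup>n\<close>.
\<close>

lemma rough_riesz_bound: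
  fixes G :: "'a::euclidean_space \<Rightarrow> real"
  defines "n \<equiv> real DIM('a)"
  assumes G [measurable]: "G \<in> borel_measurable borel" and G0: "\<And>w. G w \<ge> 0"
    and fin1: "(\<integral>\<^sup>+w. ennreal (G w) * indicator (cball 0 1) w \<partial>lborel) < \<infinity>"
    and fin2: "(\<integral>\<^sup>+w. ennreal (G w * ln (1 + G w) powr (1 - 1/n)) * indicator (cball 0 1) w \<partial>lborel) < \<infinity>"
  obtains C :: real where "C \<ge> 0" "\<And>h N. h \<in> borel_measurable borel \<Longrightarrow> (\<And>v. h v \<ge> 0) \<Longrightarrow> N \<ge> 0 \<Longrightarrow>
      (\<integral>\<^sup>+v. ennreal (h v powr n) * indicator (cball 0 1) v \<partial>lborel) \<le> ennreal (N powr n) \<Longrightarrow>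
      (\<integral>\<^sup>+w. ennreal (G w) * indicator (cball 0 1) w *
         (\<integral>\<^sup>+v. ennreal (h v * norm (v - w) powr (1 - n)) * indicator (cball 0 1) v \<partial>lborel) \<partial>lborel) \<le> ennreal (C * N)"
proof -
  define \<omega> where "\<omega> = unit_ball_vol n"
  have n: "n \<ge> 1" unfolding n_def by (metis DIM_positive Suc_leI of_nat_1 of_nat_mono One_nat_def)
  have \<omega>: "\<omega> > 0" using n by (simp add: \<omega>_def)
  define a where "a = 1 - 1/n"
  have a: "0 \<le> a" "a \<le> 1" using n by (auto simp: a_def)
  let ?B = "cball (0::'a) 1"
  have B [measurable]: "?B \<in> sets borel" by simp
  let ?R = "\<lambda>h w. \<integral>\<^sup>+v. ennreal (h v * norm (v - w) powr (1 - n)) * indicator ?B v \<partial>lborel"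
  have emB: "emeasure lborel ?B = ennreal \<omega>" by (simp add: emeasure_cball \<omega>_def n_def)
  define L where "L w = ln (1 + G w)" for w
  have L0: "L w \<ge> 0" for w using G0[of w] by (simp add: L_def)
  define I1 where "I1 = enn2real (\<integral>\<^sup>+w. ennreal (G w) * indicator ?B w \<partial>lborel)"
  define I2 where "I2 = enn2real (\<integral>\<^sup>+w. ennreal (G w * L w powr a) * indicator ?B w \<partial>lborel)"
  have I1: "(\<integral>\<^sup>+w. ennreal (G w) * indicator ?B w \<partial>lborel) = ennreal I1" "I1 \<ge> 0"
    using fin1 by (auto simp: I1_def)
  have I2: "(\<integral>\<^sup>+w. ennreal (G w * L w powr a) * indicator ?B w \<partial>lborel) = ennreal I2" "I2 \<ge> 0"
    using fin2 by (auto simp: I2_def a_def L_def)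
  define C where "C = 2 * n * \<omega> * \<omega> powr a + 3 * (n * \<omega>) powr a * (I1 + I2)"
  have C0: "C \<ge> 0" using n \<omega> I1 I2 by (simp add: C_def)
  show thesis
  proof (rule that[OF C0])
    fix h :: "'a \<Rightarrow> real" and N :: real
    assume h [measurable]: "h \<in> borel_measurable borel" and h0: "\<And>v. h v \<ge> 0" and N: "N \<ge> 0"
      and hN: "(\<integral>\<^sup>+v. ennreal (h v powr n) * indicator ?B v \<partial>lborel) \<le> ennreal (N powr n)"
    define f where "f v = h v * indicator ?B v" for v
    have f [measurable]: "f \<in> borel_measurable borel" unfolding f_def by measurable
    have f0: "f v \<ge> 0" for v using h0 by (simp add: f_def)
    have fN: "(\<integral>\<^sup>+v. ennreal (f v powr n) \<partial>lborel) \<le> ennreal (N powr n)"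
    proof -
      have "(\<integral>\<^sup>+v. ennreal (f v powr n) \<partial>lborel) = (\<integral>\<^sup>+v. ennreal (h v powr n) * indicator ?B v \<partial>lborel)"
        by (intro nn_integral_cong) (auto simp: f_def indicator_def)
      thus ?thesis using hN by simp
    qed
    define \<delta> where "\<delta> w = 1 / (1 + G w)\<^sup>2" for w
    have \<delta>: "0 < \<delta> w" "\<delta> w \<le> 1" for w using G0[of w] by (auto simp: \<delta>_def one_le_power)
    have \<delta>m [measurable]: "\<delta> \<in> borel_measurable borel" unfolding \<delta>_def by measurable
    have ln\<delta>: "ln (2 / \<delta> w) = ln 2 + 2 * L w" for w
      using G0[of w] by (simp add: \<delta>_def L_def ln_mult ln_realpow add_pos_nonneg)
    \<comment> \<open>Hoelder's inequality with exponent \<open>n\<close>, since \<open>|v - w|\<^sup>1\<^sup>-\<^sup>n\<close> is the power \<open>1 - 1/n\<close> of \<open>|v - w|\<^sup>-\<^sup>n\<close>.\<close>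
    have far: "(\<integral>\<^sup>+v. ennreal (f v * norm (v - w) powr (1 - n) * indicator {\<delta> w..2} (norm (v - w))) \<partial>lborel)
        \<le> ennreal (N * (3 * (n * \<omega>) powr a * (1 + L w powr a)))" for w
    proof -
      define m where "m v = norm (v - w) powr (- n) * indicator {\<delta> w..2} (norm (v - w))" for v
      have mm [measurable]: "m \<in> borel_measurable borel" unfolding m_def by measurable
      define b where "b = n * \<omega> * (ln 2 + 2 * L w)"
      have "0 < ln 2 + 2 * L w" using L0[of w] by (intro add_pos_nonneg) auto
      hence b: "b > 0" using n \<omega> by (simp add: b_def)
      have "(\<integral>\<^sup>+v. ennreal (m v) \<partial>lborel) = (\<integral>\<^sup>+v. (\<lambda>r. ennreal (r powr (- n)) * indicator {\<delta> w..2} r) (norm (w - v)) \<partial>lborel)"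
        by (intro nn_integral_cong) (auto simp: m_def indicator_def norm_minus_commute)
      also have "\<dots> = radial_integral DIM('a) (\<lambda>r. ennreal (r powr (- n)) * indicator {\<delta> w..2} r) * ennreal \<omega>"
        unfolding \<omega>_def n_def by (rule nn_integral_translate_radial) measurable
      also have "radial_integral DIM('a) (\<lambda>r. ennreal (r powr (- n)) * indicator {\<delta> w..2} r) = ennreal (n * ln (2 / \<delta> w))"
        unfolding n_def using \<delta>[of w] by (intro radial_integral_log) auto
      also have "\<dots> * ennreal \<omega> = ennreal b"
        using n \<omega> L0[of w] unfolding ln\<delta> by (subst ennreal_mult[symmetric]) (auto simp: b_def mult_ac)
      finally have mb: "(\<integral>\<^sup>+v. ennreal (m v) \<partial>lborel) \<le> ennreal b" by simp
      have mp: "m v powr (1 - 1/n) = norm (v - w) powr (1 - n) * indicator {\<delta> w..2} (norm (v - w))" for v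
        using n by (auto simp: m_def indicator_def powr_powr right_diff_distrib)
      have "(\<integral>\<^sup>+v. ennreal (f v * norm (v - w) powr (1 - n) * indicator {\<delta> w..2} (norm (v - w))) \<partial>lborel)
          = (\<integral>\<^sup>+v. ennreal (f v * m v powr (1 - 1/n)) \<partial>lborel)"
        unfolding mp by (simp add: mult.assoc)
      also have "\<dots> \<le> ennreal (N * b powr (1 - 1/n))"
        by (rule nn_integral_holder[OF _ _ f0 _ n N b fN mb]) (auto simp: m_def)
      also have "\<dots> \<le> ennreal (N * (3 * (n * \<omega>) powr a * (1 + L w powr a)))"
      proof (intro ennreal_leI mult_left_mono N)
        have "b powr (1 - 1/n) = (n * \<omega>) powr a * (ln 2 + 2 * L w) powr a"
          using n \<omega> L0[of w] unfolding b_def a_def by (subst powr_mult) auto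
        also have "\<dots> \<le> (n * \<omega>) powr a * (3 * (1 + L w powr a))"
          by (intro mult_left_mono log_power_split L0 a) auto
        finally show "b powr (1 - 1/n) \<le> 3 * (n * \<omega>) powr a * (1 + L w powr a)" by (simp add: algebra_simps)
      qed
      finally show ?thesis .
    qed
    define near where "near w v = ennreal (G w) * indicator ?B w *
       ennreal (f v * norm (v - w) powr (1 - n)) * indicator {p. norm (snd p - fst p) < \<delta> (fst p)} (w, v)" for w v
    have nearm [measurable]: "case_prod near \<in> borel_measurable (lborel \<Otimes>\<^sub>M lborel)"
      unfolding near_def by measurable
    have nearm1 [measurable]: "near w \<in> borel_measurable borel" for w
      unfolding near_def by measurable
    have split: "ennreal (G w) * indicator ?B w * ?R h w
       \<le> (\<integral>\<^sup>+v. near w v \<partial>lborel) + ennreal (3 * (n * \<omega>) powr a * N) * (ennreal (G w) * indicator ?B w + ennreal (G w * L w powr a) * indicator ?B w)" for w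
    proof (cases "w \<in> ?B")
      case True
      let ?far = "\<lambda>v. ennreal (f v * norm (v - w) powr (1 - n) * indicator {\<delta> w..2} (norm (v - w)))"
      have "ennreal (G w) * indicator ?B w * ?R h w
         = (\<integral>\<^sup>+v. ennreal (G w) * (ennreal (h v * norm (v - w) powr (1 - n)) * indicator ?B v) \<partial>lborel)"
        using True by (subst nn_integral_cmult) auto
      also have "\<dots> \<le> (\<integral>\<^sup>+v. near w v + ennreal (G w) * ?far v \<partial>lborel)"
      proof (rule nn_integral_mono)
        fix v
        show "ennreal (G w) * (ennreal (h v * norm (v - w) powr (1 - n)) * indicator ?B v) \<le> near w v + ennreal (G w) * ?far v"
        proof (cases "v \<in> ?B")
          case v: True
          have "norm (v - w) \<le> norm v + norm w" by (rule norm_triangle_ineq4)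
          also have "\<dots> \<le> 2" using True v by simp
          finally show ?thesis using v True by (cases "norm (v - w) < \<delta> w") (auto simp: near_def f_def)
        qed simp
      qed
      also have "\<dots> = (\<integral>\<^sup>+v. near w v \<partial>lborel) + ennreal (G w) * (\<integral>\<^sup>+v. ?far v \<partial>lborel)"
        by (subst nn_integral_add) (auto simp: nn_integral_cmult)
      also have "\<dots> \<le> (\<integral>\<^sup>+v. near w v \<partial>lborel) + ennreal (G w) * ennreal (N * (3 * (n * \<omega>) powr a * (1 + L w powr a)))"
        by (intro add_left_mono mult_left_mono far) auto
      also have "ennreal (G w) * ennreal (N * (3 * (n * \<omega>) powr a * (1 + L w powr a)))
          = ennreal (3 * (n * \<omega>) powr a * N) * (ennreal (G w) * indicator ?B w + ennreal (G w * L w powr a) * indicator ?B w)"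
        using True G0[of w] N n \<omega>
        by (simp add: ennreal_mult[symmetric] ennreal_plus[symmetric] algebra_simps del: ennreal_plus)
      finally show ?thesis .
    qed simp
    have "(\<integral>\<^sup>+w. ennreal (G w) * indicator ?B w *
         ?R h w \<partial>lborel)
       \<le> (\<integral>\<^sup>+w. (\<integral>\<^sup>+v. near w v \<partial>lborel) + ennreal (3 * (n * \<omega>) powr a * N) * (ennreal (G w) * indicator ?B w + ennreal (G w * L w powr a) * indicator ?B w) \<partial>lborel)"
      by (intro nn_integral_mono split)
    also have "\<dots> = (\<integral>\<^sup>+w. \<integral>\<^sup>+v. near w v \<partial>lborel \<partial>lborel) + ennreal (3 * (n * \<omega>) powr a * N) * (ennreal I1 + ennreal I2)"
    proof -
      have Lm [measurable]: "L \<in> borel_measurable borel" unfolding L_def by measurable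
      have [measurable]: "(\<lambda>w. \<integral>\<^sup>+v. near w v \<partial>lborel) \<in> borel_measurable borel"
        using lborel.borel_measurable_nn_integral[OF nearm] by simp
      show ?thesis
        unfolding I1(1)[symmetric] I2(1)[symmetric]
        by (simp add: nn_integral_add nn_integral_cmult)
    qed
    also have "(\<integral>\<^sup>+w. \<integral>\<^sup>+v. near w v \<partial>lborel \<partial>lborel) \<le> ennreal (2 * n * \<omega> * \<omega> powr a * N)"
    proof -
      define \<phi> where "\<phi> r = ennreal (r powr (1/2 - n)) * indicator {..1} r" for r
      have \<phi>m [measurable]: "\<phi> \<in> borel_measurable borel" unfolding \<phi>_def by measurable
      have "(\<integral>\<^sup>+w. \<integral>\<^sup>+v. near w v \<partial>lborel \<partial>lborel) \<le> (\<integral>\<^sup>+w. \<integral>\<^sup>+v. ennreal (f v) * \<phi> (norm (v - w)) \<partial>lborel \<partial>lborel)"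
      proof (intro nn_integral_mono)
        fix w v
        show "near w v \<le> ennreal (f v) * \<phi> (norm (v - w))"
        proof (cases "v \<noteq> w \<and> norm (v - w) < \<delta> w")
          case True
          define r where "r = norm (v - w)"
          have r: "0 < r" "r < \<delta> w" "r \<le> 1" using True \<delta>[of w] by (auto simp: r_def)
          \<comment> \<open>One half power of the distance \<open>r\<close> pays for the factor \<open>G w\<close>.\<close>
          have "(1 + G w)\<^sup>2 * r \<le> 1" using r G0[of w] by (simp add: \<delta>_def field_simps add_pos_nonneg)
          hence "(1 + G w)\<^sup>2 \<le> 1 / r" using r by (simp add: field_simps)
          hence "1 + G w \<le> sqrt (1 / r)" using real_le_rsqrt by blast
          hence "G w \<le> r powr (-1/2)" using r by (simp add: powr_half_sqrt[symmetric] powr_minus_divide powr_divide)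
          hence "G w * (f v * r powr (1 - n)) \<le> r powr (-1/2) * (f v * r powr (1 - n))"
            using f0 by (intro mult_right_mono) auto
          also have "\<dots> = f v * r powr (1/2 - n)" using r by (simp add: powr_add[symmetric])
          finally have "ennreal (G w) * ennreal (f v * r powr (1 - n)) \<le> ennreal (f v) * ennreal (r powr (1/2 - n))"
            using G0 f0 by (simp add: ennreal_mult[symmetric] ennreal_leI)
          hence "ennreal (G w) * indicator ?B w * ennreal (f v * r powr (1 - n)) \<le> ennreal (f v) * ennreal (r powr (1/2 - n))"
            by (auto simp: indicator_def)
          thus ?thesis using r unfolding near_def \<phi>_def r_def[symmetric] by (simp add: indicator_def)
        qed (auto simp: near_def)
      qed
      also have "\<dots> = (\<integral>\<^sup>+v. \<integral>\<^sup>+w. ennreal (f v) * \<phi> (norm (v - w)) \<partial>lborel \<partial>lborel)"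
        by (rule lborel_pair.Fubini') measurable
      also have "\<dots> = (\<integral>\<^sup>+v. ennreal (f v) * (\<integral>\<^sup>+w. \<phi> (norm (v - w)) \<partial>lborel) \<partial>lborel)"
        by (intro nn_integral_cong nn_integral_cmult) measurable
      also have "\<dots> = (\<integral>\<^sup>+v. ennreal (f v) * (ennreal (n * 1 powr (1/2) / (1/2)) * ennreal \<omega>) \<partial>lborel)"
        unfolding nn_integral_translate_radial[OF \<phi>m] unfolding \<phi>_def \<omega>_def n_def
        by (subst radial_integral_power) auto
      also have "\<dots> = (\<integral>\<^sup>+v. ennreal (f v) \<partial>lborel) * (ennreal (n * 1 powr (1/2) / (1/2)) * ennreal \<omega>)"
        by (rule nn_integral_multc) measurable
      also have "(\<integral>\<^sup>+v. ennreal (f v) \<partial>lborel) \<le> ennreal (N * \<omega> powr (1 - 1/n))"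
      proof -
        have "(\<integral>\<^sup>+v. ennreal (f v) \<partial>lborel) = (\<integral>\<^sup>+v. ennreal (f v * indicator ?B v powr (1 - 1/n)) \<partial>lborel)"
          by (intro nn_integral_cong) (auto simp: f_def indicator_def)
        also have "\<dots> \<le> ennreal (N * \<omega> powr (1 - 1/n))"
          by (rule nn_integral_holder[OF _ _ f0 _ n N \<omega> fN]) (auto simp: ennreal_indicator emB)
        finally show ?thesis .
      qed
      also have "ennreal (N * \<omega> powr (1 - 1/n)) * (ennreal (n * 1 powr (1/2) / (1/2)) * ennreal \<omega>) = ennreal (2 * n * \<omega> * \<omega> powr a * N)"
        using N \<omega> n by (simp add: ennreal_mult[symmetric] a_def mult_ac)
      finally show ?thesis by (simp add: mult_right_mono)
    qed
    also have "ennreal (2 * n * \<omega> * \<omega> powr a * N) + ennreal (3 * (n * \<omega>) powr a * N) * (ennreal I1 + ennreal I2) = ennreal (C * N)"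
      using n \<omega> N I1 I2
      by (simp add: ennreal_mult[symmetric] ennreal_plus[symmetric] C_def algebra_simps del: ennreal_plus)
    finally show "(\<integral>\<^sup>+w. ennreal (G w) * indicator ?B w *
         ?R h w \<partial>lborel) \<le> ennreal (C * N)"
      by (simp add: add_right_mono)
  qed
qed

text \<open>
  As the kernel has integral zero, any value \<open>u v\<close> may be subtracted from \<open>u\<close>. Averaging over all
  \<open>v\<close> in the ball, instead of subtracting the mean of \<open>u\<close>, keeps the argument within integrals of nonnegative
  functions.
\<close>

lemma norm_integral_cancel_le:
  fixes k u :: "'a::euclidean_space \<Rightarrow> complex" and h :: "'a \<Rightarrow> real"
  assumes k: "integrable lborel k" "(LINT w|lborel. k w) = 0" and ku: "integrable lborel (\<lambda>w. k w * u w)"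
    and u [measurable]: "u \<in> borel_measurable borel"
    and G [measurable]: "G \<in> borel_measurable borel" and G0: "\<And>w. G w \<ge> 0"
    and kG: "\<And>w. norm (k w) \<le> \<kappa> * G w * indicator (cball 0 1) w" and \<kappa>: "\<kappa> \<ge> 0"
    and h [measurable]: "h \<in> borel_measurable borel" and h0: "\<And>x. h x \<ge> 0"
    and ray: "\<And>z w. ennreal (norm (u z - u w)) \<le>
        (\<integral>\<^sup>+t. ennreal (h (z + t *\<^sub>R (w - z)) * norm (w - z)) * indicator {0..1} t \<partial>lborel)"
    and riesz: "(\<integral>\<^sup>+w. ennreal (G w) * indicator (cball 0 1) w *
         (\<integral>\<^sup>+v. ennreal (h v * norm (v - w) powr (1 - real DIM('a))) * indicator (cball 0 1) v \<partial>lborel) \<partial>lborel) \<le> ennreal D"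
    and D: "D \<ge> 0"
  shows "norm (LINT w|lborel. k w * u w) \<le> \<kappa> * 2 ^ DIM('a) / (DIM('a) * unit_ball_vol DIM('a)) * D"
proof -
  let ?B = "cball (0::'a) 1"
  have B [measurable]: "?B \<in> sets borel" by simp
  let ?R = "\<lambda>w. \<integral>\<^sup>+v. ennreal (h v * norm (v - w) powr (1 - real DIM('a))) * indicator ?B v \<partial>lborel"
  let ?U = "\<lambda>w v. ennreal (\<kappa> * G w) * indicator ?B w * ennreal (norm (u w - u v))"
  have km [measurable]: "k \<in> borel_measurable borel" using k(1) by simp
  define I where "I = (LINT w|lborel. k w * u w)"
  define \<omega> where "\<omega> = unit_ball_vol (real DIM('a))"
  have \<omega>: "\<omega> > 0" by (simp add: \<omega>_def)
  have I: "ennreal (norm I) \<le> (\<integral>\<^sup>+w. ?U w v \<partial>lborel)" for v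
  proof -
    have "I = (LINT w|lborel. k w * u w) - (LINT w|lborel. k w * u v)"
      using k by (simp add: I_def)
    also have "\<dots> = (LINT w|lborel. k w * u w - k w * u v)"
      using k ku by (subst Bochner_Integration.integral_diff) auto
    also have "\<dots> = (LINT w|lborel. k w * (u w - u v))" by (simp add: right_diff_distrib)
    finally have e: "I = (LINT w|lborel. k w * (u w - u v))" .
    have int: "integrable lborel (\<lambda>w. k w * (u w - u v))"
      using k ku by (simp add: right_diff_distrib)
    have "ennreal (norm I) \<le> (\<integral>\<^sup>+w. ennreal (norm (k w * (u w - u v))) \<partial>lborel)"
      unfolding e by (rule integral_norm_bound_ennreal[OF int])
    also have "\<dots> \<le> (\<integral>\<^sup>+w. ?U w v \<partial>lborel)"
    proof (rule nn_integral_mono)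
      fix w
      have "norm (k w * (u w - u v)) \<le> (\<kappa> * G w * indicator ?B w) * norm (u w - u v)"
        unfolding norm_mult by (intro mult_right_mono kG) auto
      thus "ennreal (norm (k w * (u w - u v))) \<le> ?U w v"
        using \<kappa> G0[of w] by (auto simp: indicator_def ennreal_mult[symmetric] intro!: ennreal_leI split: if_splits)
    qed
    finally show ?thesis .
  qed
  have "ennreal (norm I * \<omega>) = (\<integral>\<^sup>+v. ennreal (norm I) * indicator ?B v \<partial>lborel)"
    using \<omega> by (simp add: nn_integral_cmult_indicator emeasure_cball \<omega>_def ennreal_mult)
  also have "\<dots> \<le> (\<integral>\<^sup>+v. (\<integral>\<^sup>+w. ?U w v \<partial>lborel) * indicator ?B v \<partial>lborel)"
    by (intro nn_integral_mono mult_right_mono I) auto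
  also have "\<dots> = (\<integral>\<^sup>+v. (\<integral>\<^sup>+w. ?U w v * indicator ?B v \<partial>lborel) \<partial>lborel)"
    by (intro nn_integral_cong nn_integral_multc[symmetric]) measurable
  also have "\<dots> = (\<integral>\<^sup>+w. (\<integral>\<^sup>+v. ?U w v * indicator ?B v \<partial>lborel) \<partial>lborel)"
    by (rule lborel_pair.Fubini') measurable
  also have "\<dots> \<le> (\<integral>\<^sup>+w. ennreal (\<kappa> * 2 ^ DIM('a) / DIM('a)) * (ennreal (G w) * indicator ?B w *
         ?R w) \<partial>lborel)"
  proof (rule nn_integral_mono)
    fix w
    show "(\<integral>\<^sup>+v. ?U w v * indicator ?B v \<partial>lborel)
       \<le> ennreal (\<kappa> * 2 ^ DIM('a) / DIM('a)) * (ennreal (G w) * indicator ?B w *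
         ?R w)"
    proof (cases "w \<in> ?B")
      case True
      have "(\<integral>\<^sup>+v. ?U w v * indicator ?B v \<partial>lborel)
          = ennreal (\<kappa> * G w) * (\<integral>\<^sup>+v. ennreal (norm (u w - u v)) * indicator ?B v \<partial>lborel)"
        using True by (subst nn_integral_cmult[symmetric]) (auto simp: mult.assoc)
      also have "\<dots> \<le> ennreal (\<kappa> * G w) * (ennreal (2 ^ DIM('a) / DIM('a)) *
          ?R w)"
        by (intro mult_left_mono oscillation_le_riesz_potential[OF h h0 _ ray True]) auto
      also have "\<dots> = (ennreal (\<kappa> * G w) * ennreal (2 ^ DIM('a) / DIM('a))) *
          ?R w"
        by (simp only: mult.assoc)
      also have "ennreal (\<kappa> * G w) * ennreal (2 ^ DIM('a) / DIM('a)) = ennreal (\<kappa> * 2 ^ DIM('a) / DIM('a)) * ennreal (G w)"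
        using \<kappa> G0[of w] by (simp add: ennreal_mult[symmetric] mult_ac)
      finally show ?thesis using True by (simp add: mult.assoc)
    qed simp
  qed
  also have "\<dots> = ennreal (\<kappa> * 2 ^ DIM('a) / DIM('a)) * (\<integral>\<^sup>+w. (ennreal (G w) * indicator ?B w *
         ?R w) \<partial>lborel)"
    by (rule nn_integral_cmult) measurable
  also have "\<dots> \<le> ennreal (\<kappa> * 2 ^ DIM('a) / DIM('a)) * ennreal D"
    by (intro mult_left_mono riesz) auto
  also have "\<dots> = ennreal (\<kappa> * 2 ^ DIM('a) / DIM('a) * D)" using D \<kappa> by (intro ennreal_mult[symmetric]) auto
  finally have "norm I * \<omega> \<le> \<kappa> * 2 ^ DIM('a) / DIM('a) * D"
    using D \<kappa> by (subst (asm) ennreal_le_iff) auto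
  thus ?thesis unfolding I_def[symmetric] \<omega>_def[symmetric] using \<omega> by (simp add: field_simps)
qed

section \<open>The dyadic maximal operator\<close>

text \<open>
  Dyadic radii suffice for the annuli and make the supremum countable, hence measurable. The
  averages are normalised by \<open>r\<^sup>n\<close> in place of the volume of the ball.
\<close>

definition dyadic_maximal :: "('a::euclidean_space \<Rightarrow> ennreal) \<Rightarrow> 'a \<Rightarrow> ennreal" where
  "dyadic_maximal H x = (SUP k::int. ennreal (1 / (2 powr k) ^ DIM('a)) * (\<integral>\<^sup>+y. H y * indicator (cball x (2 powr k)) y \<partial>lborel))"

lemma borel_measurable_cball_integral [measurable]:
  fixes H :: "'a::euclidean_space \<Rightarrow> ennreal"
  assumes [measurable]: "H \<in> borel_measurable borel"
  shows "(\<lambda>x. \<integral>\<^sup>+y. H y * indicator (cball x r) y \<partial>lborel) \<in> borel_measurable borel"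
proof -
  have e: "indicator (cball x r) y = (indicator {p. dist (fst p) (snd p) \<le> r} (x, y) :: ennreal)" for x y :: 'a
    by (simp add: indicator_def)
  show ?thesis unfolding e by measurable
qed

lemma borel_measurable_dyadic_maximal [measurable]:
  fixes H :: "'a::euclidean_space \<Rightarrow> ennreal"
  assumes [measurable]: "H \<in> borel_measurable borel"
  shows "dyadic_maximal H \<in> borel_measurable borel"
  unfolding dyadic_maximal_def[abs_def] by measurable

lemma emeasure_UN_le_nn_integral_count_space:
  assumes I: "countable I" and A: "\<And>i. i \<in> I \<Longrightarrow> A i \<in> sets M"
  shows "emeasure M (\<Union>i\<in>I. A i) \<le> (\<integral>\<^sup>+i. emeasure M (A i) \<partial>count_space I)"
proof -
  have U: "(\<Union>i\<in>I. A i) \<in> sets M" using assms by (intro sets.countable_UN') auto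
  have "emeasure M (\<Union>i\<in>I. A i) = (\<integral>\<^sup>+x. indicator (\<Union>i\<in>I. A i) x \<partial>M)" using U by simp
  also have "\<dots> \<le> (\<integral>\<^sup>+x. (\<integral>\<^sup>+i. indicator (A i) x \<partial>count_space I) \<partial>M)"
  proof (rule nn_integral_mono)
    fix x
    show "indicator (\<Union>i\<in>I. A i) x \<le> (\<integral>\<^sup>+i. indicator (A i) x \<partial>count_space I)"
    proof (cases "x \<in> (\<Union>i\<in>I. A i)")
      case True
      then obtain j where j: "j \<in> I" "x \<in> A j" by auto
      have "1 = (\<integral>\<^sup>+i. indicator {j} i \<partial>count_space I)" using j by simp
      also have "\<dots> \<le> (\<integral>\<^sup>+i. indicator (A i) x \<partial>count_space I)"
        using j by (intro nn_integral_mono) (auto simp: indicator_def)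
      finally show ?thesis using True by simp
    qed simp
  qed
  also have "\<dots> = (\<integral>\<^sup>+i. (\<integral>\<^sup>+x. indicator (A i) x \<partial>M) \<partial>count_space I)"
    using I A by (intro nn_integral_count_space_nn_integral) auto
  also have "\<dots> = (\<integral>\<^sup>+i. emeasure M (A i) \<partial>count_space I)"
    using A by (intro nn_integral_cong) simp
  finally show ?thesis .
qed

text \<open>
  Vitali's covering lemma selects disjoint balls on which the average of \<open>H\<close> is large and whose five-fold
  enlargements cover the level set. The lemma needs bounded radii; they are bounded
  because the integral of \<open>H\<close> may be taken to be finite.
\<close>

theorem dyadic_maximal_weak_type:
  fixes H :: "'a::euclidean_space \<Rightarrow> ennreal"
  assumes H [measurable]: "H \<in> borel_measurable borel" and l: "t > 0"
  shows "emeasure lborel {x. dyadic_maximal H x > ennreal t}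
     \<le> ennreal (5 ^ DIM('a) * unit_ball_vol DIM('a) / t) * (\<integral>\<^sup>+y. H y \<partial>lborel)"
proof (cases "(\<integral>\<^sup>+y. H y \<partial>lborel) = \<infinity>")
  case True
  have "ennreal (5 ^ DIM('a) * unit_ball_vol DIM('a) / t) \<noteq> 0" using l by (simp add: ennreal_eq_0_iff not_le)
  thus ?thesis using True by (simp add: ennreal_mult_top)
next
  case False
  define n where "n = DIM('a)"
  have n: "n > 0" by (simp add: n_def)
  define \<omega> where "\<omega> = unit_ball_vol (real n)"
  have \<omega>: "\<omega> > 0" by (simp add: \<omega>_def)
  define T where "T = enn2real (\<integral>\<^sup>+y. H y \<partial>lborel)"
  have T: "(\<integral>\<^sup>+y. H y \<partial>lborel) = ennreal T" "T \<ge> 0" using False by (auto simp: T_def less_top)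
  define D where "D = density lborel H"
  have Dc: "emeasure D (cball x r) = (\<integral>\<^sup>+y. H y * indicator (cball x r) y \<partial>lborel)" for x r
    unfolding D_def by (subst emeasure_density) auto
  have DT: "emeasure D X \<le> ennreal T" if "X \<in> sets borel" for X
  proof -
    have "emeasure D X = (\<integral>\<^sup>+y. H y * indicator X y \<partial>lborel)" unfolding D_def using that by (subst emeasure_density) auto
    also have "\<dots> \<le> (\<integral>\<^sup>+y. H y \<partial>lborel)" by (intro nn_integral_mono) (auto simp: indicator_def)
    finally show ?thesis using T by simp
  qed
  define E where "E = {x. dyadic_maximal H x > ennreal t}"
  have Em: "E \<in> sets borel" unfolding E_def by measurable
  have ex: "\<exists>r>0. ennreal (r ^ n) * ennreal t \<le> emeasure D (cball x r)" if "x \<in> E" for x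
  proof -
    have "ennreal t < (SUP k::int. ennreal (1 / (2 powr k) ^ n) * emeasure D (cball x (2 powr k)))"
      using that unfolding E_def dyadic_maximal_def Dc n_def by simp
    then obtain k :: int where "ennreal t < ennreal (1 / (2 powr k) ^ n) * emeasure D (cball x (2 powr k))"
      by (auto simp: less_SUP_iff)
    hence "ennreal ((2 powr k) ^ n) * ennreal t \<le> ennreal ((2 powr k) ^ n) * (ennreal (1 / (2 powr k) ^ n) * emeasure D (cball x (2 powr k)))"
      by (intro mult_left_mono) auto
    also have "\<dots> = (ennreal ((2 powr k) ^ n) * ennreal (1 / (2 powr k) ^ n)) * emeasure D (cball x (2 powr k))"
      by (simp only: mult.assoc)
    also have "ennreal ((2 powr k) ^ n) * ennreal (1 / (2 powr k) ^ n) = 1"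
      by (subst ennreal_mult[symmetric]) auto
    finally show ?thesis by (intro exI[of _ "2 powr k"]) auto
  qed
  then obtain r where r: "\<And>x. x \<in> E \<Longrightarrow> r x > 0" "\<And>x. x \<in> E \<Longrightarrow> ennreal (r x ^ n) * ennreal t \<le> emeasure D (cball x (r x))"
    by metis
  have rb: "r x \<le> max 1 (T / t)" if "x \<in> E" for x
  proof (cases "r x \<le> 1")
    case False
    have "ennreal (r x ^ n * t) \<le> ennreal T"
      using order_trans[OF r(2)[OF that] DT[of "cball x (r x)"]] l r(1)[OF that] by (simp add: ennreal_mult)
    hence "r x ^ n \<le> T / t" using l T by (simp add: pos_le_divide_eq)
    moreover have "r x \<le> r x ^ n" using False n by (intro self_le_power) auto
    ultimately show ?thesis by simp
  qed simp
  obtain C where C: "countable C" "C \<subseteq> E"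
     "pairwise (\<lambda>i j. disjnt (cball i (r i)) (cball j (r j))) C"
     "E \<subseteq> (\<Union>i\<in>C. cball i (5 * r i))"
  proof (rule Vitali_covering_lemma_cballs[where S = E and K = E and a = "\<lambda>x. x" and r = r and B = "max 1 (T / t)"])
    show "E \<subseteq> (\<Union>i\<in>E. cball i (r i))" using r by (force intro: less_imp_le)
  qed (use r rb in auto)
  have "emeasure lborel E \<le> emeasure lborel (\<Union>i\<in>C. cball i (5 * r i))"
    using C by (intro emeasure_mono sets.countable_UN') auto
  also have "\<dots> \<le> (\<integral>\<^sup>+i. emeasure lborel (cball i (5 * r i)) \<partial>count_space C)"
    using C by (intro emeasure_UN_le_nn_integral_count_space) auto
  also have "\<dots> \<le> (\<integral>\<^sup>+i. ennreal (5 ^ n * \<omega> / t) * emeasure D (cball i (r i)) \<partial>count_space C)"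
  proof (rule nn_integral_mono, simp)
    fix i assume "i \<in> C"
    hence i: "i \<in> E" using C by auto
    have "emeasure lborel (cball i (5 * r i)) = ennreal (\<omega> * (5 * r i) ^ n)"
      using r(1)[OF i] by (simp add: emeasure_cball \<omega>_def n_def)
    also have "\<dots> = ennreal (5 ^ n * \<omega> / t) * (ennreal (r i ^ n) * ennreal t)"
      using r(1)[OF i] l \<omega> by (simp add: ennreal_mult[symmetric] power_mult_distrib)
    also have "\<dots> \<le> ennreal (5 ^ n * \<omega> / t) * emeasure D (cball i (r i))"
      by (intro mult_left_mono r i) auto
    finally show "emeasure lborel (cball i (5 * r i)) \<le> \<dots>" .
  qed
  also have "\<dots> = ennreal (5 ^ n * \<omega> / t) * (\<integral>\<^sup>+i. emeasure D (cball i (r i)) \<partial>count_space C)"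
    by (rule nn_integral_cmult) auto
  also have "(\<integral>\<^sup>+i. emeasure D (cball i (r i)) \<partial>count_space C) = emeasure D (\<Union>i\<in>C. cball i (r i))"
    using C(1,3) by (intro emeasure_UN_countable[symmetric])
       (auto simp: disjoint_family_on_def pairwise_def disjnt_def D_def)
  also have "\<dots> \<le> ennreal T" using C(1) by (intro DT sets.countable_UN') auto
  finally show ?thesis unfolding T(1) E_def n_def \<omega>_def by (simp add: mult_left_mono)
qed

lemma powr_layer_cake:
  assumes "m \<ge> 0" "s > 0"
  shows "ennreal (m powr s) = (\<integral>\<^sup>+t. ennreal (s * t powr (s - 1)) * indicator {0<..m} t \<partial>lborel)"
proof -
  have "ennreal (m powr s / s) = radial_integral 1 (\<lambda>t. ennreal (t powr (s - real 1)) * indicator {..m} t)"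
    using assms by (subst radial_integral_power) auto
  also have "\<dots> = (\<integral>\<^sup>+t. ennreal (t powr (s - 1)) * indicator {0<..m} t \<partial>lborel)"
    unfolding radial_integral_def by (intro nn_integral_cong) (auto simp: indicator_def)
  finally have "ennreal s * ennreal (m powr s / s) = ennreal s * (\<integral>\<^sup>+t. ennreal (t powr (s - 1)) * indicator {0<..m} t \<partial>lborel)"
    by simp
  also have "\<dots> = (\<integral>\<^sup>+t. ennreal (s * t powr (s - 1)) * indicator {0<..m} t \<partial>lborel)"
    using assms by (subst nn_integral_cmult[symmetric]) (auto simp: ennreal_mult mult.assoc)
  finally show ?thesis using assms by (simp add: ennreal_mult[symmetric])
qed

text \<open>
  The level set of height \<open>t\<close> depends only on the part of \<open>H\<close> above a fixed multiple of \<open>t\<close>, and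
  integrating the weak type bound for that part over \<open>t\<close> gives a power of \<open>H\<close>. Infinite values of the maximal
  function are sent to zero by \<^const>\<open>enn2real\<close>; it is applied to bounded functions \<open>H\<close>, for which there are none.
\<close>

theorem dyadic_maximal_strong_type:
  fixes s :: real
  assumes s: "s > 1"
  obtains C :: real where "C > 0" "\<And>H :: 'a::euclidean_space \<Rightarrow> real. H \<in> borel_measurable borel \<Longrightarrow> (\<And>x. H x \<ge> 0) \<Longrightarrow>
    (\<integral>\<^sup>+x. ennreal (enn2real (dyadic_maximal (\<lambda>x. ennreal (H x)) x) powr s) \<partial>lborel)
      \<le> ennreal C * (\<integral>\<^sup>+x. ennreal (H x powr s) \<partial>lborel)"
proof -
  define n where "n = DIM('a)"
  define \<omega> where "\<omega> = unit_ball_vol (real n)"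
  have \<omega>: "\<omega> > 0" by (simp add: \<omega>_def)
  define A where "A = 2 * 5 ^ n * \<omega>"
  have A: "A > 0" using \<omega> by (simp add: A_def)
  define C where "C = A * s * ((4 * \<omega>) powr (s - 1) / (s - 1))"
  have C: "C > 0" using A s \<omega> by (simp add: C_def)
  show thesis
  proof (rule that[OF C])
    fix H :: "'a \<Rightarrow> real"
    assume H [measurable]: "H \<in> borel_measurable borel" and H0: "\<And>x. H x \<ge> 0"
    define m where "m x = enn2real (dyadic_maximal (\<lambda>x. ennreal (H x)) x)" for x
    have m0: "m x \<ge> 0" for x by (simp add: m_def)
    let ?P = "\<lambda>x t. ennreal (s * t powr (s - 1)) * indicator {p. 0 < snd p \<and> snd p \<le> m (fst p)} (x, t)"
    let ?Q = "\<lambda>y t. ennreal (A * s * t powr (s - 1 - 1) * H y) * indicator {p. 0 < snd p \<and> snd p < 4 * \<omega> * H (fst p)} (y, t)"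
    let ?J = "\<lambda>t. \<integral>\<^sup>+y. ennreal (H y) * indicator {y. t < 4 * \<omega> * H y} y \<partial>lborel"
    have mm [measurable]: "m \<in> borel_measurable borel" unfolding m_def by measurable
    have weak: "emeasure lborel {x. t \<le> m x} \<le> ennreal (A / t) * ?J t" if t: "t > 0" for t
    proof -
      define F where "F y = ennreal (H y) * indicator {y. t < 4 * \<omega> * H y} y" for y
      have F [measurable]: "F \<in> borel_measurable borel" unfolding F_def by measurable
      \<comment> \<open>The part of \<open>H\<close> below \<open>t / (4 * \<omega>)\<close> contributes at most \<open>t / 4\<close>, since the constant function one
        has maximal function \<open>\<omega>\<close>.\<close>
      have M: "dyadic_maximal (\<lambda>x. ennreal (H x)) x \<le> dyadic_maximal F x + ennreal (t / 4)" for x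
        unfolding dyadic_maximal_def[of "\<lambda>x. ennreal (H x)"]
      proof (rule SUP_least)
        fix k :: int
        let ?c = "ennreal (1 / (2 powr k) ^ n)"
        have [measurable]: "cball x (2 powr k) \<in> sets borel" by simp
        have "(\<integral>\<^sup>+y. ennreal (H y) * indicator (cball x (2 powr k)) y \<partial>lborel)
           \<le> (\<integral>\<^sup>+y. F y * indicator (cball x (2 powr k)) y + ennreal (t / (4 * \<omega>)) * indicator (cball x (2 powr k)) y \<partial>lborel)"
          using \<omega> t by (intro nn_integral_mono) (auto simp: F_def indicator_def field_simps not_less intro!: ennreal_leI)
        also have "\<dots> = (\<integral>\<^sup>+y. F y * indicator (cball x (2 powr k)) y \<partial>lborel) + ennreal (t / (4 * \<omega>)) * ennreal (\<omega> * (2 powr k) ^ n)"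
          by (subst nn_integral_add) (auto simp: nn_integral_cmult_indicator emeasure_cball \<omega>_def n_def)
        finally have "?c * (\<integral>\<^sup>+y. ennreal (H y) * indicator (cball x (2 powr k)) y \<partial>lborel)
           \<le> ?c * ((\<integral>\<^sup>+y. F y * indicator (cball x (2 powr k)) y \<partial>lborel) + ennreal (t / (4 * \<omega>)) * ennreal (\<omega> * (2 powr k) ^ n))"
          by (rule mult_left_mono) simp
        also have "\<dots> = ?c * (\<integral>\<^sup>+y. F y * indicator (cball x (2 powr k)) y \<partial>lborel) + ?c * (ennreal (t / (4 * \<omega>)) * ennreal (\<omega> * (2 powr k) ^ n))"
          by (rule distrib_left)
        also have "?c * (ennreal (t / (4 * \<omega>)) * ennreal (\<omega> * (2 powr k) ^ n)) = ennreal (t / 4)"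
          using \<omega> t by (simp add: ennreal_mult[symmetric])
        also have "?c * (\<integral>\<^sup>+y. F y * indicator (cball x (2 powr k)) y \<partial>lborel) \<le> dyadic_maximal F x"
          unfolding dyadic_maximal_def n_def by (rule SUP_upper) simp
        finally show "ennreal (1 / (2 powr k) ^ DIM('a)) * (\<integral>\<^sup>+y. ennreal (H y) * indicator (cball x (2 powr k)) y \<partial>lborel) \<le> dyadic_maximal F x + ennreal (t / 4)"
          by (simp add: n_def add_right_mono)
      qed
      have "{x. t \<le> m x} \<subseteq> {x. dyadic_maximal F x > ennreal (t / 2)}"
      proof safe
        fix x assume "t \<le> m x"
        hence "ennreal t \<le> ennreal (m x)" by (rule ennreal_leI)
        also have "\<dots> \<le> dyadic_maximal (\<lambda>x. ennreal (H x)) x" by (simp add: m_def ennreal_enn2real_if)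
        also have "\<dots> \<le> dyadic_maximal F x + ennreal (t / 4)" by (rule M)
        finally have *: "ennreal t \<le> dyadic_maximal F x + ennreal (t / 4)" .
        show "dyadic_maximal F x > ennreal (t / 2)"
        proof (rule ccontr)
          assume "\<not> dyadic_maximal F x > ennreal (t / 2)"
          hence "dyadic_maximal F x + ennreal (t / 4) \<le> ennreal (t / 2) + ennreal (t / 4)" by (intro add_right_mono) auto
          also have "\<dots> = ennreal (t / 2 + t / 4)" using t by (intro ennreal_plus[symmetric]) auto
          finally have "ennreal t \<le> ennreal (t / 2 + t / 4)" using * by (rule order_trans[rotated])
          thus False using t by (subst (asm) ennreal_le_iff) auto
        qed
      qed
      hence "emeasure lborel {x. t \<le> m x} \<le> emeasure lborel {x. dyadic_maximal F x > ennreal (t / 2)}"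
        by (intro emeasure_mono) auto
      also have "\<dots> \<le> ennreal (5 ^ n * \<omega> / (t / 2)) * (\<integral>\<^sup>+y. F y \<partial>lborel)"
        unfolding n_def \<omega>_def using t by (intro dyadic_maximal_weak_type F) auto
      also have "5 ^ n * \<omega> / (t / 2) = A / t" by (simp add: A_def)
      finally show ?thesis by (simp add: F_def)
    qed
    have "(\<integral>\<^sup>+x. ennreal (m x powr s) \<partial>lborel) = (\<integral>\<^sup>+x. (\<integral>\<^sup>+t. ennreal (s * t powr (s - 1)) * indicator {0<..m x} t \<partial>lborel) \<partial>lborel)"
      using s by (intro nn_integral_cong powr_layer_cake m0) auto
    also have "\<dots> = (\<integral>\<^sup>+x. (\<integral>\<^sup>+t. ?P x t \<partial>lborel) \<partial>lborel)"
      by (intro nn_integral_cong) (auto simp: indicator_def)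
    also have "\<dots> = (\<integral>\<^sup>+t. (\<integral>\<^sup>+x. ?P x t \<partial>lborel) \<partial>lborel)"
      by (rule lborel_pair.Fubini') measurable
    also have "\<dots> \<le> (\<integral>\<^sup>+t. (\<integral>\<^sup>+y. ?Q y t \<partial>lborel) \<partial>lborel)"
    proof (rule nn_integral_mono)
      fix t :: real
      show "(\<integral>\<^sup>+x. ?P x t \<partial>lborel)
        \<le> (\<integral>\<^sup>+y. ?Q y t \<partial>lborel)"
      proof (cases "t > 0")
        case t: True
        have "(\<integral>\<^sup>+x. ?P x t \<partial>lborel)
          = (\<integral>\<^sup>+x. ennreal (s * t powr (s - 1)) * indicator {x. t \<le> m x} x \<partial>lborel)"
          using t by (intro nn_integral_cong) (auto simp: indicator_def)
        also have "\<dots> = ennreal (s * t powr (s - 1)) * emeasure lborel {x. t \<le> m x}"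
          by (rule nn_integral_cmult_indicator) measurable
        also have "\<dots> \<le> ennreal (s * t powr (s - 1)) * (ennreal (A / t) * ?J t)"
          by (intro mult_left_mono weak t) auto
        also have "\<dots> = (ennreal (s * t powr (s - 1)) * ennreal (A / t)) * ?J t"
          by (simp only: mult.assoc)
        also have "ennreal (s * t powr (s - 1)) * ennreal (A / t) = ennreal (A * s * t powr (s - 1 - 1))"
        proof -
          have "t powr (s - 1 - 1) = t powr (s - 1) / t" using t by (subst powr_diff) auto
          hence "A * s * t powr (s - 1 - 1) = (s * t powr (s - 1)) * (A / t)" by (simp only:) simp
          thus ?thesis using t s A by (simp only: ennreal_mult[symmetric]) (simp add: ennreal_mult[symmetric])
        qed
        also have "\<dots> * ?J t
           = (\<integral>\<^sup>+y. ennreal (A * s * t powr (s - 1 - 1)) * (ennreal (H y) * indicator {y. t < 4 * \<omega> * H y} y) \<partial>lborel)"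
          by (rule nn_integral_cmult[symmetric]) measurable
        also have "\<dots> = (\<integral>\<^sup>+y. ?Q y t \<partial>lborel)"
          using t s A H0 by (intro nn_integral_cong) (auto simp: indicator_def ennreal_mult)
        finally show ?thesis by simp
      qed (auto simp: indicator_def)
    qed
    also have "\<dots> = (\<integral>\<^sup>+y. (\<integral>\<^sup>+t. ?Q y t \<partial>lborel) \<partial>lborel)"
      by (rule lborel_pair.Fubini'[symmetric]) measurable
    also have "\<dots> \<le> (\<integral>\<^sup>+y. ennreal C * ennreal (H y powr s) \<partial>lborel)"
    proof (rule nn_integral_mono)
      fix y
      have "(\<integral>\<^sup>+t. ?Q y t \<partial>lborel)
         \<le> (\<integral>\<^sup>+t. ennreal (A * s / (s - 1) * H y) * (ennreal ((s - 1) * t powr (s - 1 - 1)) * indicator {0<..4 * \<omega> * H y} t) \<partial>lborel)"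
        using s A H0[of y] by (intro nn_integral_mono) (auto simp: indicator_def ennreal_mult[symmetric] mult_ac)
      also have "\<dots> = ennreal (A * s / (s - 1) * H y) * (\<integral>\<^sup>+t. ennreal ((s - 1) * t powr (s - 1 - 1)) * indicator {0<..4 * \<omega> * H y} t \<partial>lborel)"
        by (rule nn_integral_cmult) measurable
      also have "(\<integral>\<^sup>+t. ennreal ((s - 1) * t powr (s - 1 - 1)) * indicator {0<..4 * \<omega> * H y} t \<partial>lborel) = ennreal ((4 * \<omega> * H y) powr (s - 1))"
        using s \<omega> H0[of y] by (intro powr_layer_cake[symmetric]) auto
      also have "ennreal (A * s / (s - 1) * H y) * ennreal ((4 * \<omega> * H y) powr (s - 1)) = ennreal (A * s / (s - 1) * H y * (4 * \<omega> * H y) powr (s - 1))"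
        using s A H0[of y] by (intro ennreal_mult[symmetric]) auto
      also have "A * s / (s - 1) * H y * (4 * \<omega> * H y) powr (s - 1) = C * H y powr s"
      proof (cases "H y = 0")
        case False
        hence h: "H y > 0" using H0[of y] by simp
        have "(4 * \<omega> * H y) powr (s - 1) = (4 * \<omega>) powr (s - 1) * (H y powr s / H y)"
          using \<omega> h by (simp add: powr_mult powr_diff)
        thus ?thesis using h by (simp add: C_def)
      qed simp
      finally show "(\<integral>\<^sup>+t. ?Q y t \<partial>lborel)
         \<le> ennreal C * ennreal (H y powr s)" using C by (simp add: ennreal_mult)
    qed
    also have "\<dots> = ennreal C * (\<integral>\<^sup>+x. ennreal (H x powr s) \<partial>lborel)" by (rule nn_integral_cmult) measurable
    finally show "(\<integral>\<^sup>+x. ennreal (enn2real (dyadic_maximal (\<lambda>x. ennreal (H x)) x) powr s) \<partial>lborel)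
      \<le> ennreal C * (\<integral>\<^sup>+x. ennreal (H x powr s) \<partial>lborel)" unfolding m_def .
  qed
qed

section \<open>Test functions and the kernel on annuli\<close>

lemma Cc_infinity_differentiable: "f \<in> Cc_infinity \<Longrightarrow> f differentiable (at x)"
  by (auto simp: Cc_infinity_def differentiable_on_def dest!: spec[of _ "Suc 0"])

lemma Cc_infinity_continuous_partial: "f \<in> Cc_infinity \<Longrightarrow> continuous_on UNIV (partial_deriv i f)"
  by (auto simp: Cc_infinity_def dest!: spec[of _ "Suc 0"])

lemma Cc_infinity_continuous: "f \<in> Cc_infinity \<Longrightarrow> continuous_on UNIV f"
  by (auto simp: Cc_infinity_def dest!: spec[of _ 0])

lemma frechet_derivative_partial:
  fixes f :: "real ^ 'n \<Rightarrow> complex"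
  assumes f: "f differentiable (at x)"
  shows "frechet_derivative f (at x) v = (\<Sum>i\<in>UNIV. v $ i *\<^sub>R partial_deriv i f x)"
proof -
  have lin: "linear (frechet_derivative f (at x))"
    using f by (rule linear_frechet_derivative)
  have "v = (\<Sum>i\<in>UNIV. v $ i *\<^sub>R axis i 1)"
    using basis_expansion[of v] by (simp add: scalar_mult_eq_scaleR)
  hence "frechet_derivative f (at x) v = frechet_derivative f (at x) (\<Sum>i\<in>UNIV. v $ i *\<^sub>R axis i 1)"
    by simp
  also have "\<dots> = (\<Sum>i\<in>UNIV. v $ i *\<^sub>R partial_deriv i f x)"
    by (simp add: linear_sum[OF lin] linear_scale[OF lin] partial_deriv_def)
  finally show ?thesis .
qed

text \<open>
  The Cauchy-Schwarz inequality; the components of the gradient are complex, those of the direction real.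
\<close>

lemma norm_directional_derivative_le:
  fixes f :: "real ^ 'n \<Rightarrow> complex"
  shows "norm (\<Sum>i\<in>UNIV. v $ i *\<^sub>R partial_deriv i f x) \<le> norm (gradient f x) * norm v"
proof -
  have "norm (\<Sum>i\<in>UNIV. v $ i *\<^sub>R partial_deriv i f x) \<le> (\<Sum>i\<in>UNIV. norm (v $ i *\<^sub>R partial_deriv i f x))"
    by (rule norm_sum)
  also have "\<dots> = (\<Sum>i\<in>UNIV. \<bar>norm (gradient f x $ i)\<bar> * \<bar>norm (v $ i)\<bar>)"
    by (simp add: gradient_def mult.commute)
  also have "\<dots> \<le> L2_set (\<lambda>i. norm (gradient f x $ i)) UNIV * L2_set (\<lambda>i. norm (v $ i)) UNIV"
    by (rule L2_set_mult_ineq)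
  finally show ?thesis by (simp add: norm_vec_def)
qed

lemma Cc_infinity_continuous_gradient:
  assumes "f \<in> Cc_infinity"
  shows "continuous_on UNIV (gradient f)"
  unfolding gradient_def[abs_def]
  by (intro continuous_on_vec_lambda) (rule Cc_infinity_continuous_partial[OF assms])

lemma Cc_infinity_borel_measurable: "f \<in> Cc_infinity \<Longrightarrow> f \<in> borel_measurable borel"
  by (rule borel_measurable_continuous_onI[OF Cc_infinity_continuous])

lemma borel_measurable_gradient: "f \<in> Cc_infinity \<Longrightarrow> gradient f \<in> borel_measurable borel"
  by (rule borel_measurable_continuous_onI[OF Cc_infinity_continuous_gradient])

lemma Cc_infinity_support:
  assumes f: "f \<in> Cc_infinity"
  obtains M where "M > 0" "\<And>y. norm y > M \<Longrightarrow> f y = 0" "\<And>y. norm y > M \<Longrightarrow> gradient f y = 0"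
proof -
  have "bounded (closure {x. f x \<noteq> 0})" using f by (auto simp: Cc_infinity_def compact_imp_bounded)
  then obtain M where M: "M > 0" "\<And>y. y \<in> closure {x. f x \<noteq> 0} \<Longrightarrow> norm y \<le> M"
    unfolding bounded_pos by blast
  have f0: "f y = 0" if "norm y > M" for y
    using M(2)[of y] that closure_subset[of "{x. f x \<noteq> 0}"] by force
  have "gradient f y = 0" if y: "norm y > M" for y
  proof -
    have "open {y::real^'a. norm y > M}" by (intro open_Collect_less continuous_intros)
    hence "(f has_derivative (\<lambda>_. 0)) (at y)"
      by (rule has_derivative_transform_within_open[OF has_derivative_const[of 0]]) (use y f0 in auto)
    hence "frechet_derivative f (at y) = (\<lambda>_. 0)" by (metis frechet_derivative_at)
    thus ?thesis by (simp add: gradient_def partial_deriv_def vec_eq_iff)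
  qed
  thus thesis using that[OF M(1) f0] by blast
qed

lemma bounded_of_continuous_compact_support:
  fixes h :: "'a::euclidean_space \<Rightarrow> 'b::real_normed_vector"
  assumes "continuous_on UNIV h" "\<And>y. norm y > M \<Longrightarrow> h y = 0"
  obtains L where "L > 0" "\<And>y. norm (h y) \<le> L"
proof -
  have "compact (h ` cball 0 M)"
    by (intro compact_continuous_image continuous_on_subset[OF assms(1)]) auto
  then obtain L where L: "L > 0" "\<And>y. y \<in> cball 0 M \<Longrightarrow> norm (h y) \<le> L"
    using compact_imp_bounded[of "h ` cball 0 M"] unfolding bounded_pos by auto
  have "norm (h y) \<le> L" for y
    using L assms(2)[of y] by (cases "norm y \<le> M") auto
  thus thesis using that L(1) by blast
qed

lemma increment_le_integral_gradient:
  fixes f :: "real ^ 'n \<Rightarrow> complex"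
  assumes f: "f \<in> Cc_infinity"
  shows "ennreal (norm (f z - f w)) \<le>
     (\<integral>\<^sup>+t. ennreal (norm (gradient f (z + t *\<^sub>R (w - z))) * norm (w - z)) * indicator {0..1} t \<partial>lborel)"
proof -
  define \<psi> where "\<psi> t = (\<Sum>i\<in>UNIV. (w - z) $ i *\<^sub>R partial_deriv i f (z + t *\<^sub>R (w - z)))" for t
  have hb: "has_bochner_integral lborel (\<lambda>t. indicator {0..1} t *\<^sub>R \<psi> t) (f (z + 1 *\<^sub>R (w - z)) - f (z + 0 *\<^sub>R (w - z)))"
  proof (rule has_bochner_integral_FTC_Icc[where F = "\<lambda>t. f (z + t *\<^sub>R (w - z))"])
    fix t :: real
    have "((\<lambda>t. z + t *\<^sub>R (w - z)) has_derivative (\<lambda>s. s *\<^sub>R (w - z))) (at t within {0..1})"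
      by (auto intro!: derivative_eq_intros)
    moreover have "(f has_derivative frechet_derivative f (at (z + t *\<^sub>R (w - z)))) (at (z + t *\<^sub>R (w - z)))"
      using Cc_infinity_differentiable[OF f] frechet_derivative_works by blast
    ultimately have "((\<lambda>t. f (z + t *\<^sub>R (w - z))) has_derivative (\<lambda>s. frechet_derivative f (at (z + t *\<^sub>R (w - z))) (s *\<^sub>R (w - z)))) (at t within {0..1})"
      by (rule has_derivative_compose)
    moreover have "frechet_derivative f (at (z + t *\<^sub>R (w - z))) (s *\<^sub>R (w - z)) = s *\<^sub>R \<psi> t" for s
      unfolding \<psi>_def frechet_derivative_partial[OF Cc_infinity_differentiable[OF f]]
      by (simp add: scaleR_sum_right)
    ultimately show "((\<lambda>t. f (z + t *\<^sub>R (w - z))) has_vector_derivative \<psi> t) (at t within {0..1})"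
      by (simp add: has_vector_derivative_def)
  next
    show "continuous_on {0..1} \<psi>"
      unfolding \<psi>_def
      by (intro continuous_intros continuous_on_compose2[OF Cc_infinity_continuous_partial[OF f]]) auto
  qed simp
  have "ennreal (norm (f z - f w)) = ennreal (norm (LINT t|lborel. indicator {0..1} t *\<^sub>R \<psi> t))"
    using hb by (simp add: has_bochner_integral_integral_eq norm_minus_commute)
  also have "\<dots> \<le> (\<integral>\<^sup>+t. ennreal (norm (indicator {0..1} t *\<^sub>R \<psi> t)) \<partial>lborel)"
    using hb by (intro integral_norm_bound_ennreal) (simp add: has_bochner_integral_iff)
  also have "\<dots> \<le> (\<integral>\<^sup>+t. ennreal (norm (gradient f (z + t *\<^sub>R (w - z))) * norm (w - z)) * indicator {0..1} t \<partial>lborel)"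
    using norm_directional_derivative_le[where v = "w - z" and f = f] unfolding \<psi>_def
    by (intro nn_integral_mono) (auto simp: indicator_def simp del: vector_minus_component intro!: ennreal_leI)
  finally show ?thesis .
qed

lemma increment_le_Lipschitz:
  fixes f :: "real ^ 'n \<Rightarrow> complex"
  assumes f: "f \<in> Cc_infinity" and L: "\<And>y. norm (gradient f y) \<le> L" "L \<ge> 0"
  shows "norm (f z - f w) \<le> L * norm (w - z)"
proof -
  have "ennreal (norm (f z - f w)) \<le> (\<integral>\<^sup>+t. ennreal (L * norm (w - z)) * indicator {0..1::real} t \<partial>lborel)"
    using L by (intro order_trans[OF increment_le_integral_gradient[OF f]] nn_integral_mono mult_right_mono ennreal_leI mult_right_mono) auto
  also have "\<dots> = ennreal (L * norm (w - z))" by (simp add: nn_integral_cmult_indicator)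
  finally show ?thesis using L by (subst (asm) ennreal_le_iff) auto
qed

lemma integral_lborel_scale:
  fixes F :: "'a::euclidean_space \<Rightarrow> complex"
  assumes [measurable]: "F \<in> borel_measurable borel" and R: "R > 0"
  shows "(LINT y|lborel. F y) = R ^ DIM('a) *\<^sub>R (LINT w|lborel. F (R *\<^sub>R w))"
proof -
  have e: "(lborel :: 'a measure) = density (distr lborel borel (\<lambda>x. R *\<^sub>R x)) (\<lambda>_. ennreal (R ^ DIM('a)))"
    using lborel_affine[of R "0::'a"] R by simp
  show "(LINT y|lborel. F y) = R ^ DIM('a) *\<^sub>R (LINT w|lborel. F (R *\<^sub>R w))"
    using R by (subst e, subst integral_density) (auto simp: integral_distr)
qed

text \<open>
  The data that \<open>sphere_function_polar\<close> provides. The dimension appears as a real parameter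
  because it serves almost exclusively as an exponent.
\<close>

locale rough_kernel =
  fixes g :: "'a::euclidean_space \<Rightarrow> complex" and c \<alpha> n :: real
  assumes n_def: "n = real DIM('a)"
    and g [measurable]: "g \<in> borel_measurable borel"
    and c: "c > 0"
    and orlicz: "(\<integral>\<^sup>+u. ennreal (norm (g u) / c * ln (1 + norm (g u) / c) powr (1 - 1 / n)) \<partial>cone_measure) < \<infinity>"
    and mean_zero: "(LINT u|cone_measure. g u) = 0"
    and \<alpha>: "0 < \<alpha>" "\<alpha> < 1"
begin

definition G :: "'a \<Rightarrow> real" where "G w = norm (g (sgn w)) / c"

definition kern :: "real \<Rightarrow> real \<Rightarrow> 'a \<Rightarrow> complex" where
  "kern a b y = (norm y powr (- (n + 1 - \<alpha>)) * indicator {a<..b} (norm y)) *\<^sub>R g (sgn y)"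

lemma n_ge_1: "n \<ge> 1" unfolding n_def by (metis DIM_positive One_nat_def Suc_leI of_nat_1 of_nat_mono)

lemma G_measurable [measurable]: "G \<in> borel_measurable borel" unfolding G_def by measurable

lemma kern_measurable [measurable]: "kern a b \<in> borel_measurable borel" unfolding kern_def by measurable

lemma G_nonneg: "G w \<ge> 0" using c by (simp add: G_def)

lemma norm_g: "norm (g (sgn w)) = c * G w" using c by (simp add: G_def)

lemma radial_ball: "radial_integral DIM('a) (indicator {..1}) = 1"
proof -
  have "radial_integral DIM('a) (indicator {..1}) = radial_integral DIM('a) (\<lambda>r. ennreal (r powr (n - real DIM('a))) * indicator {..1} r)"
    unfolding n_def radial_integral_def by (intro nn_integral_cong) (auto simp: indicator_def)
  also have "\<dots> = ennreal (DIM('a) * 1 powr n / n)" using n_ge_1 by (intro radial_integral_power) auto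
  finally show ?thesis using n_ge_1 by (simp add: n_def)
qed

text \<open>
  For \<open>x \<ge> 2\<close> the factor \<open>ln (1 + x)\<close> is at least one, so the Orlicz condition implies integrability.
\<close>

lemma cone_integrable: "(\<integral>\<^sup>+u. ennreal (norm (g u)) \<partial>cone_measure) < \<infinity>"
proof -
  have le: "norm (g u) \<le> c * (2 + norm (g u) / c * ln (1 + norm (g u) / c) powr (1 - 1 / n))" for u
  proof -
    define x where "x = norm (g u) / c"
    have x: "x \<ge> 0" using c by (simp add: x_def)
    have "x \<le> 2 + x * ln (1 + x) powr (1 - 1/n)"
    proof (cases "x \<le> 2")
      case False
      have "exp 1 \<le> 1 + x" using False exp_le by linarith
      hence "1 \<le> ln (1 + x)" using x by (simp add: ln_ge_iff)
      hence "1 \<le> ln (1 + x) powr (1 - 1/n)" using n_ge_1 by (intro ge_one_powr_ge_zero) auto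
      hence "x * 1 \<le> x * ln (1 + x) powr (1 - 1/n)" using x by (intro mult_left_mono)
      thus ?thesis by simp
    qed (use x in \<open>smt (verit) mult_nonneg_nonneg powr_ge_zero\<close>)
    hence "c * x \<le> c * (2 + x * ln (1 + x) powr (1 - 1/n))" using c by (intro mult_left_mono) auto
    thus ?thesis using c by (simp add: x_def)
  qed
  have "(\<integral>\<^sup>+u. ennreal (norm (g u)) \<partial>cone_measure)
     \<le> (\<integral>\<^sup>+u. ennreal c * (2 + ennreal (norm (g u) / c * ln (1 + norm (g u) / c) powr (1 - 1 / n))) \<partial>cone_measure)"
  proof (rule nn_integral_mono)
    fix u
    have "ennreal (norm (g u)) \<le> ennreal (c * (2 + norm (g u) / c * ln (1 + norm (g u) / c) powr (1 - 1 / n)))"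
      by (intro ennreal_leI le)
    also have "\<dots> = ennreal c * (2 + ennreal (norm (g u) / c * ln (1 + norm (g u) / c) powr (1 - 1 / n)))"
      using c by (subst ennreal_mult, simp, simp, subst ennreal_plus) auto
    finally show "ennreal (norm (g u)) \<le> \<dots>" .
  qed
  also have "\<dots> = ennreal c * (2 * emeasure (cone_measure :: 'a measure) UNIV + (\<integral>\<^sup>+u. ennreal (norm (g u) / c * ln (1 + norm (g u) / c) powr (1 - 1 / n)) \<partial>cone_measure))"
    by (simp add: nn_integral_cmult nn_integral_add)
  also have "\<dots> < \<infinity>" using orlicz
    by (simp add: emeasure_cone_measure_UNIV ennreal_mult_less_top)
  finally show ?thesis .
qed

lemma ball_indicator: "indicator (cball (0::'a) 1) w = (indicator {..1} (norm w) :: ennreal)"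
  by (simp add: indicator_def)

lemma G_integrable: "(\<integral>\<^sup>+w. ennreal (G w) * indicator (cball 0 1) w \<partial>lborel) < \<infinity>"
proof -
  have "(\<integral>\<^sup>+w. ennreal (G w) * indicator (cball 0 1) w \<partial>lborel) = (\<integral>\<^sup>+w. indicator {..1} (norm w) * ennreal (norm (g (sgn w)) / c) \<partial>lborel)"
    unfolding ball_indicator G_def by (simp only: mult.commute)
  also have "\<dots> = (\<integral>\<^sup>+u. ennreal (norm (g u) / c) \<partial>cone_measure)"
    by (subst nn_integral_polar) (auto simp: radial_ball)
  also have "\<dots> = ennreal (1 / c) * (\<integral>\<^sup>+u. ennreal (norm (g u)) \<partial>cone_measure)"
    using c by (subst nn_integral_cmult[symmetric]) (auto simp: ennreal_mult[symmetric])
  also have "\<dots> < \<infinity>" using cone_integrable by (simp add: ennreal_mult_less_top)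
  finally show ?thesis .
qed

lemma G_log_integrable: "(\<integral>\<^sup>+w. ennreal (G w * ln (1 + G w) powr (1 - 1 / n)) * indicator (cball 0 1) w \<partial>lborel) < \<infinity>"
proof -
  have "(\<integral>\<^sup>+w. ennreal (G w * ln (1 + G w) powr (1 - 1 / n)) * indicator (cball 0 1) w \<partial>lborel)
     = (\<integral>\<^sup>+w. indicator {..1} (norm w) * ennreal (norm (g (sgn w)) / c * ln (1 + norm (g (sgn w)) / c) powr (1 - 1 / n)) \<partial>lborel)"
    unfolding ball_indicator G_def by (simp only: mult.commute)
  also have "\<dots> = (\<integral>\<^sup>+u. ennreal (norm (g u) / c * ln (1 + norm (g u) / c) powr (1 - 1 / n)) \<partial>cone_measure)"
    by (subst nn_integral_polar) (auto simp: radial_ball)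
  also have "\<dots> < \<infinity>" by (rule orlicz)
  finally show ?thesis .
qed

text \<open>
  By polar coordinates the integral of a radial function times \<open>g (sgn y)\<close> is a multiple of the mean of
  \<open>g\<close>.
\<close>

lemma radial_mean_zero:
  fixes \<phi> :: "real \<Rightarrow> real"
  assumes \<phi> [measurable]: "\<phi> \<in> borel_measurable borel" and \<phi>0: "\<And>r. \<phi> r \<ge> 0"
    and fin: "radial_integral DIM('a) (\<lambda>r. ennreal (\<phi> r)) < \<infinity>"
  shows "integrable lborel (\<lambda>y::'a. \<phi> (norm y) *\<^sub>R g (sgn y))" "(LINT y|lborel. \<phi> (norm y) *\<^sub>R g (sgn y)) = 0"
proof -
  show int: "integrable lborel (\<lambda>y::'a. \<phi> (norm y) *\<^sub>R g (sgn y))"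
  proof (rule integrableI_bounded)
    have "(\<integral>\<^sup>+y. ennreal (norm (\<phi> (norm y) *\<^sub>R g (sgn y))) \<partial>lborel) = (\<integral>\<^sup>+y. ennreal (\<phi> (norm y)) * ennreal (norm (g (sgn y))) \<partial>lborel)"
      using \<phi>0 by (simp add: ennreal_mult)
    also have "\<dots> = radial_integral DIM('a) (\<lambda>r. ennreal (\<phi> r)) * (\<integral>\<^sup>+u. ennreal (norm (g u)) \<partial>cone_measure)"
      by (rule nn_integral_polar) measurable
    also have "\<dots> < \<infinity>" using fin cone_integrable by (simp add: ennreal_mult_less_top)
    finally show "(\<integral>\<^sup>+y. ennreal (norm (\<phi> (norm y) *\<^sub>R g (sgn y))) \<partial>lborel) < \<infinity>" .
  qed measurable
  define K where "K = enn2real (radial_integral DIM('a) (\<lambda>r. ennreal (\<phi> r)))"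
  have K: "radial_integral DIM('a) (\<lambda>r. ennreal (\<phi> r)) = ennreal K" "K \<ge> 0" using fin by (auto simp: K_def)
  have "(LINT y|lborel. \<phi> (norm y) *\<^sub>R g (sgn y)) = (LINT y|density lborel (\<lambda>y::'a. ennreal (\<phi> (norm y))). g (sgn y))"
    using \<phi>0 by (subst integral_density) auto
  also have "\<dots> = (LINT u|distr (density lborel (\<lambda>y::'a. ennreal (\<phi> (norm y)))) borel sgn. g u)"
    by (subst integral_distr) auto
  also have "distr (density lborel (\<lambda>y::'a. ennreal (\<phi> (norm y)))) borel sgn = density cone_measure (\<lambda>_. ennreal K)"
    unfolding polar_distr[of "\<lambda>r. ennreal (\<phi> r)", simplified] K(1)
    by (intro measure_eqI) (auto simp: emeasure_density nn_integral_cmult_indicator)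
  also have "(LINT u|density cone_measure (\<lambda>_. ennreal K). g u) = (LINT u|cone_measure. K *\<^sub>R g u)"
    using K(2) by (subst integral_density) auto
  also have "\<dots> = 0" by (simp add: mean_zero)
  finally show "(LINT y|lborel. \<phi> (norm y) *\<^sub>R g (sgn y)) = 0" .
qed

lemma radial_integral_bounded_finite:
  assumes "\<And>r. r > 0 \<Longrightarrow> \<phi> r \<le> ennreal (K * r powr (s - n)) * indicator {..R} r" "s > 0" "R \<ge> 0" "K \<ge> 0"
  shows "radial_integral DIM('a) \<phi> < \<infinity>"
proof -
  have "radial_integral DIM('a) \<phi> \<le> (\<integral>\<^sup>+r. ennreal K * (ennreal (r powr (s - real DIM('a))) * indicator {..R} r * ennreal (real DIM('a) * r ^ (DIM('a) - 1)) * indicator {0<..} r) \<partial>lborel)"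
    unfolding radial_integral_def n_def
  proof (rule nn_integral_mono)
    fix r :: real
    show "\<phi> r * ennreal (real DIM('a) * r ^ (DIM('a) - 1)) * indicator {0<..} r \<le> ennreal K * (ennreal (r powr (s - real DIM('a))) * indicator {..R} r * ennreal (real DIM('a) * r ^ (DIM('a) - 1)) * indicator {0<..} r)"
    proof (cases "r > 0")
      case True
      have "\<phi> r * ennreal (real DIM('a) * r ^ (DIM('a) - 1)) \<le> (ennreal (K * r powr (s - real DIM('a))) * indicator {..R} r) * ennreal (real DIM('a) * r ^ (DIM('a) - 1))"
        by (intro mult_right_mono assms[unfolded n_def] True) auto
      thus ?thesis using True assms(4) by (simp add: ennreal_mult mult.assoc)
    qed simp
  qed
  also have "\<dots> = ennreal K * radial_integral DIM('a) (\<lambda>r. ennreal (r powr (s - real DIM('a))) * indicator {..R} r)"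
    unfolding radial_integral_def by (rule nn_integral_cmult) measurable
  also have "\<dots> = ennreal K * ennreal (DIM('a) * R powr s / s)"
    using assms by (subst radial_integral_power) auto
  also have "\<dots> < \<infinity>" by (simp add: ennreal_mult_less_top)
  finally show ?thesis .
qed

lemma kern_integrable:
  assumes "a > 0"
  shows "integrable lborel (kern a b)" "(LINT y|lborel. kern a b y) = 0"
proof -
  have "radial_integral DIM('a) (\<lambda>r. ennreal (r powr (- (n + 1 - \<alpha>)) * indicator {a<..b} r)) < \<infinity>"
  proof (rule radial_integral_bounded_finite[where K = "a powr (- (n + 1 - \<alpha>))" and s = n and R = "max b 0"])
    fix r :: real assume "r > 0"
    show "ennreal (r powr (- (n + 1 - \<alpha>)) * indicator {a<..b} r) \<le> ennreal (a powr (- (n + 1 - \<alpha>)) * r powr (n - n)) * indicator {..max b 0} r"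
      using assms \<alpha> n_ge_1 \<open>r > 0\<close> by (auto simp: indicator_def intro!: ennreal_leI powr_mono2')
  qed (use n_ge_1 in auto)
  thus "integrable lborel (kern a b)" "(LINT y|lborel. kern a b y) = 0"
    unfolding kern_def by (intro radial_mean_zero; simp)+
qed

lemma kern_scale: "R > 0 \<Longrightarrow> kern (R / 2) R (R *\<^sub>R w) = R powr (- (n + 1 - \<alpha>)) *\<^sub>R kern (1/2) 1 w"
  by (auto simp: kern_def indicator_def sgn_scaleR powr_mult field_simps)

end

section \<open>Summation over dyadic annuli\<close>

lemma sum_powr_below:
  fixes \<beta> :: real
  assumes \<beta>: "\<beta> > 0" and S: "finite S" "\<And>k. k \<in> S \<Longrightarrow> k \<le> k0"
  shows "(\<Sum>k\<in>S. 2 powr (\<beta> * real_of_int k)) \<le> 2 powr (\<beta> * k0) / (1 - 2 powr (-\<beta>))"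
proof -
  define q :: real where "q = 2 powr (-\<beta>)"
  have q: "0 < q" "q < 1" using \<beta> by (auto simp: q_def powr_less_one)
  have "(\<Sum>k\<in>S. 2 powr (\<beta> * real_of_int k)) = (\<Sum>k\<in>S. 2 powr (\<beta> * k0) * q ^ nat (k0 - k))"
  proof (rule sum.cong)
    fix k assume k: "k \<in> S"
    have "q ^ nat (k0 - k) = 2 powr (-\<beta> * real (nat (k0 - k)))"
      by (simp add: q_def powr_realpow[symmetric] powr_powr)
    also have "real (nat (k0 - k)) = real_of_int k0 - real_of_int k" using S(2)[OF k] by simp
    finally show "2 powr (\<beta> * real_of_int k) = 2 powr (\<beta> * k0) * q ^ nat (k0 - k)"
      by (simp add: powr_add[symmetric] algebra_simps)
  qed simp
  also have "\<dots> = 2 powr (\<beta> * k0) * (\<Sum>k\<in>S. q ^ nat (k0 - k))" by (simp add: sum_distrib_left)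
  also have "(\<Sum>k\<in>S. q ^ nat (k0 - k)) = (\<Sum>i\<in>(\<lambda>k. nat (k0 - k)) ` S. q ^ i)"
  proof (rule sum.reindex_cong[symmetric, OF _ refl])
    show "inj_on (\<lambda>k. nat (k0 - k)) S"
    proof (rule inj_onI)
      fix k k' assume "k \<in> S" "k' \<in> S" "nat (k0 - k) = nat (k0 - k')"
      thus "k = k'" using S(2)[of k] S(2)[of k'] by linarith
    qed
  qed simp
  also have "\<dots> \<le> (\<Sum>i. q ^ i)" using q S by (intro sum_le_suminf) auto
  also have "\<dots> = 1 / (1 - q)" using q by (intro suminf_geometric) auto
  finally show ?thesis by (simp add: q_def mult_left_mono)
qed

text \<open>
  The two bounds are equal where \<open>2\<^sup>k\<^sup>s = B / A\<close>. To the left of that index the first one is a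
  geometric series, to the right the second one.
\<close>

lemma hedberg_sum:
  fixes \<alpha> s :: real
  assumes \<alpha>: "0 < \<alpha>" "\<alpha> < s"
  obtains C where "C > 0" "\<And>A B S. A \<ge> 0 \<Longrightarrow> B \<ge> 0 \<Longrightarrow> finite S \<Longrightarrow>
     (\<Sum>k\<in>S. min (A * 2 powr (\<alpha> * real_of_int k)) (B * 2 powr ((\<alpha> - s) * real_of_int k))) \<le> C * A powr (1 - \<alpha>/s) * B powr (\<alpha>/s)"
proof -
  define \<beta> where "\<beta> = s - \<alpha>"
  have \<beta>: "\<beta> > 0" using \<alpha> by (simp add: \<beta>_def)
  have s: "s > 0" using \<alpha> by simp
  define C1 where "C1 = 1 / (1 - 2 powr (-\<alpha>))"
  define C2 where "C2 = 1 / (1 - 2 powr (-\<beta>))"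
  have C: "C1 > 0" "C2 > 0" using \<alpha> \<beta> by (auto simp: C1_def C2_def powr_less_one)
  show thesis
  proof (rule that[of "C1 + C2"])
    show "C1 + C2 > 0" using C by simp
    fix A B :: real and S :: "int set"
    assume A: "A \<ge> 0" and B: "B \<ge> 0" and S: "finite S"
    let ?t = "\<lambda>k. min (A * 2 powr (\<alpha> * real_of_int k)) (B * 2 powr ((\<alpha> - s) * real_of_int k))"
    show "(\<Sum>k\<in>S. ?t k) \<le> (C1 + C2) * A powr (1 - \<alpha>/s) * B powr (\<alpha>/s)"
    proof (cases "A = 0 \<or> B = 0")
      case True
      hence "?t k = 0" for k using A B by auto
      hence "(\<Sum>k\<in>S. ?t k) = 0" by simp
      moreover have "0 \<le> (C1 + C2) * A powr (1 - \<alpha>/s) * B powr (\<alpha>/s)"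
        using C by (intro mult_nonneg_nonneg) auto
      ultimately show ?thesis by simp
    next
      case False
      hence A: "A > 0" and B: "B > 0" using A B by auto
      define R where "R = (B / A) powr (1/s)"
      have R: "R > 0" using A B by (simp add: R_def)
      define k0 where "k0 = \<lfloor>log 2 R\<rfloor>"
      have k0: "real_of_int k0 \<le> log 2 R" "log 2 R \<le> real_of_int (k0 + 1)"
        unfolding k0_def by linarith+
      have p1: "2 powr (\<alpha> * real_of_int k0) \<le> R powr \<alpha>"
      proof -
        have "2 powr (\<alpha> * real_of_int k0) \<le> 2 powr (\<alpha> * log 2 R)"
          using k0 \<alpha> by (intro powr_mono mult_left_mono) auto
        also have "\<dots> = R powr \<alpha>" using R by (simp add: powr_powr[symmetric] mult.commute[of \<alpha>])
        finally show ?thesis .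
      qed
      have p2: "2 powr (\<beta> * real_of_int (- (k0 + 1))) \<le> R powr (-\<beta>)"
      proof -
        have "\<beta> * log 2 R \<le> \<beta> * real_of_int (k0 + 1)" using k0(2) \<beta> by (intro mult_left_mono) auto
        hence "2 powr (\<beta> * real_of_int (- (k0 + 1))) \<le> 2 powr (- \<beta> * log 2 R)"
          by (intro powr_mono) (auto simp: algebra_simps)
        also have "\<dots> = (2 powr log 2 R) powr (-\<beta>)" unfolding powr_powr by (simp add: mult.commute)
        also have "\<dots> = R powr (-\<beta>)" using R by simp
        finally show ?thesis .
      qed
      define S1 where "S1 = {k\<in>S. k \<le> k0}"
      define S2 where "S2 = {k\<in>S. k0 < k}"
      have "(\<Sum>k\<in>S. ?t k) = (\<Sum>k\<in>S1. ?t k) + (\<Sum>k\<in>S2. ?t k)"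
        using S unfolding S1_def S2_def by (subst sum.union_disjoint[symmetric]) (auto intro!: sum.cong)
      also have "(\<Sum>k\<in>S1. ?t k) \<le> (\<Sum>k\<in>S1. A * 2 powr (\<alpha> * real_of_int k))" by (intro sum_mono) auto
      also have "\<dots> = A * (\<Sum>k\<in>S1. 2 powr (\<alpha> * real_of_int k))" by (simp add: sum_distrib_left)
      also have "\<dots> \<le> A * (2 powr (\<alpha> * k0) / (1 - 2 powr (-\<alpha>)))"
        using A \<alpha> S by (intro mult_left_mono sum_powr_below) (auto simp: S1_def)
      also have "\<dots> = C1 * (A * 2 powr (\<alpha> * k0))" by (simp add: C1_def)
      also have "\<dots> \<le> C1 * (A * R powr \<alpha>)" using A C by (intro mult_left_mono p1) auto
      also have "(\<Sum>k\<in>S2. ?t k) \<le> (\<Sum>k\<in>S2. B * 2 powr ((\<alpha> - s) * real_of_int k))" by (intro sum_mono) auto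
      also have "\<dots> = B * (\<Sum>k\<in>S2. 2 powr (\<beta> * real_of_int (- k)))" by (simp add: sum_distrib_left \<beta>_def algebra_simps)
      also have "(\<Sum>k\<in>S2. 2 powr (\<beta> * real_of_int (- k))) = (\<Sum>k\<in>uminus ` S2. 2 powr (\<beta> * real_of_int k))"
        by (subst sum.reindex) (auto simp: inj_on_def)
      also have "B * \<dots> \<le> B * (2 powr (\<beta> * real_of_int (- (k0 + 1))) / (1 - 2 powr (-\<beta>)))"
        using B \<beta> S by (intro mult_left_mono sum_powr_below) (auto simp: S2_def)
      also have "\<dots> = C2 * (B * 2 powr (\<beta> * real_of_int (- (k0 + 1))))" by (simp add: C2_def)
      also have "\<dots> \<le> C2 * (B * R powr (-\<beta>))" using B C by (intro mult_left_mono p2) auto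
      also have "A * R powr \<alpha> = A powr (1 - \<alpha>/s) * B powr (\<alpha>/s)"
      proof -
        have "R powr \<alpha> = B powr (\<alpha>/s) / A powr (\<alpha>/s)"
          using A B by (simp add: R_def powr_powr powr_divide)
        moreover have "A powr (1 - \<alpha>/s) = A / A powr (\<alpha>/s)" using A by (simp add: powr_diff)
        ultimately show ?thesis by simp
      qed
      also have "B * R powr (-\<beta>) = A powr (1 - \<alpha>/s) * B powr (\<alpha>/s)"
      proof -
        have e: "1/s * (-\<beta>) = \<alpha>/s - 1" using s by (simp add: \<beta>_def field_simps)
        have "R powr (-\<beta>) = (B / A) powr (\<alpha>/s - 1)" unfolding R_def powr_powr e ..
        also have "\<dots> = (B powr (\<alpha>/s) / B) / (A powr (\<alpha>/s) / A)"
          using A B by (simp add: powr_divide powr_diff)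
        finally have "B * R powr (-\<beta>) = B powr (\<alpha>/s) * (A / A powr (\<alpha>/s))" using A B by simp
        moreover have "A powr (1 - \<alpha>/s) = A / A powr (\<alpha>/s)" using A by (simp add: powr_diff)
        ultimately show ?thesis by simp
      qed
      finally show ?thesis by (simp add: algebra_simps)
    qed
  qed
qed

locale rough_kernel_cart = rough_kernel g c \<alpha> n for g :: "real ^ 'n \<Rightarrow> complex" and c \<alpha> n
begin

abbreviation energy :: "(real ^ 'n \<Rightarrow> complex) \<Rightarrow> real ^ 'n \<Rightarrow> real \<Rightarrow> ennreal" where
  "energy f x R \<equiv> \<integral>\<^sup>+y. ennreal (norm (gradient f y) powr n) * indicator (cball x R) y \<partial>lborel"

lemma integrable_kern_mult:
  assumes a: "a > 0" and f: "f \<in> Cc_infinity"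
  shows "integrable lborel (\<lambda>y. kern a b y * f (x - r *\<^sub>R y))"
proof -
  obtain M where M: "\<And>y. norm y > M \<Longrightarrow> f y = 0" using Cc_infinity_support[OF f] by metis
  obtain L where L: "L > 0" "\<And>y. norm (f y) \<le> L"
    using bounded_of_continuous_compact_support[OF Cc_infinity_continuous[OF f] M] by metis
  have [measurable]: "f \<in> borel_measurable borel" by (rule Cc_infinity_borel_measurable[OF f])
  show ?thesis
  proof (rule Bochner_Integration.integrable_bound[where f = "\<lambda>y. L *\<^sub>R kern a b y"])
    show "integrable lborel (\<lambda>y. L *\<^sub>R kern a b y)" using kern_integrable(1)[OF a] by simp
    show "AE y in lborel. norm (kern a b y * f (x - r *\<^sub>R y)) \<le> norm (L *\<^sub>R kern a b y)"
      using L by (intro AE_I2) (simp add: norm_mult mult.commute mult_right_mono)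
  qed measurable
qed

text \<open>
  Rescaling the annulus to \<open>1/2 < |w| \<le> 1\<close> leaves \<open>\<integral> |\<nabla>f|\<^sup>n\<close> unchanged, because \<open>n\<close> is the dimension, and
  produces the factor \<open>R\<^sup>n R\<^sup>-\<^sup>(\<^sup>n\<^sup>+\<^sup>1\<^sup>-\<^sup>\<alpha>\<^sup>)\<close>.
\<close>

lemma annulus_estimate:
  obtains C where "C > 0" "\<And>f x R A. f \<in> Cc_infinity \<Longrightarrow> R > 0 \<Longrightarrow> A \<ge> 0 \<Longrightarrow>
     energy f x R \<le> ennreal (A powr n) \<Longrightarrow>
     norm (LINT y|lborel. kern (R / 2) R y * f (x - y)) \<le> C * R powr (\<alpha> - 1) * A"
proof -
  obtain C0 where C0: "C0 \<ge> 0" "\<And>h N. h \<in> borel_measurable borel \<Longrightarrow> (\<And>v. h v \<ge> 0) \<Longrightarrow> N \<ge> 0 \<Longrightarrow>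
      (\<integral>\<^sup>+v. ennreal (h v powr n) * indicator (cball 0 1) v \<partial>lborel) \<le> ennreal (N powr n) \<Longrightarrow>
      (\<integral>\<^sup>+w. ennreal (G w) * indicator (cball 0 1) w *
         (\<integral>\<^sup>+v. ennreal (h v * norm (v - w) powr (1 - n)) * indicator (cball 0 1) v \<partial>lborel) \<partial>lborel) \<le> ennreal (C0 * N)"
    by (rule rough_riesz_bound[OF G_measurable G_nonneg G_integrable G_log_integrable[unfolded n_def], folded n_def]) blast
  define \<kappa> where "\<kappa> = c * (1/2) powr (- (n + 1 - \<alpha>))"
  have \<kappa>: "\<kappa> \<ge> 0" using c by (simp add: \<kappa>_def)
  define C where "C = \<kappa> * 2 ^ CARD('n) / (CARD('n) * unit_ball_vol CARD('n)) * C0"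
  have Cge: "C \<ge> 0" using \<kappa> C0(1) by (simp add: C_def)
  show thesis
  \<comment> \<open>The constant \<open>C\<close> may be zero.\<close>
  proof (rule that[of "C + 1"])
    show "C + 1 > 0" using Cge by simp
    fix f :: "real ^ 'n \<Rightarrow> complex" and x R A
    assume f: "f \<in> Cc_infinity" and R: "(R::real) > 0" and A: "(A::real) \<ge> 0"
      and hA: "energy f x R \<le> ennreal (A powr n)"
    have fm [measurable]: "f \<in> borel_measurable borel" by (rule Cc_infinity_borel_measurable[OF f])
    have gm [measurable]: "gradient f \<in> borel_measurable borel" by (rule borel_measurable_gradient[OF f])
    define u where "u w = f (x - R *\<^sub>R w)" for w
    define h where "h w = R * norm (gradient f (x - R *\<^sub>R w))" for w
    have um [measurable]: "u \<in> borel_measurable borel" unfolding u_def by measurable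
    have hm [measurable]: "h \<in> borel_measurable borel" unfolding h_def by measurable
    have h0: "h w \<ge> 0" for w using R by (simp add: h_def)
    have ray: "ennreal (norm (u z - u w)) \<le> (\<integral>\<^sup>+t. ennreal (h (z + t *\<^sub>R (w - z)) * norm (w - z)) * indicator {0..1} t \<partial>lborel)" for z w
    proof -
      have e: "x - R *\<^sub>R z + t *\<^sub>R (x - R *\<^sub>R w - (x - R *\<^sub>R z)) = x - R *\<^sub>R (z + t *\<^sub>R (w - z))" for t
        by (simp add: algebra_simps)
      have e2: "norm (x - R *\<^sub>R w - (x - R *\<^sub>R z)) = R * norm (w - z)"
      proof -
        have "x - R *\<^sub>R w - (x - R *\<^sub>R z) = R *\<^sub>R (z - w)" by (simp add: algebra_simps)
        thus ?thesis using R by (simp add: norm_minus_commute)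
      qed
      show ?thesis
        using increment_le_integral_gradient[OF f, of "x - R *\<^sub>R z" "x - R *\<^sub>R w"]
        unfolding e e2 u_def h_def by (simp add: mult_ac)
    qed
    have hN: "(\<integral>\<^sup>+v. ennreal (h v powr n) * indicator (cball 0 1) v \<partial>lborel) \<le> ennreal (A powr n)"
    proof -
      let ?F = "\<lambda>y. ennreal (norm (gradient f y) powr n) * indicator (cball x R) y"
      have [measurable]: "cball x R \<in> sets borel" by simp
      have "(\<integral>\<^sup>+y. ?F y \<partial>lborel) = ennreal (\<bar>-R\<bar> ^ DIM(real^'n)) * (\<integral>\<^sup>+w. ?F (x + (-R) *\<^sub>R w) \<partial>lborel)"
        by (rule nn_integral_lborel_affine) (use R in auto)
      also have "\<dots> = (\<integral>\<^sup>+w. ennreal (\<bar>-R\<bar> ^ DIM(real^'n)) * ?F (x + (-R) *\<^sub>R w) \<partial>lborel)"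
        by (rule nn_integral_cmult[symmetric]) measurable
      also have "\<dots> = (\<integral>\<^sup>+v. ennreal (h v powr n) * indicator (cball 0 1) v \<partial>lborel)"
      proof (rule nn_integral_cong)
        fix v :: "real^'n"
        have i: "indicator (cball x R) (x + (-R) *\<^sub>R v) = (indicator (cball 0 1) v :: ennreal)"
          using R by (simp add: indicator_def dist_norm)
        have "h v powr n = R ^ CARD('n) * norm (gradient f (x - R *\<^sub>R v)) powr n"
          using R by (simp add: h_def powr_mult n_def powr_realpow)
        thus "ennreal (\<bar>-R\<bar> ^ DIM(real^'n)) * ?F (x + (-R) *\<^sub>R v) = ennreal (h v powr n) * indicator (cball 0 1) v"
          unfolding i using R by (simp add: ennreal_mult mult.assoc)
      qed
      finally show ?thesis using hA by simp
    qed
    have k: "integrable lborel (kern (1/2) 1)" "(LINT w|lborel. kern (1/2) 1 w) = 0"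
      using kern_integrable[of "1/2" 1] by auto
    have ku: "integrable lborel (\<lambda>w. kern (1/2) 1 w * u w)"
      unfolding u_def by (rule integrable_kern_mult[OF _ f]) simp
    have kG: "norm (kern (1/2) 1 w) \<le> \<kappa> * G w * indicator (cball 0 1) w" for w
    proof (cases "norm w \<in> {1/2<..1}")
      case True
      have "norm w powr (- (n + 1 - \<alpha>)) \<le> (1/2) powr (- (n + 1 - \<alpha>))"
        using True n_ge_1 \<alpha> by (intro powr_mono2') auto
      hence "norm w powr (- (n + 1 - \<alpha>)) * (c * G w) \<le> (1/2) powr (- (n + 1 - \<alpha>)) * (c * G w)"
        using c G_nonneg[of w] by (intro mult_right_mono) auto
      thus ?thesis using True by (simp add: kern_def norm_g \<kappa>_def mult_ac)
    qed (use \<kappa> G_nonneg in \<open>auto simp: kern_def\<close>)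
    have "norm (LINT w|lborel. kern (1/2) 1 w * u w) \<le> \<kappa> * 2 ^ DIM(real^'n) / (DIM(real^'n) * unit_ball_vol DIM(real^'n)) * (C0 * A)"
      by (rule norm_integral_cancel_le[OF k ku um G_measurable G_nonneg kG \<kappa> hm h0 ray _])
         (use C0(2)[OF hm h0 A hN] C0(1) A in \<open>simp_all add: n_def\<close>)
    hence b: "norm (LINT w|lborel. kern (1/2) 1 w * u w) \<le> C * A" by (simp add: C_def mult.assoc)
    have "(LINT y|lborel. kern (R / 2) R y * f (x - y)) = R ^ DIM(real^'n) *\<^sub>R (LINT w|lborel. kern (R / 2) R (R *\<^sub>R w) * f (x - R *\<^sub>R w))"
      using R by (intro integral_lborel_scale) auto
    also have "\<dots> = R ^ DIM(real^'n) *\<^sub>R (LINT w|lborel. R powr (- (n + 1 - \<alpha>)) *\<^sub>R (kern (1/2) 1 w * u w))"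
      using R by (simp add: kern_scale u_def)
    also have "\<dots> = (R ^ DIM(real^'n) * R powr (- (n + 1 - \<alpha>))) *\<^sub>R (LINT w|lborel. kern (1/2) 1 w * u w)"
      by simp
    also have "R ^ DIM(real^'n) * R powr (- (n + 1 - \<alpha>)) = R powr (\<alpha> - 1)"
    proof -
      have "R ^ DIM(real^'n) = R powr n" using R by (simp add: n_def powr_realpow)
      thus ?thesis by (simp add: powr_add[symmetric])
    qed
    finally have "norm (LINT y|lborel. kern (R / 2) R y * f (x - y)) = R powr (\<alpha> - 1) * norm (LINT w|lborel. kern (1/2) 1 w * u w)"
      by simp
    also have "\<dots> \<le> R powr (\<alpha> - 1) * (C * A)" by (intro mult_left_mono b) auto
    also have "\<dots> \<le> (C + 1) * R powr (\<alpha> - 1) * A" using A by (simp add: algebra_simps)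
    finally show "norm (LINT y|lborel. kern (R / 2) R y * f (x - y)) \<le> (C + 1) * R powr (\<alpha> - 1) * A" .
  qed
qed

lemma kern_split: "a \<le> m \<Longrightarrow> m \<le> b \<Longrightarrow> kern a b y = kern a m y + kern m b y"
  by (auto simp: kern_def indicator_def)

lemma integral_kern_dyadic:
  assumes f: "f \<in> Cc_infinity" and b: "b > 0"
  shows "(LINT y|lborel. kern (b / 2 ^ l) b y * f (x - y))
     = (\<Sum>j<l. LINT y|lborel. kern (b / 2 ^ j / 2) (b / 2 ^ j) y * f (x - y))"
proof (induction l)
  case 0
  have "kern b b y = 0" for y by (simp add: kern_def)
  thus ?case by simp
next
  case (Suc l)
  have i: "integrable lborel (\<lambda>y. kern a b' y * f (x - y))" if "a > 0" for a b'
    using integrable_kern_mult[OF that f, of b' x 1] by simp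
  have "(LINT y|lborel. kern (b / 2 ^ Suc l) b y * f (x - y))
      = (LINT y|lborel. kern (b / 2 ^ l / 2) (b / 2 ^ l) y * f (x - y) + kern (b / 2 ^ l) b y * f (x - y))"
  proof (rule Bochner_Integration.integral_cong)
    fix y
    have "kern (b / 2 ^ Suc l) b y = kern (b / 2 ^ l / 2) (b / 2 ^ l) y + kern (b / 2 ^ l) b y"
      using b kern_split[of "b / 2 ^ Suc l" "b / 2 ^ l" b y] by (simp add: field_simps)
    thus "kern (b / 2 ^ Suc l) b y * f (x - y) = kern (b / 2 ^ l / 2) (b / 2 ^ l) y * f (x - y) + kern (b / 2 ^ l) b y * f (x - y)"
      by (simp add: distrib_right)
  qed simp
  also have "\<dots> = (LINT y|lborel. kern (b / 2 ^ l / 2) (b / 2 ^ l) y * f (x - y)) + (LINT y|lborel. kern (b / 2 ^ l) b y * f (x - y))"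
    using b by (intro Bochner_Integration.integral_add i) auto
  finally show ?case using Suc by simp
qed

text \<open>
  The truncated operator with the Borel representative \<open>g\<close> in place of \<open>\<Omega>\<close>, which makes it Borel
  measurable in \<open>x\<close>.
\<close>

definition trunc :: "real \<Rightarrow> (real ^ 'n \<Rightarrow> complex) \<Rightarrow> real ^ 'n \<Rightarrow> complex" where
  "trunc \<epsilon> f x = (LINT y|lborel. (norm y powr (- (n + 1 - \<alpha>)) * indicator {\<epsilon><..} (norm y)) *\<^sub>R g (sgn y) * f (x - y))"

lemma trunc_eq_kern:
  assumes "\<And>y. norm y > b \<Longrightarrow> f (x - y) = 0"
  shows "trunc \<epsilon> f x = (LINT y|lborel. kern \<epsilon> b y * f (x - y))"
  unfolding trunc_def kern_def
  by (rule Bochner_Integration.integral_cong) (use assms in \<open>auto simp: indicator_def not_le\<close>)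

lemma borel_measurable_trunc:
  assumes f: "f \<in> Cc_infinity"
  shows "trunc \<epsilon> f \<in> borel_measurable borel"
proof -
  have [measurable]: "f \<in> borel_measurable borel" by (rule Cc_infinity_borel_measurable[OF f])
  show ?thesis unfolding trunc_def[abs_def] by measurable
qed

text \<open>
  As the kernel has mean zero, \<open>f x\<close> may be subtracted from \<open>f (x - y)\<close>. As \<open>f\<close> is Lipschitz, this gains a factor
  \<open>|y|\<close>, and \<open>|y|\<^sup>\<alpha>\<^sup>-\<^sup>n\<close> is integrable near the origin.
\<close>

lemma trunc_tendsto:
  assumes f: "f \<in> Cc_infinity"
  shows "\<exists>l. ((\<lambda>\<epsilon>. trunc \<epsilon> f x) \<longlongrightarrow> l) (at_right 0)"
proof -
  have fm [measurable]: "f \<in> borel_measurable borel" by (rule Cc_infinity_borel_measurable[OF f])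
  obtain M where M: "M > 0" "\<And>y. norm y > M \<Longrightarrow> f y = 0" "\<And>y. norm y > M \<Longrightarrow> gradient f y = 0"
    using Cc_infinity_support[OF f] by metis
  obtain L where L: "L > 0" "\<And>y. norm (gradient f y) \<le> L"
    using bounded_of_continuous_compact_support[OF Cc_infinity_continuous_gradient[OF f] M(3)] by metis
  define b where "b = M + norm x"
  have b: "b > 0" using M by (simp add: b_def add_pos_nonneg)
  have fb: "f (x - y) = 0" if "norm y > b" for y
    using that norm_triangle_ineq2[of y x] by (intro M(2)) (simp add: b_def norm_minus_commute)
  define F where "F y = kern 0 b y * (f (x - y) - f x)" for y
  have Fm [measurable]: "F \<in> borel_measurable borel" unfolding F_def by measurable
  have Fint: "integrable lborel F"
  proof (rule Bochner_Integration.integrable_bound)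
    show "integrable lborel (\<lambda>y. (L * norm y powr (\<alpha> - n) * indicator {..b} (norm y)) *\<^sub>R g (sgn y))"
    proof (rule radial_mean_zero(1))
      show "radial_integral DIM(real^'n) (\<lambda>r. ennreal (L * r powr (\<alpha> - n) * indicator {..b} r)) < \<infinity>"
        by (rule radial_integral_bounded_finite[where K = L and s = \<alpha> and R = b])
           (use L \<alpha> b in \<open>auto simp: indicator_def\<close>)
    qed (use L in auto)
    show "AE y in lborel. norm (F y) \<le> norm ((L * norm y powr (\<alpha> - n) * indicator {..b} (norm y)) *\<^sub>R g (sgn y))"
    proof (rule AE_I2)
      fix y :: "real ^ 'n"
      show "norm (F y) \<le> norm ((L * norm y powr (\<alpha> - n) * indicator {..b} (norm y)) *\<^sub>R g (sgn y))"
      proof (cases "norm y \<in> {0<..b}")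
        case True
        have "norm (f (x - y) - f x) \<le> L * norm (x - (x - y))"
          using L by (intro increment_le_Lipschitz[OF f]) auto
        hence "norm y powr (- (n + 1 - \<alpha>)) * norm (g (sgn y)) * norm (f (x - y) - f x) \<le> norm y powr (- (n + 1 - \<alpha>)) * norm (g (sgn y)) * (L * norm y)"
          by (intro mult_left_mono) auto
        also have "\<dots> = L * (norm y powr (- (n + 1 - \<alpha>)) * norm y powr 1) * norm (g (sgn y))"
          by simp
        also have "norm y powr (- (n + 1 - \<alpha>)) * norm y powr 1 = norm y powr (\<alpha> - n)"
          unfolding powr_add[symmetric] by (simp add: algebra_simps)
        finally show ?thesis using True L by (simp add: F_def kern_def norm_mult)
      qed (auto simp: F_def kern_def)
    qed
  qed measurable
  define l where "l = (LINT y|lborel. F y)"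
  have eq: "trunc \<epsilon> f x = (LINT y|lborel. indicator {\<epsilon><..} (norm y) *\<^sub>R F y)" if e: "\<epsilon> > 0" for \<epsilon>
  proof -
    have "trunc \<epsilon> f x = (LINT y|lborel. kern \<epsilon> b y * f (x - y))" by (rule trunc_eq_kern) (rule fb)
    also have "\<dots> = (LINT y|lborel. kern \<epsilon> b y * f (x - y)) - (LINT y|lborel. kern \<epsilon> b y * f x)"
      using kern_integrable[OF e, of b] by simp
    also have "\<dots> = (LINT y|lborel. kern \<epsilon> b y * f (x - y) - kern \<epsilon> b y * f x)"
      using kern_integrable[OF e, of b] integrable_kern_mult[OF e f, of b x 1]
      by (subst Bochner_Integration.integral_diff) auto
    also have "\<dots> = (LINT y|lborel. indicator {\<epsilon><..} (norm y) *\<^sub>R F y)"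
      using e by (intro Bochner_Integration.integral_cong) (auto simp: F_def kern_def indicator_def algebra_simps)
    finally show ?thesis .
  qed
  have "((\<lambda>\<epsilon>. trunc \<epsilon> f x) \<longlongrightarrow> l) (at_right 0)"
  proof (rule tendsto_at_right_sequentially[of 0 1])
    fix S :: "nat \<Rightarrow> real" assume S: "\<And>i. 0 < S i" "S \<longlonglongrightarrow> 0"
    have "(\<lambda>i. LINT y|lborel. indicator {S i<..} (norm y) *\<^sub>R F y) \<longlonglongrightarrow> l"
      unfolding l_def
    proof (rule integral_dominated_convergence[where w = "\<lambda>y. norm (F y)"])
      show "integrable lborel (\<lambda>y. norm (F y))" using Fint by simp
      show "AE y in lborel. (\<lambda>i. indicator {S i<..} (norm y) *\<^sub>R F y) \<longlonglongrightarrow> F y"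
      proof (rule AE_mp[OF AE_lborel_nonzero], rule AE_I2, rule impI)
        fix y :: "real^'n" assume "y \<noteq> 0"
        hence "\<forall>\<^sub>F i in sequentially. S i < norm y" using S(2) by (intro order_tendstoD) auto
        hence "\<forall>\<^sub>F i in sequentially. indicator {S i<..} (norm y) *\<^sub>R F y = F y"
          by eventually_elim simp
        thus "(\<lambda>i. indicator {S i<..} (norm y) *\<^sub>R F y) \<longlonglongrightarrow> F y" by (rule tendsto_eventually)
      qed
      show "AE y in lborel. norm (indicator {S i<..} (norm y) *\<^sub>R F y) \<le> norm (F y)" for i
        by (intro AE_I2) (auto simp: indicator_def)
    qed measurable
    thus "(\<lambda>i. trunc (S i) f x) \<longlonglongrightarrow> l" using S(1) by (simp add: eq)
  qed simp
  thus ?thesis by blast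
qed

text \<open>
  A truncation at \<open>2\<^sup>-\<^sup>l\<close> is a finite sum of annuli, since \<open>f\<close> has compact support. The two hypotheses
  on the balls are the bounds that \<open>hedberg_sum\<close> balances.
\<close>

lemma trunc_pointwise_bound:
  assumes s: "\<alpha> < s"
  obtains C where "C > 0" "\<And>f x A B l. f \<in> Cc_infinity \<Longrightarrow> A \<ge> 0 \<Longrightarrow> B \<ge> 0 \<Longrightarrow>
     (\<And>k::int. energy f x (2 powr k) \<le> ennreal ((A * 2 powr k) powr n)) \<Longrightarrow>
     (\<And>k::int. energy f x (2 powr k) \<le> ennreal ((B * 2 powr ((1 - s) * k)) powr n)) \<Longrightarrow>
     norm (trunc (1 / 2 ^ l) f x) \<le> C * A powr (1 - \<alpha>/s) * B powr (\<alpha>/s)"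
proof -
  obtain C1 where C1: "C1 > 0" "\<And>f x R A. f \<in> Cc_infinity \<Longrightarrow> R > 0 \<Longrightarrow> A \<ge> 0 \<Longrightarrow>
     energy f x R \<le> ennreal (A powr n) \<Longrightarrow>
     norm (LINT y|lborel. kern (R / 2) R y * f (x - y)) \<le> C1 * R powr (\<alpha> - 1) * A"
    by (rule annulus_estimate) blast
  obtain C2 where C2: "C2 > 0" "\<And>A B S. A \<ge> 0 \<Longrightarrow> B \<ge> 0 \<Longrightarrow> finite S \<Longrightarrow>
     (\<Sum>k\<in>S. min (A * 2 powr (\<alpha> * real_of_int k)) (B * 2 powr ((\<alpha> - s) * real_of_int k))) \<le> C2 * A powr (1 - \<alpha>/s) * B powr (\<alpha>/s)"
    by (rule hedberg_sum[OF \<alpha>(1) s]) blast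
  show thesis
  proof (rule that[of "C1 * C2"])
    show "C1 * C2 > 0" using C1 C2 by simp
    fix f :: "real ^ 'n \<Rightarrow> complex" and x A B and l :: nat
    assume f: "f \<in> Cc_infinity" and A: "(A::real) \<ge> 0" and B: "(B::real) \<ge> 0"
      and hA: "\<And>k::int. energy f x (2 powr k) \<le> ennreal ((A * 2 powr k) powr n)"
      and hB: "\<And>k::int. energy f x (2 powr k) \<le> ennreal ((B * 2 powr ((1 - s) * k)) powr n)"
    obtain M where M: "M > 0" "\<And>y. norm y > M \<Longrightarrow> f y = 0" using Cc_infinity_support[OF f] by metis
    obtain K :: nat where K: "M + norm x < 2 ^ K" using real_arch_pow[of 2 "M + norm x"] by auto
    define b :: real where "b = 2 ^ K"
    have b: "b > 0" by (simp add: b_def)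
    have fb: "f (x - y) = 0" if "norm y > b" for y
      using that K norm_triangle_ineq2[of y x] by (intro M(2)) (simp add: b_def norm_minus_commute)
    have bj: "b / 2 ^ j = 2 powr (real_of_int (int K - int j))" for j
      by (simp add: b_def powr_diff powr_realpow)
    have bl: "1 / 2 ^ l = b / 2 ^ (K + l)" by (simp add: b_def power_add)
    have "trunc (1 / 2 ^ l) f x = (LINT y|lborel. kern (b / 2 ^ (K + l)) b y * f (x - y))"
      unfolding bl by (rule trunc_eq_kern) (rule fb)
    also have "\<dots> = (\<Sum>j<K+l. LINT y|lborel. kern (b / 2 ^ j / 2) (b / 2 ^ j) y * f (x - y))"
      by (rule integral_kern_dyadic[OF f b])
    finally have "norm (trunc (1 / 2 ^ l) f x) \<le> (\<Sum>j<K+l. norm (LINT y|lborel. kern (b / 2 ^ j / 2) (b / 2 ^ j) y * f (x - y)))"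
      by (simp only: norm_sum)
    also have "\<dots> \<le> (\<Sum>j<K+l. C1 * (min (A * 2 powr (\<alpha> * real_of_int (int K - int j))) (B * 2 powr ((\<alpha> - s) * real_of_int (int K - int j)))))"
    proof (rule sum_mono)
      fix j
      define k where "k = int K - int j"
      have "norm (LINT y|lborel. kern (2 powr k / 2) (2 powr k) y * f (x - y)) \<le> C1 * (2 powr k) powr (\<alpha> - 1) * (A * 2 powr k)"
        using A by (intro C1(2) f hA) auto
      moreover have "(2 powr k) powr (\<alpha> - 1) * (A * 2 powr k) = A * 2 powr (\<alpha> * k)"
        by (simp add: powr_powr powr_add[symmetric] algebra_simps)
      moreover have "norm (LINT y|lborel. kern (2 powr k / 2) (2 powr k) y * f (x - y)) \<le> C1 * (2 powr k) powr (\<alpha> - 1) * (B * 2 powr ((1 - s) * k))"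
        using B by (intro C1(2) f hB) auto
      moreover have "(2 powr k) powr (\<alpha> - 1) * (B * 2 powr ((1 - s) * k)) = B * 2 powr ((\<alpha> - s) * k)"
        by (simp add: powr_powr powr_add[symmetric] algebra_simps)
      ultimately show "norm (LINT y|lborel. kern (b / 2 ^ j / 2) (b / 2 ^ j) y * f (x - y))
         \<le> C1 * (min (A * 2 powr (\<alpha> * real_of_int (int K - int j))) (B * 2 powr ((\<alpha> - s) * real_of_int (int K - int j))))"
        unfolding bj k_def[symmetric] by (simp add: mult.assoc min_def)
    qed
    also have "\<dots> = C1 * (\<Sum>j<K+l. min (A * 2 powr (\<alpha> * real_of_int (int K - int j))) (B * 2 powr ((\<alpha> - s) * real_of_int (int K - int j))))"
      by (simp add: sum_distrib_left)
    also have "(\<Sum>j<K+l. min (A * 2 powr (\<alpha> * real_of_int (int K - int j))) (B * 2 powr ((\<alpha> - s) * real_of_int (int K - int j))))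
       = (\<Sum>k\<in>(\<lambda>j. int K - int j) ` {..<K+l}. min (A * 2 powr (\<alpha> * real_of_int k)) (B * 2 powr ((\<alpha> - s) * real_of_int k)))"
      by (subst sum.reindex) (auto simp: inj_on_def)
    also have "C1 * \<dots> \<le> C1 * (C2 * A powr (1 - \<alpha>/s) * B powr (\<alpha>/s))"
      using C1 A B by (intro mult_left_mono C2(2)) auto
    finally show "norm (trunc (1 / 2 ^ l) f x) \<le> C1 * C2 * A powr (1 - \<alpha>/s) * B powr (\<alpha>/s)"
      by (simp add: mult.assoc)
  qed
qed

end

section \<open>Sobolev bounds for the rough operator\<close>

lemma integral_lebesgue_AE_borel:
  fixes F F' :: "'a::euclidean_space \<Rightarrow> complex"
  assumes F' [measurable]: "F' \<in> borel_measurable borel" and ae: "AE y in lborel. F y = F' y"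
  shows "(LINT y|lebesgue. F y) = (LINT y|lborel. F' y)"
proof -
  have ae': "AE y in lebesgue. F y = F' y" using ae by (rule AE_completion)
  have F'l: "F' \<in> borel_measurable lebesgue" by (intro measurable_completion) simp
  have "F \<in> borel_measurable lebesgue"
  proof (rule measurableI)
    fix A :: "complex set" assume A: "A \<in> sets borel"
    have 1: "F' -` A \<inter> space lebesgue \<in> sets lebesgue" using F'l A by (rule measurable_sets)
    have 2: "AE y in lebesgue. y \<in> F' -` A \<inter> space lebesgue \<longleftrightarrow> y \<in> F -` A \<inter> space lebesgue"
      using ae' by eventually_elim auto
    show "F -` A \<inter> space lebesgue \<in> sets lebesgue"
      by (rule completion.in_sets_AE[OF 2 1]) simp
  qed simp
  hence "(LINT y|lebesgue. F y) = (LINT y|lebesgue. F' y)"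
    using F'l ae' by (intro integral_cong_AE) auto
  also have "\<dots> = (LINT y|lborel. F' y)" by (rule integral_completion) simp
  finally show ?thesis .
qed

lemma ennreal_powr_root_le:
  assumes "x \<le> ennreal (D powr q)" "D \<ge> 0" "q > 0"
  shows "ennreal_powr x (1/q) \<le> ennreal D"
proof -
  have "x \<noteq> \<infinity>" using assms(1) by (auto simp: top_unique)
  moreover have "enn2real x \<le> D powr q" using assms by (intro enn2real_leI) auto
  hence "enn2real x powr (1/q) \<le> (D powr q) powr (1/q)" using assms by (intro powr_mono2) auto
  moreover have "(D powr q) powr (1/q) = D" using assms by (simp add: powr_powr)
  ultimately show ?thesis by (auto simp: ennreal_powr_def intro!: ennreal_leI)
qed

lemma Cc_infinity_gradient_Lp:
  fixes f :: "real ^ 'n \<Rightarrow> complex"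
  assumes f: "f \<in> Cc_infinity" and p: "p > 0"
  obtains P where "P \<ge> 0" "(\<integral>\<^sup>+y. ennreal (norm (gradient f y) powr p) \<partial>lborel) = ennreal (P powr p)"
    "Lp_norm p (gradient f) = ennreal P"
proof -
  have gm [measurable]: "gradient f \<in> borel_measurable borel" by (rule borel_measurable_gradient[OF f])
  obtain M where M: "M > 0" "\<And>y. norm y > M \<Longrightarrow> gradient f y = 0"
    using Cc_infinity_support[OF f] by metis
  obtain L where L: "L > 0" "\<And>y. norm (gradient f y) \<le> L"
    using bounded_of_continuous_compact_support[OF Cc_infinity_continuous_gradient[OF f] M(2)] by metis
  let ?I = "\<integral>\<^sup>+y. ennreal (norm (gradient f y) powr p) \<partial>lborel"
  have "?I \<le> (\<integral>\<^sup>+y. ennreal (L powr p) * indicator (cball (0::real^'n) M) y \<partial>lborel)"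
  proof (rule nn_integral_mono)
    fix y
    show "ennreal (norm (gradient f y) powr p) \<le> ennreal (L powr p) * indicator (cball 0 M) y"
    proof (cases "norm y \<le> M")
      case True
      thus ?thesis using L p by (auto intro!: ennreal_leI powr_mono2)
    qed (use M(2)[of y] p in auto)
  qed
  also have "\<dots> < \<infinity>" using M(1)
    by (simp add: nn_integral_cmult_indicator emeasure_cball ennreal_mult_less_top)
  finally have fin: "?I < \<infinity>" .
  define P where "P = enn2real ?I powr (1/p)"
  have P: "P \<ge> 0" by (simp add: P_def)
  have "P powr p = enn2real ?I" using p by (simp add: P_def powr_powr)
  hence I: "?I = ennreal (P powr p)" using fin by simp
  have "Lp_norm p (gradient f) = ennreal P"
    unfolding Lp_norm_def nn_integral_completion ennreal_powr_def using fin by (simp add: P_def)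
  thus thesis using that P I by blast
qed

context rough_kernel_cart
begin

abbreviation maximal_gradient :: "(real ^ 'n \<Rightarrow> complex) \<Rightarrow> real ^ 'n \<Rightarrow> real" where
  "maximal_gradient f x \<equiv> enn2real (dyadic_maximal (\<lambda>y. ennreal (norm (gradient f y) powr n)) x)"

lemma rough_truncated_eq_trunc:
  assumes ae: "AE y in lborel. \<Omega> (sgn y) = g (sgn y)" and f: "f \<in> Cc_infinity"
  shows "rough_truncated \<Omega> \<alpha> \<epsilon> f x = trunc \<epsilon> f x"
  unfolding rough_truncated_def set_lebesgue_integral_def trunc_def
proof (rule integral_lebesgue_AE_borel)
  have [measurable]: "f \<in> borel_measurable borel" by (rule Cc_infinity_borel_measurable[OF f])
  show "(\<lambda>y. (norm y powr - (n + 1 - \<alpha>) * indicat_real {\<epsilon><..} (norm y)) *\<^sub>R g (sgn y) * f (x - y)) \<in> borel_measurable borel"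
    by measurable
  show "AE y in lborel. indicat_real {y. \<epsilon> < norm y} y *\<^sub>R (\<Omega> (sgn y) / complex_of_real (norm y powr (real CARD('n) + 1 - \<alpha>)) * f (x - y)) =
      (norm y powr - (n + 1 - \<alpha>) * indicat_real {\<epsilon><..} (norm y)) *\<^sub>R g (sgn y) * f (x - y)"
    using ae
  proof eventually_elim
    case (elim y)
    have "norm y powr - (n + 1 - \<alpha>) = inverse (norm y powr (real CARD('n) + 1 - \<alpha>))"
      by (subst powr_minus) (simp add: n_def)
    thus ?case using elim by (auto simp: indicator_def scaleR_conv_of_real divide_inverse)
  qed
qed

text \<open>
  The maximal function is finite because the gradient of a test function is bounded; thus nothing is lost
  in the passage to real numbers.
\<close>

lemma maximal_gradient_ge:
  fixes k :: int and f :: "real ^ 'n \<Rightarrow> complex"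
  assumes f: "f \<in> Cc_infinity"
  shows "energy f x (2 powr k)
     \<le> ennreal ((maximal_gradient f x powr (1/n) * 2 powr k) powr n)"
proof -
  have gm [measurable]: "gradient f \<in> borel_measurable borel" by (rule borel_measurable_gradient[OF f])
  obtain M where M: "\<And>y. norm y > M \<Longrightarrow> gradient f y = 0"
    using Cc_infinity_support[OF f] by metis
  obtain L where L: "L > 0" "\<And>y. norm (gradient f y) \<le> L"
    using bounded_of_continuous_compact_support[OF Cc_infinity_continuous_gradient[OF f] M] by metis
  let ?I = "\<lambda>k::int. energy f x (2 powr k)"
  let ?M = "dyadic_maximal (\<lambda>y. ennreal (norm (gradient f y) powr n)) x"
  have "?M \<le> ennreal (L powr n * unit_ball_vol n)"
    unfolding dyadic_maximal_def
  proof (rule SUP_least)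
    fix k :: int
    have "?I k \<le> (\<integral>\<^sup>+y. ennreal (L powr n) * indicator (cball x (2 powr k)) y \<partial>lborel)"
      using L n_ge_1 by (intro nn_integral_mono mult_right_mono ennreal_leI powr_mono2) auto
    also have "\<dots> = ennreal (L powr n) * ennreal (unit_ball_vol n * (2 powr k) ^ DIM(real^'n))"
      by (simp add: nn_integral_cmult_indicator emeasure_cball n_def)
    finally have "ennreal (1 / (2 powr k) ^ DIM(real^'n)) * ?I k \<le> ennreal (1 / (2 powr k) ^ DIM(real^'n)) * (ennreal (L powr n) * ennreal (unit_ball_vol n * (2 powr k) ^ DIM(real^'n)))"
      by (rule mult_left_mono) simp
    also have "\<dots> = ennreal (L powr n * unit_ball_vol n)"
      using n_ge_1 by (simp add: ennreal_mult[symmetric])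
    finally show "ennreal (1 / (2 powr k) ^ DIM(real^'n)) * ?I k \<le> ennreal (L powr n * unit_ball_vol n)" .
  qed
  hence fin: "?M < \<infinity>" by (rule le_less_trans) simp
  have "ennreal (1 / (2 powr k) ^ DIM(real^'n)) * ?I k \<le> ?M"
    unfolding dyadic_maximal_def by (rule SUP_upper) simp
  hence "ennreal ((2 powr k) ^ DIM(real^'n)) * (ennreal (1 / (2 powr k) ^ DIM(real^'n)) * ?I k) \<le> ennreal ((2 powr k) ^ DIM(real^'n)) * ?M"
    by (rule mult_left_mono) simp
  also have "ennreal ((2 powr k) ^ DIM(real^'n)) * (ennreal (1 / (2 powr k) ^ DIM(real^'n)) * ?I k) = ?I k"
    by (simp add: mult.assoc[symmetric] ennreal_mult[symmetric])
  also have "ennreal ((2 powr k) ^ DIM(real^'n)) * ?M = ennreal ((2 powr k) powr n * maximal_gradient f x)"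
    using fin by (simp add: ennreal_mult n_def powr_realpow)
  also have "(2 powr k) powr n * maximal_gradient f x = (maximal_gradient f x powr (1/n) * 2 powr k) powr n"
    using n_ge_1 by (simp add: powr_mult powr_powr)
  finally show ?thesis .
qed

lemma gradient_ball_le_Lp:
  fixes k :: int and f :: "real ^ 'n \<Rightarrow> complex"
  assumes f: "f \<in> Cc_infinity" and p: "n \<le> p" and P: "P \<ge> 0"
    and hP: "(\<integral>\<^sup>+y. ennreal (norm (gradient f y) powr p) \<partial>lborel) = ennreal (P powr p)"
  shows "energy f x (2 powr k)
     \<le> ennreal ((unit_ball_vol n powr (1/n - 1/p) * P * 2 powr ((1 - n/p) * k)) powr n)"
proof -
  have gm [measurable]: "gradient f \<in> borel_measurable borel" by (rule borel_measurable_gradient[OF f])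
  have cb [measurable]: "cball x (2 powr k) \<in> sets borel" by simp
  have n: "n > 0" using n_ge_1 by simp
  define \<omega> where "\<omega> = unit_ball_vol n"
  have \<omega>: "\<omega> > 0" using n_ge_1 by (simp add: \<omega>_def)
  define b where "b = \<omega> * (2 powr k) powr n"
  have b: "b > 0" using \<omega> by (simp add: b_def)
  have "energy f x (2 powr k)
     = (\<integral>\<^sup>+y. ennreal (norm (gradient f y) powr n * indicat_real (cball x (2 powr k)) y powr (1 - 1/(p/n))) \<partial>lborel)"
    by (intro nn_integral_cong) (auto simp: indicator_def)
  also have "\<dots> \<le> ennreal (P powr n * b powr (1 - 1/(p/n)))"
  proof (rule nn_integral_holder)
    show "1 \<le> p / n" using p n by simp
    show "(\<integral>\<^sup>+y. ennreal ((norm (gradient f y) powr n) powr (p/n)) \<partial>lborel) \<le> ennreal ((P powr n) powr (p/n))"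
      using hP n by (simp add: powr_powr)
    show "(\<integral>\<^sup>+y. ennreal (indicat_real (cball x (2 powr k)) y) \<partial>lborel) \<le> ennreal b"
      using n by (simp add: ennreal_indicator emeasure_cball b_def \<omega>_def n_def powr_realpow)
  qed (use b in auto)
  also have "P powr n * b powr (1 - 1/(p/n)) = (\<omega> powr (1/n - 1/p) * P * 2 powr ((1 - n/p) * k)) powr n"
  proof -
    have e1: "(1/n - 1/p) * n = 1 - n/p" using n by (simp add: field_simps)
    have e2: "(1 - n/p) * real_of_int k * n = real_of_int k * n * (1 - n/p)" by simp
    have "b powr (1 - 1/(p/n)) = \<omega> powr (1 - n/p) * 2 powr (real_of_int k * n * (1 - n/p))"
      using \<omega> by (simp add: b_def powr_mult powr_powr)
    moreover have "(\<omega> powr (1/n - 1/p) * P * 2 powr ((1 - n/p) * k)) powr n = \<omega> powr (1 - n/p) * P powr n * 2 powr (real_of_int k * n * (1 - n/p))"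
      using \<omega> P by (simp only: powr_mult powr_powr e1 e2)
    ultimately show ?thesis by simp
  qed
  finally show ?thesis by (simp add: \<omega>_def)
qed

text \<open>
  Hedberg's inequality with \<open>s = n / p\<close>: the condition \<open>p < n / \<alpha>\<close> is \<open>\<alpha> < s\<close>.
\<close>

lemma limit_pointwise_bound:
  assumes p: "n \<le> p" "p < n / \<alpha>"
  obtains C where "C > 0" "\<And>f x P l. f \<in> Cc_infinity \<Longrightarrow> ((\<lambda>\<epsilon>. trunc \<epsilon> f x) \<longlongrightarrow> l) (at_right 0) \<Longrightarrow> P \<ge> 0 \<Longrightarrow>
     (\<integral>\<^sup>+y. ennreal (norm (gradient f y) powr p) \<partial>lborel) = ennreal (P powr p) \<Longrightarrow>
     norm l \<le> C * maximal_gradient f x powr ((1 - \<alpha> * p / n) / n) * P powr (\<alpha> * p / n)"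
proof -
  have n: "n > 0" using n_ge_1 by simp
  have p0: "p > 0" using p n by simp
  define s where "s = n / p"
  have "\<alpha> * p < n" using p \<alpha> by (simp add: field_simps)
  hence s: "\<alpha> < s" using p0 by (simp add: s_def field_simps)
  have as: "\<alpha> / s = \<alpha> * p / n" by (simp add: s_def)
  define \<theta> where "\<theta> = \<alpha> * p / n"
  define W where "W = unit_ball_vol n powr (1/n - 1/p)"
  have "unit_ball_vol n > 0" using n by simp
  hence W: "W > 0" by (simp add: W_def)
  obtain C where C: "C > 0" "\<And>f x A B l. f \<in> Cc_infinity \<Longrightarrow> A \<ge> 0 \<Longrightarrow> B \<ge> 0 \<Longrightarrow>
     (\<And>k::int. energy f x (2 powr k) \<le> ennreal ((A * 2 powr k) powr n)) \<Longrightarrow>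
     (\<And>k::int. energy f x (2 powr k) \<le> ennreal ((B * 2 powr ((1 - s) * k)) powr n)) \<Longrightarrow>
     norm (trunc (1 / 2 ^ l) f x) \<le> C * A powr (1 - \<alpha>/s) * B powr (\<alpha>/s)"
    by (rule trunc_pointwise_bound[OF s]) blast
  show thesis
  proof (rule that[of "C * W powr \<theta>"])
    show "C * W powr \<theta> > 0" using C W by simp
    fix f x P l
    assume f: "f \<in> Cc_infinity" and lim: "((\<lambda>\<epsilon>. trunc \<epsilon> f x) \<longlongrightarrow> l) (at_right 0)" and P: "P \<ge> 0"
      and hP: "(\<integral>\<^sup>+y. ennreal (norm (gradient f y) powr p) \<partial>lborel) = ennreal (P powr p)"
    let ?m = "maximal_gradient f x"
    have b: "norm (trunc (1 / 2 ^ j) f x) \<le> C * (?m powr (1/n)) powr (1 - \<alpha>/s) * (W * P) powr (\<alpha>/s)" for j :: nat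
      using W P maximal_gradient_ge[OF f] gradient_ball_le_Lp[OF f p(1) P hP]
      by (intro C(2) f) (auto simp: W_def s_def)
    have "filterlim (\<lambda>j. 1 / 2 ^ j) (at_right (0::real)) sequentially"
      unfolding filterlim_at by (auto intro!: tendsto_eq_intros LIMSEQ_divide_realpow_zero)
    hence "(\<lambda>j. trunc (1 / 2 ^ j) f x) \<longlonglongrightarrow> l" by (rule filterlim_compose[OF lim])
    hence "norm l \<le> C * (?m powr (1/n)) powr (1 - \<alpha>/s) * (W * P) powr (\<alpha>/s)"
      by (intro LIMSEQ_le_const2[OF tendsto_norm]) (auto intro!: b)
    also have "\<dots> = (C * W powr \<theta>) * ?m powr ((1 - \<alpha> * p / n) / n) * P powr (\<alpha> * p / n)"
      using W P unfolding as \<theta>_def by (simp add: powr_powr powr_mult)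
    finally show "norm l \<le> (C * W powr \<theta>) * ?m powr ((1 - \<alpha> * p / n) / n) * P powr (\<alpha> * p / n)" .
  qed
qed

lemma rough_op_limit:
  assumes ae: "AE y in lborel. \<Omega> (sgn y) = g (sgn y)" and f: "f \<in> Cc_infinity"
  shows "((\<lambda>\<epsilon>. trunc \<epsilon> f x) \<longlongrightarrow> rough_op \<Omega> \<alpha> f x) (at_right 0)"
proof -
  obtain l where l: "((\<lambda>\<epsilon>. trunc \<epsilon> f x) \<longlongrightarrow> l) (at_right 0)" using trunc_tendsto[OF f] by blast
  have "rough_op \<Omega> \<alpha> f x = l"
    unfolding rough_op_def rough_truncated_eq_trunc[OF ae f] by (rule tendsto_Lim[OF _ l]) simp
  thus ?thesis using l by simp
qed

lemma rough_op_measurable: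
  assumes ae: "AE y in lborel. \<Omega> (sgn y) = g (sgn y)" and f: "f \<in> Cc_infinity"
  shows "rough_op \<Omega> \<alpha> f \<in> borel_measurable borel"
proof (rule borel_measurable_LIMSEQ_metric)
  show "trunc (1 / 2 ^ j) f \<in> borel_measurable borel" for j :: nat by (rule borel_measurable_trunc[OF f])
  have "filterlim (\<lambda>j. 1 / 2 ^ j) (at_right (0::real)) sequentially"
    unfolding filterlim_at by (auto intro!: tendsto_eq_intros LIMSEQ_divide_realpow_zero)
  thus "(\<lambda>j. trunc (1 / 2 ^ j) f x) \<longlonglongrightarrow> rough_op \<Omega> \<alpha> f x" for x
    by (rule filterlim_compose[OF rough_op_limit[OF ae f]])
qed

text \<open>
  The exponents fit because \<open>q (1 - \<alpha> p / n) = p\<close>: the power \<open>q\<close> of the pointwise bound contains the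
  maximal function to the power \<open>p / n > 1\<close>.
\<close>

theorem rough_op_strong_bound:
  assumes ae: "AE y in lborel. \<Omega> (sgn y) = g (sgn y)"
    and p: "n < p" "p < n / \<alpha>" and q: "1 / q = 1 / p - \<alpha> / n"
  shows "bounded_from_sobolev p (Lp_norm q) (rough_op \<Omega> \<alpha>)"
proof -
  have n: "n > 0" using n_ge_1 by simp
  have p0: "p > 0" using p n by simp
  define \<theta> where "\<theta> = \<alpha> * p / n"
  have \<theta>: "0 < \<theta>" "\<theta> < 1" using p p0 n \<alpha> by (auto simp: \<theta>_def field_simps)
  have q1: "1 / q = (1 - \<theta>) / p" using q n p0 by (simp add: \<theta>_def field_simps)
  have "q \<noteq> 0" using q1 \<theta> p0 by auto
  hence qe: "q * (1 - \<theta>) = p" using q1 p0 by (simp add: field_simps)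
  hence q0: "q > 0" using \<theta> p0 by (smt (verit) mult_nonpos_nonneg)
  obtain C where C: "C > 0" "\<And>f x P l. f \<in> Cc_infinity \<Longrightarrow> ((\<lambda>\<epsilon>. trunc \<epsilon> f x) \<longlongrightarrow> l) (at_right 0) \<Longrightarrow> P \<ge> 0 \<Longrightarrow>
     (\<integral>\<^sup>+y. ennreal (norm (gradient f y) powr p) \<partial>lborel) = ennreal (P powr p) \<Longrightarrow>
     norm l \<le> C * maximal_gradient f x powr ((1 - \<alpha> * p / n) / n) * P powr (\<alpha> * p / n)"
    using p by (rule_tac limit_pointwise_bound[of p]) (auto intro: less_imp_le)
  have "p / n > 1" using p n by simp
  then obtain Cm where Cm: "Cm > 0" "\<And>H :: real^'n \<Rightarrow> real. H \<in> borel_measurable borel \<Longrightarrow> (\<And>x. H x \<ge> 0) \<Longrightarrow>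
    (\<integral>\<^sup>+x. ennreal (enn2real (dyadic_maximal (\<lambda>x. ennreal (H x)) x) powr (p/n)) \<partial>lborel)
      \<le> ennreal Cm * (\<integral>\<^sup>+x. ennreal (H x powr (p/n)) \<partial>lborel)"
    by (rule dyadic_maximal_strong_type) blast
  define K where "K = C * Cm powr (1/q)"
  have K: "K \<ge> 0" using C by (simp add: K_def)
  show ?thesis
    unfolding bounded_from_sobolev_def
  proof (intro exI[of _ K] ballI conjI)
    fix f :: "real ^ 'n \<Rightarrow> complex" assume f: "f \<in> Cc_infinity"
    show "rough_op \<Omega> \<alpha> f \<in> borel_measurable lebesgue"
      using rough_op_measurable[OF ae f] by (intro measurable_completion) simp
    have gm [measurable]: "gradient f \<in> borel_measurable borel" by (rule borel_measurable_gradient[OF f])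
    obtain P where P: "P \<ge> 0" "(\<integral>\<^sup>+y. ennreal (norm (gradient f y) powr p) \<partial>lborel) = ennreal (P powr p)"
      "Lp_norm p (gradient f) = ennreal P"
      using Cc_infinity_gradient_Lp[OF f p0] by metis
    let ?m = "maximal_gradient f"
    have pt: "norm (rough_op \<Omega> \<alpha> f x) powr q \<le> C powr q * P powr (\<theta> * q) * ?m x powr (p / n)" for x
    proof -
      have "norm (rough_op \<Omega> \<alpha> f x) \<le> C * ?m x powr ((1 - \<theta>) / n) * P powr \<theta>"
        unfolding \<theta>_def by (rule C(2)[OF f rough_op_limit[OF ae f] P(1,2)])
      hence "norm (rough_op \<Omega> \<alpha> f x) powr q \<le> (C * ?m x powr ((1 - \<theta>) / n) * P powr \<theta>) powr q"
        using q0 by (intro powr_mono2) auto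
      also have "\<dots> = C powr q * ?m x powr ((1 - \<theta>) / n * q) * P powr (\<theta> * q)"
        using C by (simp add: powr_mult powr_powr)
      also have "(1 - \<theta>) / n * q = p / n" using qe by (simp add: mult.commute)
      finally show ?thesis by (simp add: mult_ac)
    qed
    have "(\<integral>\<^sup>+x. ennreal (norm (rough_op \<Omega> \<alpha> f x) powr q) \<partial>lebesgue) \<le> (\<integral>\<^sup>+x. ennreal (C powr q * P powr (\<theta> * q) * ?m x powr (p / n)) \<partial>lebesgue)"
      by (intro nn_integral_mono ennreal_leI pt)
    also have "\<dots> = (\<integral>\<^sup>+x. ennreal (C powr q * P powr (\<theta> * q)) * ennreal (?m x powr (p / n)) \<partial>lborel)"
      unfolding nn_integral_completion by (intro nn_integral_cong ennreal_mult) auto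
    also have "\<dots> = ennreal (C powr q * P powr (\<theta> * q)) * (\<integral>\<^sup>+x. ennreal (?m x powr (p / n)) \<partial>lborel)"
      by (rule nn_integral_cmult) measurable
    also have "\<dots> \<le> ennreal (C powr q * P powr (\<theta> * q)) * (ennreal Cm * (\<integral>\<^sup>+x. ennreal ((norm (gradient f x) powr n) powr (p/n)) \<partial>lborel))"
      by (intro mult_left_mono Cm(2)) auto
    also have "(\<integral>\<^sup>+x. ennreal ((norm (gradient f x) powr n) powr (p/n)) \<partial>lborel) = ennreal (P powr p)"
      using P(2) n by (simp add: powr_powr)
    also have "ennreal (C powr q * P powr (\<theta> * q)) * (ennreal Cm * ennreal (P powr p)) = ennreal ((K * P) powr q)"
    proof -
      have "\<theta> * q + p = q" using qe by (simp add: algebra_simps)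
      hence "P powr (\<theta> * q) * P powr p = P powr q" by (simp add: powr_add[symmetric])
      moreover have "K powr q = C powr q * Cm"
        using C Cm q0 by (simp add: K_def powr_mult powr_powr)
      ultimately have "(K * P) powr q = C powr q * P powr (\<theta> * q) * (Cm * P powr p)"
        using K P(1) by (simp add: powr_mult)
      thus ?thesis using C Cm by (simp add: ennreal_mult)
    qed
    finally have "Lp_norm q (rough_op \<Omega> \<alpha> f) \<le> ennreal (K * P)"
      unfolding Lp_norm_def using K P(1) q0 by (intro ennreal_powr_root_le) auto
    thus "Lp_norm q (rough_op \<Omega> \<alpha> f) \<le> ennreal K * Lp_norm p (gradient f)"
      using K P by (simp add: ennreal_mult)
  qed
qed

text \<open>
  Here the pointwise bound contains the maximal function of an integrable function to the power
  \<open>(1 - \<alpha>) / n\<close>, and the weak type estimate for that maximal function turns into the one of exponent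
  \<open>n / (1 - \<alpha>)\<close>.
\<close>

theorem rough_op_weak_bound:
  assumes ae: "AE y in lborel. \<Omega> (sgn y) = g (sgn y)"
  shows "bounded_from_sobolev n (weak_Lp_norm (n / (1 - \<alpha>))) (rough_op \<Omega> \<alpha>)"
proof -
  have n: "n > 0" using n_ge_1 by simp
  have pn: "n \<le> n" "n < n / \<alpha>" using n \<alpha> by (auto simp: field_simps)
  define q where "q = n / (1 - \<alpha>)"
  have q: "q > 0" using n \<alpha> by (simp add: q_def)
  have na: "\<alpha> * n / n = \<alpha>" using n by simp
  obtain C where C: "C > 0" "\<And>f x P l. f \<in> Cc_infinity \<Longrightarrow> ((\<lambda>\<epsilon>. trunc \<epsilon> f x) \<longlongrightarrow> l) (at_right 0) \<Longrightarrow> P \<ge> 0 \<Longrightarrow>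
     (\<integral>\<^sup>+y. ennreal (norm (gradient f y) powr n) \<partial>lborel) = ennreal (P powr n) \<Longrightarrow>
     norm l \<le> C * maximal_gradient f x powr ((1 - \<alpha>) / n) * P powr \<alpha>"
    by (rule limit_pointwise_bound[OF pn, unfolded na]) blast
  define C1 where "C1 = 5 ^ DIM(real^'n) * unit_ball_vol DIM(real^'n)"
  have C1: "C1 > 0" by (simp add: C1_def)
  define K where "K = C * C1 powr (1/q)"
  have K: "K \<ge> 0" using C by (simp add: K_def)
  have "bounded_from_sobolev n (weak_Lp_norm q) (rough_op \<Omega> \<alpha>)"
    unfolding bounded_from_sobolev_def
  proof (intro exI[of _ K] ballI conjI)
    fix f :: "real ^ 'n \<Rightarrow> complex" assume f: "f \<in> Cc_infinity"
    show "rough_op \<Omega> \<alpha> f \<in> borel_measurable lebesgue"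
      using rough_op_measurable[OF ae f] by (intro measurable_completion) simp
    have gm [measurable]: "gradient f \<in> borel_measurable borel" by (rule borel_measurable_gradient[OF f])
    obtain P where P: "P \<ge> 0" "(\<integral>\<^sup>+y. ennreal (norm (gradient f y) powr n) \<partial>lborel) = ennreal (P powr n)"
      "Lp_norm n (gradient f) = ennreal P"
      using Cc_infinity_gradient_Lp[OF f n] by metis
    let ?m = "maximal_gradient f"
    let ?M = "dyadic_maximal (\<lambda>y. ennreal (norm (gradient f y) powr n))"
    have pt: "norm (rough_op \<Omega> \<alpha> f x) \<le> C * ?m x powr (1/q) * P powr \<alpha>" for x
      using C(2)[OF f rough_op_limit[OF ae f] P(1,2), of x] by (simp add: q_def)
    have "weak_Lp_norm q (rough_op \<Omega> \<alpha> f) \<le> ennreal (K * P)"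
      unfolding weak_Lp_norm_def
    proof (rule SUP_least)
      fix t :: real assume "t \<in> {0<..}"
      hence t: "t > 0" by simp
      let ?E = "{x. t < norm (rough_op \<Omega> \<alpha> f x)}"
      show "ennreal t * ennreal_powr (emeasure lebesgue ?E) (1/q) \<le> ennreal (K * P)"
      proof (cases "P = 0")
        case True
        have E0: "?E = {}" using t pt True \<alpha> by (auto simp: not_less)
        show ?thesis unfolding E0 by (simp add: ennreal_powr_def)
      next
        case False
        hence P0: "P > 0" using P(1) by simp
        define D where "D = C * P powr \<alpha>"
        have D: "D > 0" using C P0 by (simp add: D_def)
        define r where "r = (t / D) powr q"
        have r: "r > 0" using t D by (simp add: r_def)
        have "?E \<subseteq> {x. ?M x > ennreal r}"
        proof safe
          fix x assume "t < norm (rough_op \<Omega> \<alpha> f x)"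
          also have "\<dots> \<le> C * ?m x powr (1/q) * P powr \<alpha>" by (rule pt)
          finally have "t / D < ?m x powr (1/q)" using D by (simp add: D_def field_simps)
          hence "r < (?m x powr (1/q)) powr q" unfolding r_def using t D q by (intro powr_less_mono2) auto
          hence "r < ?m x" using q by (simp add: powr_powr)
          hence "ennreal r < ennreal (?m x)" using r by (simp add: ennreal_lessI)
          also have "\<dots> \<le> ?M x" by (simp add: ennreal_enn2real_if)
          finally show "ennreal r < ?M x" .
        qed
        moreover have Mm: "{x. ?M x > ennreal r} \<in> sets borel" by measurable
        ultimately have "emeasure lebesgue ?E \<le> emeasure lebesgue {x. ?M x > ennreal r}"
          by (intro emeasure_mono) auto
        also have "\<dots> = emeasure lborel {x. ?M x > ennreal r}" using Mm by simp
        also have "\<dots> \<le> ennreal (C1 / r) * (\<integral>\<^sup>+y. ennreal (norm (gradient f y) powr n) \<partial>lborel)"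
          unfolding C1_def using r by (intro dyadic_maximal_weak_type) auto
        also have "\<dots> = ennreal (C1 / r * P powr n)" unfolding P(2) using C1 r by (subst ennreal_mult) auto
        also have "C1 / r * P powr n = (K * P / t) powr q"
        proof -
          have "\<alpha> * q + n = q" using \<alpha> by (simp add: q_def field_simps)
          hence Pq: "P powr q = P powr (\<alpha> * q) * P powr n" by (simp add: powr_add[symmetric])
          have "K powr q = C powr q * C1" using C C1 q by (simp add: K_def powr_mult powr_powr)
          hence "(K * P / t) powr q = C powr q * C1 * (P powr (\<alpha> * q) * P powr n) / t powr q"
            using K P(1) t by (simp add: powr_divide powr_mult Pq)
          moreover have "r = t powr q / (C powr q * P powr (\<alpha> * q))"
            using t C P(1) by (simp add: r_def D_def powr_divide powr_mult powr_powr)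
          ultimately show ?thesis by (simp add: mult_ac)
        qed
        finally have "ennreal_powr (emeasure lebesgue ?E) (1/q) \<le> ennreal (K * P / t)"
          using K P(1) t q by (intro ennreal_powr_root_le) auto
        hence "ennreal t * ennreal_powr (emeasure lebesgue ?E) (1/q) \<le> ennreal t * ennreal (K * P / t)"
          by (rule mult_left_mono) simp
        also have "\<dots> = ennreal (K * P)" using t K P(1) by (simp add: ennreal_mult[symmetric])
        finally show ?thesis .
      qed
    qed
    thus "weak_Lp_norm q (rough_op \<Omega> \<alpha> f) \<le> ennreal K * Lp_norm n (gradient f)"
      using K P by (simp add: ennreal_mult)
  qed
  thus ?thesis by (simp add: q_def)
qed

end

theorem theorem1p8:
  fixes \<Omega> :: "real ^ 'n \<Rightarrow> complex" and \<alpha> :: real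
  assumes "0 < \<alpha>" and "\<alpha> < 1"
    and "\<Omega> \<in> L_log_L_sphere (1 - 1 / real CARD('n))"
    and "(LINT y|sphere_measure. \<Omega> y) = 0"
  shows "(\<forall>f\<in>Cc_infinity. \<forall>x. \<exists>l. ((\<lambda>\<epsilon>. rough_truncated \<Omega> \<alpha> \<epsilon> f x) \<longlongrightarrow> l) (at_right 0))
    \<and> (\<forall>p q. real CARD('n) < p \<and> p < real CARD('n) / \<alpha> \<and> 1 / q = 1 / p - \<alpha> / real CARD('n)
          \<longrightarrow> bounded_from_sobolev p (Lp_norm q) (rough_op \<Omega> \<alpha>))
    \<and> bounded_from_sobolev (real CARD('n)) (weak_Lp_norm (real CARD('n) / (1 - \<alpha>))) (rough_op \<Omega> \<alpha>)"
proof -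
  obtain g c where rep: "g \<in> borel_measurable borel" "AE y in lborel. \<Omega> (sgn y) = g (sgn y)" "c > 0"
    "(\<integral>\<^sup>+u. ennreal (norm (g u) / c * ln (1 + norm (g u) / c) powr (1 - 1 / real CARD('n))) \<partial>cone_measure) < \<infinity>"
    "(LINT y|sphere_measure. \<Omega> y) = 0 \<Longrightarrow> (LINT u|cone_measure. g u) = 0"
  proof (rule sphere_function_polar[OF assms(3)[unfolded L_log_L_sphere_def]])
    show "(\<lambda>t. t * ln (1 + t) powr (1 - 1 / real CARD('n))) \<in> borel_measurable borel" by measurable
  qed blast
  interpret rough_kernel_cart g c \<alpha> "real CARD('n)"
    by unfold_locales (use rep assms in auto)
  show ?thesis
  proof (intro conjI ballI allI impI)
    fix f :: "real ^ 'n \<Rightarrow> complex" and x assume f: "f \<in> Cc_infinity"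
    show "\<exists>l. ((\<lambda>\<epsilon>. rough_truncated \<Omega> \<alpha> \<epsilon> f x) \<longlongrightarrow> l) (at_right 0)"
      unfolding rough_truncated_eq_trunc[OF rep(2) f] by (rule trunc_tendsto[OF f])
  next
    fix p q assume "real CARD('n) < p \<and> p < real CARD('n) / \<alpha> \<and> 1 / q = 1 / p - \<alpha> / real CARD('n)"
    thus "bounded_from_sobolev p (Lp_norm q) (rough_op \<Omega> \<alpha>)"
      using rough_op_strong_bound[OF rep(2)] by blast
  next
    show "bounded_from_sobolev (real CARD('n)) (weak_Lp_norm (real CARD('n) / (1 - \<alpha>))) (rough_op \<Omega> \<alpha>)"
      by (rule rough_op_weak_bound[OF rep(2)])
  qed
qed

end
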